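(* Fix a prime power $q$. For all modified types $\boldsymbol\mu,\boldsymbol\nu,\boldsymbol\lambda$ there exist polynomials $r_{\boldsymbol\mu,\boldsymbol\nu}^{\boldsymbol\lambda}\in\mathcal{R}_q$, with only finitely many $\boldsymbol\lambda$ giving a nonzero $r_{\boldsymbol\mu,\boldsymbol\nu}^{\boldsymbol\lambda}$ for fixed $\boldsymbol\mu,\boldsymbol\nu$, such that for every integer $m\ge 0$, in $Z(\mathbb{Z}GL_m(\mathbb{F}_q))$, \[ X_{\boldsymbol\mu,m}X_{\boldsymbol\nu,m}=\sum_{\boldsymbol\lambda} r_{\boldsymbol\mu,\boldsymbol\nu}^{\boldsymbol\lambda}([m]_q)\,X_{\boldsymbol\lambda,m}, \] the sum ranging over all modified types $\boldsymbol\lambda$.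
   Context: $q$ is a fixed prime power. For $n\in\mathbb{Z}$ put $[n]_q=(q^n-1)/(q-1)\in\mathbb{Z}[q^{-1}]$ and $[k]_q!=[k]_q[k-1]_q\cdots[1]_q$, $[0]_q!=1$. For $k\ge 0$ let $\binom{x}{k}_q=\frac{x(x-[1]_q)\cdots(x-[k-1]_q)}{q^{k(k-1)/2}[k]_q!}\in\mathbb{Q}[x]$ (equal to $1$ for $k=0$). $\mathcal{R}_q$ denotes the set of $\mathbb{Z}[q,q^{-1}]$-linear combinations of the polynomials $\binom{x}{k}_q$, $k\ge0$ (the ring of quantum integer-valued polynomials specialised at the prime power $q$). Let $\Phi_q$ be the set of monic irreducible polynomials over $\mathbb{F}_q$ other than $t$. The type of $g\in GL_n(\mathbb{F}_q)$ is the function $\boldsymbol\mu$ from $\Phi_q$ to partitions such that the number of parts of $\boldsymbol\mu(r)$ equal to $i$ is the multiplicity of $r(t)^i$ as an elementary divisor of the $\mathbb{F}_q[t]$-module $\mathbb{F}_q^n$ with $t$ acting by $g$; two elements are conjugate iff they have the same type. The modified type of $g$ is obtained from its type by replacing the partition $\boldsymbol\mu(t-1)$ with the partition obtained by subtracting $1$ from each of its parts (and discarding zero parts), leaving $\boldsymbol\mu(r)$ unchanged for $r\ne t-1$. A modified type means any function $\Phi_q\to\{\text{partitions}\}$ with finitely many nonempty values. $X_{\boldsymbol\nu,n}\in Z(\mathbb{Z}GL_n(\mathbb{F}_q))$ is the sum of all elements of $GL_n(\mathbb{F}_q)$ of modified type $\boldsymbol\nu$ (zero if there are none). *)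

theory Defs
  imports "Jordan_Normal_Form.Matrix" "HOL-Computational_Algebra.Polynomial_Factorial"
begin

definition qint :: "nat \<Rightarrow> nat \<Rightarrow> rat" where
  "qint q n = (of_nat q ^ n - 1) / (of_nat q - 1)"

definition qfact :: "nat \<Rightarrow> nat \<Rightarrow> rat" where
  "qfact q k = (\<Prod>j\<in>{1..k}. qint q j)"

definition qbinom_poly :: "nat \<Rightarrow> nat \<Rightarrow> rat poly" where
  "qbinom_poly q k = smult (1 / (of_nat q ^ (k * (k - 1) div 2) * qfact q k))
      (\<Prod>j<k. [:- qint q j, 1:])"

text \<open>The ring Z[q,q^-1] specialised at the number q, inside Q.\<close>
definition laurent_ints :: "nat \<Rightarrow> rat set" where
  "laurent_ints q = {x. \<exists>(a::int) (k::nat). x = of_int a / of_nat q ^ k}"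

definition Rq :: "nat \<Rightarrow> rat poly set" where
  "Rq q = {p. \<exists>(K::nat) (c::nat \<Rightarrow> rat). (\<forall>k<K. c k \<in> laurent_ints q) \<and>
                 p = (\<Sum>k<K. smult (c k) (qbinom_poly q k))}"

definition GL :: "nat \<Rightarrow> 'a::field mat set" where
  "GL n = {A \<in> carrier_mat n n. invertible_mat A}"

definition companion_mat :: "'a::field poly \<Rightarrow> 'a mat" where
  "companion_mat p = (let d = degree p in
     mat d d (\<lambda>(i,j). if j = d - 1 then - coeff p i else if i = j + 1 then 1 else 0))"

definition Phi :: "'a::field poly set" where
  "Phi = {r. lead_coeff r = 1 \<and> irreducible r \<and> r \<noteq> [:0, 1:]}"

text \<open>Elementary divisors of the F[t]-module F^n (t acting by g), as the multiset of
  pairs (r,i) standing for r^i: the unique multiset of prime powers such that g is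
  similar to the block-diagonal matrix of the companion matrices of those prime powers
  (i.e. F^n decomposes as the direct sum of the cyclic modules F[t]/(r^i)).\<close>
definition elem_divs :: "'a::field mat \<Rightarrow> ('a poly \<times> nat) multiset" where
  "elem_divs g = (THE D. (\<forall>x\<in>#D. lead_coeff (fst x) = 1 \<and> irreducible (fst x) \<and> snd x \<ge> 1) \<and>
      (\<exists>xs. mset xs = D \<and>
        similar_mat g (diag_block_mat (map (\<lambda>(r,i). companion_mat (r ^ i)) xs))))"

text \<open>Partitions are represented as multisets of positive naturals (their parts).
  The type of g: r maps to the partition with (number of parts equal to i) =
  (multiplicity of r^i among the elementary divisors).\<close>
definition type_of :: "'a::field mat \<Rightarrow> 'a poly \<Rightarrow> nat multiset" where
  "type_of g r = image_mset snd (filter_mset (\<lambda>x. fst x = r) (elem_divs g))"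

definition mod_type_of :: "'a::field mat \<Rightarrow> 'a poly \<Rightarrow> nat multiset" where
  "mod_type_of g r = (if r = [:-1, 1:]
      then filter_mset (\<lambda>i. i \<noteq> 0) (image_mset (\<lambda>i. i - 1) (type_of g r))
      else type_of g r)"

text \<open>A modified type: function from Phi_q to partitions, finitely many nonempty values
  (represented as a function on all polynomials which is empty outside Phi_q).\<close>
definition is_mod_type :: "('a::field poly \<Rightarrow> nat multiset) \<Rightarrow> bool" where
  "is_mod_type \<nu> \<longleftrightarrow> (\<forall>r. \<nu> r \<noteq> {#} \<longrightarrow> r \<in> Phi) \<and> (\<forall>r. 0 \<notin># \<nu> r) \<and>
      finite {r. \<nu> r \<noteq> {#}}"

text \<open>Elements of the group algebra are coefficient functions on matrices (supported on GL n).\<close>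
definition X_class :: "nat \<Rightarrow> ('a::field poly \<Rightarrow> nat multiset) \<Rightarrow> 'a mat \<Rightarrow> rat" where
  "X_class n \<nu> g = (if g \<in> GL n \<and> mod_type_of g = \<nu> then 1 else 0)"

definition ga_mult :: "nat \<Rightarrow> ('a::field mat \<Rightarrow> rat) \<Rightarrow> ('a mat \<Rightarrow> rat) \<Rightarrow> 'a mat \<Rightarrow> rat" where
  "ga_mult n X Y g = (if g \<in> GL n then
      (\<Sum>h\<in>GL n. \<Sum>k\<in>GL n. if h * k = g then X h * Y k else 0) else 0)"

end

theory Submission
  imports Defs "Jordan_Normal_Form.Determinant"
begin

text \<open>
  Write \<open>h = 1 + B C\<close> with \<open>B\<close> injective of size \<open>m \<times> a\<close> and \<open>C\<close> surjective of size \<open>a \<times> m\<close>. The modified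
  type of \<open>h\<close> is the type of \<open>1 + C B\<close>, a matrix whose size \<open>a\<close> does not depend on \<open>m\<close>, and every
  matrix of the modified type of \<open>g\<^sub>0\<close> and of size \<open>m \<ge> m\<^sub>0\<close> is conjugate to \<open>g\<^sub>0 \<oplus> 1\<close>. A factorisation
  \<open>g\<^sub>0 \<oplus> 1\<^sub>n = (1 + B C) (1 + D E)\<close> is encoded by \<open>S = [B D]\<close> and by \<open>T\<close>, which is \<open>C\<close> on top of \<open>E\<close>; it is
  determined up to two general linear groups of fixed size. After splitting \<open>S\<close> and \<open>T\<close> along
  \<open>F ^ m\<^sub>0 \<oplus> F ^ n\<close>, all conditions on the parts \<open>S\<^sub>1\<close>, \<open>T\<^sub>1\<close> that depend on \<open>n\<close> concern only the kernel of
  \<open>S\<^sub>1\<close>, the image of \<open>T\<^sub>1\<close> and the product \<open>T\<^sub>1 S\<^sub>1\<close>, so the number of factorisations is a polynomial in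
  \<open>q ^ n\<close> with rational coefficients. Finally, a polynomial that takes values in \<open>Z[1/q]\<close> at \<open>[m]\<close> for
  all large \<open>m\<close> takes such values for all \<open>m \<ge> 0\<close>, hence lies in the span of the q-binomials.
\<close>

section \<open>Values at quantum integers\<close>

text \<open>Counting yields only rational coefficients: it divides by the orders of two general
  linear groups and, when the \<open>T\<close> with a given product \<open>T S\<close> are counted,
  by the number of attainable products. Integrality is therefore recovered from values, and counting
  makes these integral only at sizes where the type of the product occurs; hence the descent to
  small \<open>m\<close>. The shift by one in the modified type comes from
  \<open>(B C) ^ (j + 1) = B (C B) ^ j C\<close> with \<open>B\<close> injective and
  \<open>C\<close> surjective: a kernel at exponent \<open>j + 1\<close> for \<open>1 + B C\<close>
  is an extension of the kernel at exponent \<open>j\<close> for \<open>1 + C B\<close>. Types rest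
  on a definite description, so existence and uniqueness of the primary rational form must be
  established; over a finite field, cardinalities of kernels and of vector spaces stand in for
  dimensions. Only finitely many types occur in a product because the rank of \<open>g - 1\<close>
  is at most \<open>a + b\<close> for \<open>g = h k\<close>.\<close>

lemma qint_0 [simp]: "qint q 0 = 0"
  by (simp add: qint_def)

lemma qint_Suc: "q \<ge> 2 \<Longrightarrow> qint q (Suc n) = of_nat q * qint q n + 1"
  by (simp add: qint_def field_simps)

lemma qint_strict_mono:
  assumes "q \<ge> 2"
  shows "strict_mono (qint q)"
unfolding strict_mono_Suc_iff
proof
  fix n
  have "(1::rat) \<le> of_nat q ^ n"
    using assms by (intro one_le_power) simp
  hence "qint q n \<ge> 0"
    using assms by (simp add: qint_def)
  moreover have "1 * qint q n \<le> of_nat q * qint q n"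
    using assms calculation by (intro mult_right_mono) simp_all
  ultimately show "qint q n < qint q (Suc n)"
    unfolding qint_Suc[OF assms] by linarith
qed

lemma qint_pos: "q \<ge> 2 \<Longrightarrow> qint q (Suc n) > 0"
  using strict_mono_less[OF qint_strict_mono, of q 0 "Suc n"] by simp

lemma qbinom_poly_0 [simp]: "qbinom_poly q 0 = 1"
  by (simp add: qbinom_poly_def qfact_def)

lemma degree_qbinom_poly_le: "degree (qbinom_poly q k) \<le> k"
proof -
  have "degree (\<Prod>j<k. [:- qint q j, 1:]) \<le> sum (degree \<circ> (\<lambda>j. [:- qint q j, 1:])) {..<k}"
    by (rule degree_prod_sum_le) simp
  also have "\<dots> = k"
    by simp
  finally show ?thesis
    unfolding qbinom_poly_def by (rule le_trans[OF degree_smult_le])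
qed

lemma qbinom_poly_eq_0:
  assumes "n < k"
  shows "poly (qbinom_poly q k) (qint q n) = 0"
  using assms by (auto simp: qbinom_poly_def poly_prod intro!: prod_zero)

text \<open>The q-Pascal rule: \<open>x \<mapsto> q x + 1\<close> sends \<open>[j]\<close> to
  \<open>[j + 1]\<close>, so it carries the roots of one q-binomial to all but the first root of the
  next. Integrality at the nodes and the value 1 at \<open>[k]\<close> follow from it by
  induction.\<close>

lemma qbinom_poly_shift:
  assumes q: "q \<ge> 2"
  shows "poly (qbinom_poly q (Suc k)) (of_nat q * x + 1) =
    poly (qbinom_poly q k) x + of_nat q ^ Suc k * poly (qbinom_poly q (Suc k)) x"
proof -
  define c where "c k = of_nat q ^ (k * (k - 1) div 2) * qfact q k" for k
  define P where "P k x = (\<Prod>j<k. x - qint q j)" for k and x :: rat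
  have qb: "poly (qbinom_poly q k) x = P k x / c k" for k x
    by (simp add: qbinom_poly_def c_def P_def poly_prod)
  \<comment> \<open>The exponent is a truncated quotient; it is exact because
    \<open>k * (k - 1)\<close> is even.\<close>
  have "Suc k * k div 2 = k * (k - 1) div 2 + k"
  proof -
    have "even (k * (k - 1))" by (cases k) auto
    moreover have "Suc k * k = k * (k - 1) + 2 * k" by (cases k) auto
    ultimately show ?thesis by presburger
  qed
  hence cS: "c (Suc k) = c k * of_nat q ^ k * qint q (Suc k)"
    by (simp add: c_def qfact_def power_add mult_ac)
  have cpos: "c k > 0" for k
    using q qint_pos[OF q]
    by (auto simp: c_def qfact_def intro!: mult_pos_pos prod_pos dest!: Suc_le_D)
  have P1: "P (Suc k) (of_nat q * x + 1) = (of_nat q * x + 1) * (of_nat q ^ k * P k x)"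
  proof -
    have "P (Suc k) (of_nat q * x + 1) =
        (of_nat q * x + 1) * (\<Prod>j<k. of_nat q * x + 1 - qint q (Suc j))"
      unfolding P_def by (subst prod.lessThan_Suc_shift) simp
    also have "(\<Prod>j<k. of_nat q * x + 1 - qint q (Suc j)) = (\<Prod>j<k. of_nat q * (x - qint q j))"
      using q by (intro prod.cong) (auto simp: qint_Suc algebra_simps)
    also have "\<dots> = of_nat q ^ k * P k x"
      by (simp add: P_def prod.distrib)
    finally show ?thesis .
  qed
  have P2: "P (Suc k) x = P k x * (x - qint q k)"
    by (simp add: P_def)
  \<comment> \<open>In this splitting \<open>[k + 1]\<close> cancels against the new factor of the
    q-factorial, while \<open>x - [k]\<close> completes the longer product; these are the two terms
    of the rule.\<close>
  have id: "of_nat q * x + 1 = qint q (Suc k) + of_nat q * (x - qint q k)"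
    using q by (simp add: qint_Suc algebra_simps)
  have gen: "(s + Q * d) * (Q ^ k * p) / (C * Q ^ k * s) =
      p / C + Q ^ Suc k * (p * d / (C * Q ^ k * s))"
    if "Q \<noteq> 0" "s \<noteq> 0" "C \<noteq> 0" for s Q d p C :: rat
    using that by (simp add: divide_simps) (simp add: algebra_simps)
  have nz: "of_nat q \<noteq> (0::rat)" "qint q (Suc k) \<noteq> 0" "c k \<noteq> 0"
    using cpos[of k] qint_pos[OF q, of k] q by auto
  show ?thesis
    unfolding qb P1 P2 cS by (subst id) (rule gen[OF nz])
qed

lemma qbinom_poly_eq_1:
  assumes q: "q \<ge> 2"
  shows "poly (qbinom_poly q k) (qint q k) = 1"
proof (induction k)
  case (Suc k)
  show ?case
    using qbinom_poly_shift[OF q, of k "qint q k"] Suc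
    by (simp add: qint_Suc[OF q] qbinom_poly_eq_0)
qed simp

section \<open>The coefficient ring and Newton interpolation at the quantum integers\<close>

lemma laurent_ints_of_int [simp]: "of_int a \<in> laurent_ints q"
  unfolding laurent_ints_def by (intro CollectI exI[of _ a] exI[of _ 0]) simp

lemma laurent_ints_add:
  assumes "q > 0" "x \<in> laurent_ints q" "y \<in> laurent_ints q"
  shows "x + y \<in> laurent_ints q"
proof -
  from assms obtain a k b l where "x = of_int a / of_nat q ^ k" "y = of_int b / of_nat q ^ l"
    unfolding laurent_ints_def by blast
  hence "x + y = of_int (a * int q ^ l + b * int q ^ k) / of_nat q ^ (k + l)"
    using assms(1) by (simp add: add_divide_distrib power_add)
  thus ?thesis
    unfolding laurent_ints_def by blast
qed

lemma laurent_ints_mult: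
  assumes "x \<in> laurent_ints q" "y \<in> laurent_ints q"
  shows "x * y \<in> laurent_ints q"
proof -
  from assms obtain a k b l where "x = of_int a / of_nat q ^ k" "y = of_int b / of_nat q ^ l"
    unfolding laurent_ints_def by blast
  hence "x * y = of_int (a * b) / of_nat q ^ (k + l)"
    by (simp add: power_add)
  thus ?thesis
    unfolding laurent_ints_def by blast
qed

lemma laurent_ints_diff:
  assumes "q > 0" "x \<in> laurent_ints q" "y \<in> laurent_ints q"
  shows "x - y \<in> laurent_ints q"
  using laurent_ints_add[OF assms(1,2) laurent_ints_mult[OF laurent_ints_of_int[of "-1"] assms(3)]]
  by simp

lemma laurent_ints_power: "of_nat q ^ k \<in> laurent_ints q"
  using laurent_ints_of_int[of "int q ^ k"] by simp

lemma laurent_ints_sum: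
  assumes "q > 0" "\<And>i. i \<in> I \<Longrightarrow> f i \<in> laurent_ints q"
  shows "sum f I \<in> laurent_ints q"
  using assms(2)
proof (induction I rule: infinite_finite_induct)
  case (insert x F)
  thus ?case using laurent_ints_add[OF assms(1)] by simp
qed (use laurent_ints_of_int[of 0] in simp_all)

lemma laurent_ints_cancel_power:
  assumes "q > 0" "of_nat q ^ d * x \<in> laurent_ints q"
  shows "x \<in> laurent_ints q"
proof -
  from assms(2) obtain a k where "of_nat q ^ d * x = of_int a / of_nat q ^ k"
    unfolding laurent_ints_def by blast
  hence "x = of_int a / of_nat q ^ (k + d)"
    using assms(1) by (simp add: field_simps power_add)
  thus ?thesis
    unfolding laurent_ints_def by blast
qed

lemma qbinom_poly_laurent:
  assumes q: "q \<ge> 2"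
  shows "poly (qbinom_poly q k) (qint q n) \<in> laurent_ints q"
proof (induction n arbitrary: k)
  case 0
  show ?case
    using qbinom_poly_eq_0[of 0 k q] laurent_ints_of_int[of 0 q] laurent_ints_of_int[of 1 q]
    by (cases k) auto
next
  case (Suc n)
  show ?case
  proof (cases k)
    case 0
    thus ?thesis using laurent_ints_of_int[of 1 q] by simp
  next
    case [simp]: (Suc j)
    show ?thesis
      unfolding Suc qint_Suc[OF q] qbinom_poly_shift[OF q]
      using q Suc.IH by (intro laurent_ints_add laurent_ints_mult laurent_ints_power) auto
  qed
qed

text \<open>Newton interpolation at the nodes \<open>[0], [1], ...\<close>: the q-binomials are
  triangular there with diagonal entries 1, so each coefficient is a value of \<open>p\<close> minus
  a combination of earlier coefficients and stays in the ring.\<close>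

lemma Rq_if_laurent_values:
  assumes q: "q \<ge> 2" and p: "\<And>n. poly p (qint q n) \<in> laurent_ints q"
  shows "p \<in> Rq q"
proof -
  have "\<exists>c. (\<forall>k<K. c k \<in> laurent_ints q) \<and>
      (\<forall>n<K. poly (p - (\<Sum>k<K. smult (c k) (qbinom_poly q k))) (qint q n) = 0)" for K
  proof (induction K)
    case (Suc K)
    then obtain c where c: "\<And>k. k < K \<Longrightarrow> c k \<in> laurent_ints q"
      "\<And>n. n < K \<Longrightarrow> poly (p - (\<Sum>k<K. smult (c k) (qbinom_poly q k))) (qint q n) = 0"
      by blast
    define a where "a = poly (p - (\<Sum>k<K. smult (c k) (qbinom_poly q k))) (qint q K)"
    have "a \<in> laurent_ints q"
      using q p c(1) qbinom_poly_laurent[OF q]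
      by (auto simp: a_def poly_sum intro!: laurent_ints_diff laurent_ints_sum laurent_ints_mult)
    moreover have "poly (p - (\<Sum>k<Suc K. smult ((c(K := a)) k) (qbinom_poly q k))) (qint q n) = 0"
      if "n < Suc K" for n
    proof -
      have "(\<Sum>k<Suc K. smult ((c(K := a)) k) (qbinom_poly q k)) =
          (\<Sum>k<K. smult (c k) (qbinom_poly q k)) + smult a (qbinom_poly q K)"
        by simp
      thus ?thesis
        using that c(2)[of n] qbinom_poly_eq_0[of n K q] qbinom_poly_eq_1[OF q, of K]
        by (cases "n = K") (auto simp: a_def)
    qed
    ultimately show ?case
      using c(1) by (intro exI[of _ "c(K := a)"]) (auto simp: less_Suc_eq)
  qed simp
  then obtain c where c: "\<And>k. k < Suc (degree p) \<Longrightarrow> c k \<in> laurent_ints q"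
    "\<And>n. n < Suc (degree p) \<Longrightarrow>
       poly (p - (\<Sum>k<Suc (degree p). smult (c k) (qbinom_poly q k))) (qint q n) = 0"
    by meson
  define r where "r = p - (\<Sum>k<Suc (degree p). smult (c k) (qbinom_poly q k))"
  have "degree (\<Sum>k<Suc (degree p). smult (c k) (qbinom_poly q k)) \<le> degree p"
  proof (rule degree_sum_le)
    fix k assume "k \<in> {..<Suc (degree p)}"
    thus "degree (smult (c k) (qbinom_poly q k)) \<le> degree p"
      using degree_smult_le[of "c k" "qbinom_poly q k"] degree_qbinom_poly_le[of q k] by simp
  qed simp
  hence deg: "degree r \<le> degree p"
    unfolding r_def by (intro degree_diff_le) auto
  \<comment> \<open>The remainder has degree at most \<open>degree p\<close> and vanishes at
    \<open>degree p + 1\<close> distinct nodes.\<close>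
  have "r = 0"
  proof (rule ccontr)
    assume r: "r \<noteq> 0"
    have "qint q ` {..degree p} \<subseteq> {x. poly r x = 0}"
      using c(2) by (auto simp: r_def)
    hence "card (qint q ` {..degree p}) \<le> card {x. poly r x = 0}"
      by (intro card_mono poly_roots_finite r)
    also have "card (qint q ` {..degree p}) = Suc (degree p)"
      using strict_mono_imp_inj_on[OF qint_strict_mono[OF q]]
      by (subst card_image) (auto intro: inj_on_subset)
    also have "card {x. poly r x = 0} \<le> degree r"
      by (rule card_poly_roots_bound[OF r])
    finally show False using deg by simp
  qed
  hence "p = (\<Sum>k<Suc (degree p). smult (c k) (qbinom_poly q k))"
    by (simp add: r_def)
  thus ?thesis
    using c(1) unfolding Rq_def by blast
qed

text \<open>The twisted difference \<open>p(q x + 1) - q ^ d p(x)\<close> kills the leading term, and \<open>q\<close> is a unit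
  of the coefficient ring, so integrality propagates downwards from \<open>[n + 1]\<close> to \<open>[n]\<close>.\<close>

lemma laurent_values_downward:
  assumes q: "q \<ge> 2" and "degree p \<le> d" and "\<And>n. n > N \<Longrightarrow> poly p (qint q n) \<in> laurent_ints q"
  shows "poly p (qint q N) \<in> laurent_ints q"
  using assms(2,3)
proof (induction d arbitrary: p N)
  case 0
  then obtain a where "p = [:a:]"
    by (metis degree_0_id le_zero_eq)
  thus ?case using 0(2)[of "Suc N"] by simp
next
  case (Suc d)
  show ?case
  proof (cases "degree p \<le> d")
    case True
    thus ?thesis using Suc by blast
  next
    case False
    hence dp: "degree p = Suc d"
      using Suc.prems by simp
    define r where "r = pcompose p [:1, of_nat q:] - smult (of_nat q ^ Suc d) p"
    have q0: "q > 0" using q by simp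
    have dc: "degree (pcompose p [:1, of_nat q:]) = Suc d"
      using q0 by (simp add: degree_pcompose dp)
    have "coeff (pcompose p [:1, of_nat q:]) (Suc d) = of_nat q ^ Suc d * coeff p (Suc d)"
      using lead_coeff_comp[of "[:1, of_nat q:]" p] dc dp q0 by (simp add: mult_ac)
    hence "coeff r (Suc d) = 0"
      by (simp add: r_def)
    moreover have "degree r \<le> Suc d"
      unfolding r_def by (intro degree_diff_le) (simp_all add: dc dp)
    ultimately have dr: "degree r \<le> d"
      by (intro degree_le allI impI) (metis Suc_lessI coeff_eq_0 le_less_trans)
    have r: "poly r (qint q n) = poly p (qint q (Suc n)) - of_nat q ^ Suc d * poly p (qint q n)" for n
      by (simp add: r_def poly_pcompose qint_Suc[OF q] algebra_simps)
    have "poly r (qint q n) \<in> laurent_ints q" if "n > N" for n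
      unfolding r using q that Suc.prems(2)
      by (intro laurent_ints_diff laurent_ints_mult laurent_ints_power) auto
    hence "poly r (qint q N) \<in> laurent_ints q"
      using dr Suc.IH by blast
    hence "poly p (qint q (Suc N)) - poly r (qint q N) \<in> laurent_ints q"
      using q Suc.prems(2) by (intro laurent_ints_diff) auto
    hence "of_nat q ^ Suc d * poly p (qint q N) \<in> laurent_ints q"
      by (simp add: r)
    thus ?thesis
      by (rule laurent_ints_cancel_power[OF q0])
  qed
qed

text \<open>Writing the bound as \<open>n + j \<ge> n0\<close> lets an induction on \<open>j\<close>
  lower the threshold one node at a time without truncated subtraction.\<close>

lemma Rq_if_eventually_laurent_values:
  assumes q: "q \<ge> 2" and p: "\<And>n. n \<ge> n0 \<Longrightarrow> poly p (qint q n) \<in> laurent_ints q"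
  shows "p \<in> Rq q"
proof (rule Rq_if_laurent_values[OF q])
  have "\<forall>n. n + j \<ge> n0 \<longrightarrow> poly p (qint q n) \<in> laurent_ints q" for j
  proof (induction j)
    case 0
    thus ?case using p by simp
  next
    case (Suc j)
    show ?case
    proof (intro allI impI)
      fix n assume n: "n0 \<le> n + Suc j"
      show "poly p (qint q n) \<in> laurent_ints q"
      proof (rule laurent_values_downward[OF q order_refl])
        fix n' assume "n < n'"
        hence "n0 \<le> n' + j" using n by linarith
        thus "poly p (qint q n') \<in> laurent_ints q" using Suc by blast
      qed
    qed
  qed
  from this[of n0] show "poly p (qint q n) \<in> laurent_ints q" for n
    by simp
qed

section \<open>Block matrices and full rank factorisations\<close>

lemma four_block_mult_0:
  fixes A :: "'a::comm_ring_1 mat"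
  assumes "A \<in> carrier_mat a a" "D \<in> carrier_mat b b" "A' \<in> carrier_mat a a" "D' \<in> carrier_mat b b"
  shows "four_block_mat A (0\<^sub>m a b) (0\<^sub>m b a) D * four_block_mat A' (0\<^sub>m a b) (0\<^sub>m b a) D' =
    four_block_mat (A * A') (0\<^sub>m a b) (0\<^sub>m b a) (D * D')"
  using assms by (subst mult_four_block_mat) auto

lemma mult_cancel_one:
  fixes X :: "'a::comm_ring_1 mat"
  assumes "X \<in> carrier_mat r n" "Y \<in> carrier_mat n r" "Z \<in> carrier_mat r k" "X * Y = 1\<^sub>m r"
  shows "X * (Y * Z) = Z"
  using assms assoc_mult_mat[OF assms(1-3)] by simp

lemma mult_mat_unit_vec:
  assumes "(A :: 'a::comm_ring_1 mat) \<in> carrier_mat n m" "j < m"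
  shows "A *\<^sub>v unit_vec m j = col A j"
  using assms by (intro eq_vecI) auto

text \<open>A four-block matrix with an empty lower row, so that the product rule for block matrices
  applies to juxtaposition; dually for \<open>vcat\<close>.\<close>

definition hcat :: "'a::zero mat \<Rightarrow> 'a mat \<Rightarrow> 'a mat" where
  "hcat A B = four_block_mat A B (0\<^sub>m 0 (dim_col A)) (0\<^sub>m 0 (dim_col B))"

definition vcat :: "'a::zero mat \<Rightarrow> 'a mat \<Rightarrow> 'a mat" where
  "vcat A B = four_block_mat A (0\<^sub>m (dim_row A) 0) B (0\<^sub>m (dim_row B) 0)"

lemma dim_hcat [simp]:
  "dim_row (hcat A B) = dim_row A" "dim_col (hcat A B) = dim_col A + dim_col B"
  by (simp_all add: hcat_def)

lemma dim_vcat [simp]: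
  "dim_row (vcat A B) = dim_row A + dim_row B" "dim_col (vcat A B) = dim_col A"
  by (simp_all add: vcat_def)

lemma hcat_carrier [simp, intro]:
  "A \<in> carrier_mat n a \<Longrightarrow> B \<in> carrier_mat n b \<Longrightarrow> hcat A B \<in> carrier_mat n (a + b)"
  by (intro carrier_matI) simp_all

lemma vcat_carrier [simp, intro]:
  "A \<in> carrier_mat a n \<Longrightarrow> B \<in> carrier_mat b n \<Longrightarrow> vcat A B \<in> carrier_mat (a + b) n"
  by (intro carrier_matI) simp_all

lemma index_hcat:
  "A \<in> carrier_mat n a \<Longrightarrow> B \<in> carrier_mat n b \<Longrightarrow> i < n \<Longrightarrow> j < a + b \<Longrightarrow>
    hcat A B $$ (i, j) = (if j < a then A $$ (i, j) else B $$ (i, j - a))"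
  by (auto simp: hcat_def)

lemma index_vcat:
  "A \<in> carrier_mat a n \<Longrightarrow> B \<in> carrier_mat b n \<Longrightarrow> i < a + b \<Longrightarrow> j < n \<Longrightarrow>
    vcat A B $$ (i, j) = (if i < a then A $$ (i, j) else B $$ (i - a, j))"
  by (auto simp: vcat_def)

lemma col_hcat:
  assumes "A \<in> carrier_mat n a" "B \<in> carrier_mat n b" "j < a + b"
  shows "col (hcat A B) j = (if j < a then col A j else col B (j - a))"
  using assms by (cases "j < a"; intro eq_vecI) (simp_all add: index_hcat[OF assms(1,2)])

lemma row_vcat:
  assumes "A \<in> carrier_mat a n" "B \<in> carrier_mat b n" "i < a + b"
  shows "row (vcat A B) i = (if i < a then row A i else row B (i - a))"
  using assms by (cases "i < a"; intro eq_vecI) (simp_all add: index_vcat[OF assms(1,2)])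

lemma mult_hcat:
  fixes A :: "'a::comm_ring_1 mat"
  assumes A: "A \<in> carrier_mat n k" and B: "B \<in> carrier_mat k a" and C: "C \<in> carrier_mat k b"
  shows "A * hcat B C = hcat (A * B) (A * C)"
proof (rule eq_matI)
  have AB: "A * B \<in> carrier_mat n a" and AC: "A * C \<in> carrier_mat n b"
    using A B C by auto
  fix i j assume "i < dim_row (hcat (A * B) (A * C))" "j < dim_col (hcat (A * B) (A * C))"
  hence ij: "i < n" "j < a + b" using A B C by simp_all
  show "(A * hcat B C) $$ (i, j) = hcat (A * B) (A * C) $$ (i, j)"
    using A B C ij by (simp add: index_hcat[OF AB AC] col_hcat[OF B C])
qed (use A in simp_all)

lemma vcat_mult:
  fixes A :: "'a::comm_ring_1 mat"
  assumes A: "A \<in> carrier_mat a k" and B: "B \<in> carrier_mat b k" and C: "C \<in> carrier_mat k n"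
  shows "vcat A B * C = vcat (A * C) (B * C)"
proof (rule eq_matI)
  have AC: "A * C \<in> carrier_mat a n" and BC: "B * C \<in> carrier_mat b n"
    using A B C by auto
  fix i j assume "i < dim_row (vcat (A * C) (B * C))" "j < dim_col (vcat (A * C) (B * C))"
  hence ij: "i < a + b" "j < n" using A B C by simp_all
  show "(vcat A B * C) $$ (i, j) = vcat (A * C) (B * C) $$ (i, j)"
    using A B C ij by (simp add: index_vcat[OF AC BC] row_vcat[OF A B])
qed (use C in simp_all)

lemma hcat_mult_vcat:
  fixes A :: "'a::comm_ring_1 mat"
  assumes "A \<in> carrier_mat n a" "B \<in> carrier_mat n b" "C \<in> carrier_mat a k" "D \<in> carrier_mat b k"
  shows "hcat A B * vcat C D = A * C + B * D"
proof -
  have "hcat A B * vcat C D = four_block_mat (A * C + B * D) (A * 0\<^sub>m a 0 + B * 0\<^sub>m b 0)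
      (0\<^sub>m 0 a * C + 0\<^sub>m 0 b * D) (0\<^sub>m 0 a * 0\<^sub>m a 0 + 0\<^sub>m 0 b * 0\<^sub>m b 0)"
    unfolding hcat_def vcat_def using assms
    by (subst mult_four_block_mat[where ?n1.0 = a and ?n2.0 = b]) auto
  also have "\<dots> = A * C + B * D"
    using assms by (intro eq_matI) auto
  finally show ?thesis .
qed

lemma vcat_mult_hcat:
  fixes A :: "'a::comm_ring_1 mat"
  assumes "A \<in> carrier_mat a k" "B \<in> carrier_mat b k" "C \<in> carrier_mat k c" "D \<in> carrier_mat k d"
  shows "vcat A B * hcat C D = four_block_mat (A * C) (A * D) (B * C) (B * D)"
proof -
  have "vcat A B * hcat C D = four_block_mat (A * C + 0\<^sub>m a 0 * 0\<^sub>m 0 c) (A * D + 0\<^sub>m a 0 * 0\<^sub>m 0 d)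
      (B * C + 0\<^sub>m b 0 * 0\<^sub>m 0 c) (B * D + 0\<^sub>m b 0 * 0\<^sub>m 0 d)"
    unfolding hcat_def vcat_def using assms
    by (subst mult_four_block_mat[where ?n1.0 = k and ?n2.0 = 0]) auto
  also have "\<dots> = four_block_mat (A * C) (A * D) (B * C) (B * D)"
    using assms by simp
  finally show ?thesis .
qed

lemma hcat_split:
  assumes "S \<in> carrier_mat n (a + b)"
  shows "\<exists>A B. A \<in> carrier_mat n a \<and> B \<in> carrier_mat n b \<and> S = hcat A B"
proof (intro exI conjI)
  show "S = hcat (mat n a (\<lambda>(i, j). S $$ (i, j))) (mat n b (\<lambda>(i, j). S $$ (i, a + j)))"
    using assms by (intro eq_matI) (auto simp: hcat_def)
qed auto

lemma vcat_split:
  assumes "S \<in> carrier_mat (a + b) n"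
  shows "\<exists>A B. A \<in> carrier_mat a n \<and> B \<in> carrier_mat b n \<and> S = vcat A B"
proof (intro exI conjI)
  show "S = vcat (mat a n (\<lambda>(i, j). S $$ (i, j))) (mat b n (\<lambda>(i, j). S $$ (a + i, j)))"
    using assms by (intro eq_matI) (auto simp: vcat_def)
qed auto

lemma hcat_inj:
  assumes "A \<in> carrier_mat n a" "B \<in> carrier_mat n b" "A' \<in> carrier_mat n a" "B' \<in> carrier_mat n b"
    and eq: "hcat A B = hcat A' B'"
  shows "A = A' \<and> B = B'"
proof
  show "A = A'"
  proof (rule eq_matI)
    fix i j assume "i < dim_row A'" "j < dim_col A'"
    thus "A $$ (i, j) = A' $$ (i, j)"
      using index_hcat[OF assms(1,2), of i j] index_hcat[OF assms(3,4), of i j] eq assms by auto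
  qed (use assms in auto)
  show "B = B'"
  proof (rule eq_matI)
    fix i j assume "i < dim_row B'" "j < dim_col B'"
    thus "B $$ (i, j) = B' $$ (i, j)"
      using index_hcat[OF assms(1,2), of i "a + j"] index_hcat[OF assms(3,4), of i "a + j"] eq assms
      by auto
  qed (use assms in auto)
qed

lemma vcat_inj:
  assumes "A \<in> carrier_mat a n" "B \<in> carrier_mat b n" "A' \<in> carrier_mat a n" "B' \<in> carrier_mat b n"
    and eq: "vcat A B = vcat A' B'"
  shows "A = A' \<and> B = B'"
proof
  show "A = A'"
  proof (rule eq_matI)
    fix i j assume "i < dim_row A'" "j < dim_col A'"
    thus "A $$ (i, j) = A' $$ (i, j)"
      using index_vcat[OF assms(1,2), of i j] index_vcat[OF assms(3,4), of i j] eq assms by auto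
  qed (use assms in auto)
  show "B = B'"
  proof (rule eq_matI)
    fix i j assume "i < dim_row B'" "j < dim_col B'"
    thus "B $$ (i, j) = B' $$ (i, j)"
      using index_vcat[OF assms(1,2), of "a + i" j] index_vcat[OF assms(3,4), of "a + i" j] eq assms
      by auto
  qed (use assms in auto)
qed

lemma hcat_four_block:
  fixes A :: "'a::comm_ring_1 mat"
  assumes "A \<in> carrier_mat n a" "B \<in> carrier_mat n b"
    "C \<in> carrier_mat a c" "D \<in> carrier_mat a d" "E \<in> carrier_mat b c" "F \<in> carrier_mat b d"
  shows "hcat A B * four_block_mat C D E F = hcat (A * C + B * E) (A * D + B * F)"
proof -
  have "hcat A B * four_block_mat C D E F = four_block_mat (A * C + B * E) (A * D + B * F)
      (0\<^sub>m 0 a * C + 0\<^sub>m 0 b * E) (0\<^sub>m 0 a * D + 0\<^sub>m 0 b * F)"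
    unfolding hcat_def using assms
    by (subst mult_four_block_mat[where ?n1.0 = a and ?n2.0 = b]) auto
  also have "\<dots> = hcat (A * C + B * E) (A * D + B * F)"
    using assms by (simp add: hcat_def)
  finally show ?thesis .
qed

text \<open>Columns are added one at a time. The new column is \<open>V = B X + W\<close> with
  \<open>B' W = 0\<close>; if \<open>W = 0\<close> the rank stays, otherwise \<open>W\<close>
  becomes a further column of \<open>B\<close>. The one-sided inverses \<open>B'\<close> and
  \<open>C'\<close> are carried along, so full rank never has to be expressed by a rank
  function.\<close>

lemma full_rank_factorization:
  fixes S :: "'a::field mat"
  assumes "S \<in> carrier_mat n m"
  shows "\<exists>r B C B' C'. B \<in> carrier_mat n r \<and> C \<in> carrier_mat r m \<and>
    B' \<in> carrier_mat r n \<and> C' \<in> carrier_mat m r \<and> B' * B = 1\<^sub>m r \<and> C * C' = 1\<^sub>m r \<and> S = B * C"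
  using assms
proof (induction m arbitrary: S)
  case 0
  hence "S = 0\<^sub>m n 0 * 0\<^sub>m 0 0"
    by (intro eq_matI) auto
  thus ?case
    by (intro exI[of _ 0] exI[of _ "0\<^sub>m n 0"] exI[of _ "0\<^sub>m 0 0"] exI[of _ "0\<^sub>m 0 n"]) auto
next
  case (Suc m)
  from Suc.prems obtain S1 V where S1: "S1 \<in> carrier_mat n m" and V: "V \<in> carrier_mat n 1"
    and S: "S = hcat S1 V"
    using hcat_split[of S n m 1] by auto
  obtain r B C B' C' where B: "B \<in> carrier_mat n r" and C: "C \<in> carrier_mat r m"
    and B': "B' \<in> carrier_mat r n" and C': "C' \<in> carrier_mat m r"
    and BB: "B' * B = 1\<^sub>m r" and CC: "C * C' = 1\<^sub>m r" and S1eq: "S1 = B * C"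
    using Suc.IH[OF S1] by blast
  define X where "X = B' * V"
  have X: "X \<in> carrier_mat r 1" using B' V by (simp add: X_def)
  define W where "W = V - B * X"
  have BX: "B * X \<in> carrier_mat n 1" using B X by simp
  have W: "W \<in> carrier_mat n 1" using B X V by (simp add: W_def minus_carrier_mat)
  have V_eq: "V = B * X + W"
    using V BX by (intro eq_matI) (auto simp: W_def)
  have B'W: "B' * W = 0\<^sub>m r 1"
  proof -
    have "B' * (B * X) = X"
      using assoc_mult_mat[OF B' B X] BB X by simp
    moreover have "X - X = 0\<^sub>m r 1" using X by (intro eq_matI) auto
    ultimately show ?thesis
      unfolding W_def by (subst mult_minus_distrib_mat[OF B' V BX]) (simp add: X_def)
  qed
  show ?case
  proof (cases "W = 0\<^sub>m n 1")
    case True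
    hence "V = B * X" using V_eq BX by simp
    hence 1: "S = B * hcat C X"
      unfolding S S1eq using mult_hcat[OF B C X] by simp
    have 2: "hcat C X * vcat C' (0\<^sub>m 1 r) = 1\<^sub>m r"
      using C X C' CC by (subst hcat_mult_vcat[where a = m and b = 1]) auto
    have 3: "hcat C X \<in> carrier_mat r (Suc m)" "vcat C' (0\<^sub>m 1 r) \<in> carrier_mat (Suc m) r"
      using hcat_carrier[OF C X] vcat_carrier[OF C' zero_carrier_mat[of 1 r]] by simp_all
    show ?thesis
      by (intro exI[of _ r] exI[of _ B] exI[of _ "hcat C X"] exI[of _ B']
            exI[of _ "vcat C' (0\<^sub>m 1 r)"] conjI) (fact B 1 2 3 B' BB)+
  next
    case False
    then obtain i where i: "i < n" "W $$ (i, 0) \<noteq> 0"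
      using W by (metis One_nat_def carrier_matD eq_matI index_zero_mat less_Suc0)
    \<comment> \<open>A functional with value 1 on \<open>W\<close>, supported at one nonzero entry
      of \<open>W\<close>. Subtracting \<open>\<phi> B B'\<close> below makes it vanish on the
      columns of \<open>B\<close> and keeps its value on \<open>W\<close>, because
      \<open>B' W = 0\<close>.\<close>
    define \<phi> where "\<phi> = mat 1 n (\<lambda>(_, j). if j = i then 1 / W $$ (i, 0) else 0)"
    have \<phi>: "\<phi> \<in> carrier_mat 1 n" by (simp add: \<phi>_def)
    have \<phi>W: "\<phi> * W = 1\<^sub>m 1"
    proof (rule eq_matI)
      fix a b assume "a < dim_row (1\<^sub>m 1 :: 'a mat)" "b < dim_col (1\<^sub>m 1 :: 'a mat)"
      hence [simp]: "a = 0" "b = 0" by auto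
      have "(\<phi> * W) $$ (0, 0) = (\<Sum>j = 0..<n. (if j = i then 1 / W $$ (i, 0) else 0) * W $$ (j, 0))"
        using W \<phi> by (simp add: scalar_prod_def \<phi>_def)
      also have "\<dots> = (\<Sum>j = 0..<n. if j = i then 1 else 0)"
        using i by (intro sum.cong) auto
      also have "\<dots> = 1" using i by simp
      finally show "(\<phi> * W) $$ (a, b) = 1\<^sub>m 1 $$ (a, b)" by simp
    qed (use W \<phi> in auto)
    define \<psi> where "\<psi> = \<phi> - (\<phi> * B) * B'"
    have pB: "\<phi> * B \<in> carrier_mat 1 r" using \<phi> B by simp
    have \<psi>: "\<psi> \<in> carrier_mat 1 n" using \<phi> pB B' by (simp add: \<psi>_def minus_carrier_mat)
    have \<psi>W: "\<psi> * W = 1\<^sub>m 1"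
    proof -
      have "\<psi> * W = \<phi> * W - (\<phi> * B) * B' * W"
        unfolding \<psi>_def using \<phi> pB B' W by (intro minus_mult_distrib_mat) auto
      also have "(\<phi> * B) * B' * W = 0\<^sub>m 1 1"
        using assoc_mult_mat[OF pB B' W] B'W right_mult_zero_mat[OF pB] by simp
      also have "\<phi> * W - 0\<^sub>m 1 1 = 1\<^sub>m 1"
        using \<phi>W by (intro eq_matI) auto
      finally show ?thesis .
    qed
    have \<psi>B: "\<psi> * B = 0\<^sub>m 1 r"
    proof -
      have "\<psi> * B = \<phi> * B - (\<phi> * B) * B' * B"
        unfolding \<psi>_def using \<phi> pB B' B by (intro minus_mult_distrib_mat) auto
      also have "(\<phi> * B) * B' * B = \<phi> * B"
        using assoc_mult_mat[OF pB B' B] BB right_mult_one_mat[OF pB] by simp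
      also have "\<phi> * B - \<phi> * B = 0\<^sub>m 1 r"
        using pB by (intro eq_matI) auto
      finally show ?thesis .
    qed
    \<comment> \<open>Block triangular, encoding \<open>V = B X + W\<close> in the last column; the
      corner \<open>- C' X\<close> of the right inverse cancels \<open>X\<close>.\<close>
    define C2 where "C2 = four_block_mat C X (0\<^sub>m 1 m) (1\<^sub>m 1)"
    define C2' where "C2' = four_block_mat C' (- (C' * X)) (0\<^sub>m 1 r) (1\<^sub>m 1)"
    have C'X: "C' * X \<in> carrier_mat m 1" using C' X by simp
    have 1: "S = hcat B W * C2"
      unfolding C2_def S S1eq using B W C X V_eq
      by (subst hcat_four_block[where a = r and b = 1]) auto
    have 2: "vcat B' \<psi> * hcat B W = 1\<^sub>m (r + 1)"
      by (subst vcat_mult_hcat[OF B' \<psi> B W]) (simp add: BB B'W \<psi>B \<psi>W)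
    have 3: "C2 * C2' = 1\<^sub>m (r + 1)"
    proof -
      have "C2 * C2' = four_block_mat (C * C' + X * 0\<^sub>m 1 r) (C * - (C' * X) + X * 1\<^sub>m 1)
          (0\<^sub>m 1 m * C' + 1\<^sub>m 1 * 0\<^sub>m 1 r) (0\<^sub>m 1 m * - (C' * X) + 1\<^sub>m 1 * 1\<^sub>m 1)"
        unfolding C2_def C2'_def using C X C' C'X
        by (intro mult_four_block_mat) auto
      also have "C * - (C' * X) + X * 1\<^sub>m 1 = 0\<^sub>m r 1"
      proof -
        have "C * - (C' * X) = - X"
          using uminus_mult_right_mat[of C "C' * X"] mult_cancel_one[OF C C' X CC] C C' X by simp
        thus ?thesis using X by simp
      qed
      also have "C * C' + X * 0\<^sub>m 1 r = 1\<^sub>m r"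
        using X CC by simp
      also have "0\<^sub>m 1 m * - (C' * X) + 1\<^sub>m 1 * 1\<^sub>m 1 = (1\<^sub>m 1 :: 'a mat)"
        using left_mult_zero_mat[of "- (C' * X)" m 1 1] C'X by simp
      finally show ?thesis
        using C' by simp
    qed
    have 4: "hcat B W \<in> carrier_mat n (r + 1)" "vcat B' \<psi> \<in> carrier_mat (r + 1) n"
      using B W B' \<psi> by auto
    have 5: "C2 \<in> carrier_mat (r + 1) (Suc m)" "C2' \<in> carrier_mat (Suc m) (r + 1)"
      using C X C' C'X by (auto simp: C2_def C2'_def)
    show ?thesis
      by (intro exI[of _ "r + 1"] exI[of _ "hcat B W"] exI[of _ C2] exI[of _ "vcat B' \<psi>"]
            exI[of _ C2'] conjI) (fact 1 2 3 4 5)+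
  qed
qed

text \<open>In a full rank factorisation \<open>K = B C\<close> every \<open>C' C x - x\<close> lies
  in the kernel of \<open>K\<close>. Hence \<open>C' C = 1\<close>, and \<open>C' B'\<close> is a
  left inverse.\<close>

lemma left_inverse_if_kernel_trivial:
  fixes K :: "'a::field mat"
  assumes K: "K \<in> carrier_mat n d"
    and inj: "\<And>x. x \<in> carrier_vec d \<Longrightarrow> K *\<^sub>v x = 0\<^sub>v n \<Longrightarrow> x = 0\<^sub>v d"
  shows "\<exists>R \<in> carrier_mat d n. R * K = 1\<^sub>m d"
proof -
  obtain r B C B' C' where B: "B \<in> carrier_mat n r" and C: "C \<in> carrier_mat r d"
    and B': "B' \<in> carrier_mat r n" and C': "C' \<in> carrier_mat d r"
    and BB: "B' * B = 1\<^sub>m r" and CC: "C * C' = 1\<^sub>m r" and Keq: "K = B * C"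
    using full_rank_factorization[OF K] by blast
  have C'C: "C' * C = 1\<^sub>m d"
  proof (rule mat_col_eqI)
    fix j assume "j < dim_col (1\<^sub>m d :: 'a mat)"
    hence j: "j < d" by simp
    define e :: "'a vec" where "e = unit_vec d j"
    have e: "e \<in> carrier_vec d" by (simp add: e_def)
    have Ce: "C *\<^sub>v e \<in> carrier_vec r" using C e by simp
    have "K *\<^sub>v (C' *\<^sub>v (C *\<^sub>v e) - e) = K *\<^sub>v (C' *\<^sub>v (C *\<^sub>v e)) - K *\<^sub>v e"
      using K C' Ce e by (intro mult_minus_distrib_mat_vec) auto
    also have "K *\<^sub>v (C' *\<^sub>v (C *\<^sub>v e)) = (K * C') *\<^sub>v (C *\<^sub>v e)"
      by (rule assoc_mult_mat_vec[OF K C' Ce, symmetric])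
    also have "K * C' = B"
      using assoc_mult_mat[OF B C C'] CC right_mult_one_mat[OF B] by (simp add: Keq)
    also have "B *\<^sub>v (C *\<^sub>v e) = K *\<^sub>v e"
      unfolding Keq by (rule assoc_mult_mat_vec[OF B C e, symmetric])
    also have "K *\<^sub>v e - K *\<^sub>v e = 0\<^sub>v n"
      using K e by (intro minus_cancel_vec) simp
    finally have "C' *\<^sub>v (C *\<^sub>v e) - e = 0\<^sub>v d"
      using inj C' C e by simp
    hence eq: "C' *\<^sub>v (C *\<^sub>v e) = e"
      using C' C e by (auto simp: vec_eq_iff)
    have "col (C' * C) j = (C' * C) *\<^sub>v e"
      unfolding e_def using C C' j by (intro mult_mat_unit_vec[symmetric]) auto
    also have "\<dots> = e" using eq C' C e by simp
    also have "\<dots> = col (1\<^sub>m d) j" using j by (simp add: e_def)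
    finally show "col (C' * C) j = col (1\<^sub>m d) j" .
  qed (use C C' in auto)
  have "(C' * B') * K = 1\<^sub>m d"
    using assoc_mult_mat[OF C' B' mult_carrier_mat[OF B C]] mult_cancel_one[OF B' B C BB] C'C
    by (simp add: Keq)
  thus ?thesis
    using C' B' by (intro bexI[of _ "C' * B'"]) auto
qed

text \<open>The purpose is to solve \<open>Y S = W\<close> for a \<open>W\<close> that vanishes on
  the kernel of \<open>S\<close>: then \<open>Y = W T\<close> works.\<close>

lemma generalized_inverse:
  fixes S :: "'a::field mat"
  assumes S: "S \<in> carrier_mat n m"
  shows "\<exists>T \<in> carrier_mat m n. S * T * S = S"
proof -
  obtain r B C B' C' where B: "B \<in> carrier_mat n r" and C: "C \<in> carrier_mat r m"
    and B': "B' \<in> carrier_mat r n" and C': "C' \<in> carrier_mat m r"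
    and BB: "B' * B = 1\<^sub>m r" and CC: "C * C' = 1\<^sub>m r" and Seq: "S = B * C"
    using full_rank_factorization[OF S] by blast
  have "S * (C' * B') * S = S"
    using assoc_mult_mat[OF B C mult_carrier_mat[OF C' B']] mult_cancel_one[OF C C' B' CC]
      assoc_mult_mat[OF B B' mult_carrier_mat[OF B C]] mult_cancel_one[OF B' B C BB]
    by (simp only: Seq)
  thus ?thesis
    using C' B' by (intro bexI[of _ "C' * B'"]) auto
qed

section \<open>Cardinalities of sets of vectors and matrices over a finite field\<close>

lemma card_carrier_vec_finite: "card (carrier_vec n :: 'a::finite vec set) = card (UNIV :: 'a set) ^ n"
proof -
  have "bij_betw (\<lambda>f. vec n f) (PiE {..<n} (\<lambda>_. UNIV :: 'a set)) (carrier_vec n)"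
    by (rule bij_betwI[where g = "\<lambda>v. \<lambda>i\<in>{..<n}. v $ i"])
       (auto simp: fun_eq_iff PiE_def extensional_def restrict_def)
  thus ?thesis
    by (auto simp: card_PiE dest!: bij_betw_same_card)
qed

lemma finite_carrier_vec_finite [simp]: "finite (carrier_vec n :: 'a::finite vec set)"
  by (rule card_ge_0_finite) (simp add: card_carrier_vec_finite card_gt_0_iff)

lemma card_mat_rows_in:
  fixes X :: "'a::zero vec set"
  assumes "X \<subseteq> carrier_vec m" "finite X"
  shows "finite {A \<in> carrier_mat n m. \<forall>i<n. row A i \<in> X}"
    and "card {A \<in> carrier_mat n m. \<forall>i<n. row A i \<in> X} = card X ^ n"
proof -
  have bij: "bij_betw (\<lambda>f. mat\<^sub>r n m f) (PiE {..<n} (\<lambda>_. X)) {A \<in> carrier_mat n m. \<forall>i<n. row A i \<in> X}"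
  proof (rule bij_betwI[where g = "\<lambda>A. \<lambda>i\<in>{..<n}. row A i"])
    show "(\<lambda>f. mat\<^sub>r n m f) \<in> (PiE {..<n} (\<lambda>_. X)) \<rightarrow> {A \<in> carrier_mat n m. \<forall>i<n. row A i \<in> X}"
      using assms by (auto simp: PiE_iff subset_iff)
    show "(\<lambda>A. \<lambda>i\<in>{..<n}. row A i) \<in> {A \<in> carrier_mat n m. \<forall>i<n. row A i \<in> X} \<rightarrow> (PiE {..<n} (\<lambda>_. X))"
      by auto
    show "(\<lambda>i\<in>{..<n}. row (mat\<^sub>r n m f) i) = f" if "f \<in> PiE {..<n} (\<lambda>_. X)" for f
    proof
      fix i
      show "(\<lambda>i\<in>{..<n}. row (mat\<^sub>r n m f) i) i = f i"
        using that assms by (cases "i < n") (auto simp: PiE_iff extensional_def subset_iff)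
    qed
    show "mat\<^sub>r n m (\<lambda>i\<in>{..<n}. row A i) = A" if "A \<in> {A \<in> carrier_mat n m. \<forall>i<n. row A i \<in> X}" for A
      using that by (intro eq_rowI) auto
  qed
  have "finite (PiE {..<n} (\<lambda>_. X))"
    using assms by (intro finite_PiE) auto
  thus "finite {A \<in> carrier_mat n m. \<forall>i<n. row A i \<in> X}"
    using bij_betw_finite[OF bij] by blast
  show "card {A \<in> carrier_mat n m. \<forall>i<n. row A i \<in> X} = card X ^ n"
    using bij_betw_same_card[OF bij] by (simp add: card_PiE)
qed

lemma finite_carrier_mat [simp]: "finite (carrier_mat n m :: 'a::{zero,finite} mat set)"
proof -
  have "carrier_mat n m = {A \<in> carrier_mat n m. \<forall>i<n. row A i \<in> (carrier_vec m :: 'a vec set)}"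
    by auto
  thus ?thesis
    using card_mat_rows_in(1)[of "carrier_vec m :: 'a vec set" m n] by simp
qed

lemma card_mat_cols_in:
  fixes X :: "'a::zero vec set"
  assumes "X \<subseteq> carrier_vec m" "finite X"
  shows "card {A \<in> carrier_mat m n. \<forall>i<n. col A i \<in> X} = card X ^ n"
proof -
  have "bij_betw transpose_mat {A \<in> carrier_mat m n. \<forall>i<n. col A i \<in> X}
      {A \<in> carrier_mat n m. \<forall>i<n. row A i \<in> X}"
    by (rule bij_betwI[where g = transpose_mat]) auto
  thus ?thesis
    using card_mat_rows_in(2)[OF assms] by (simp add: bij_betw_same_card)
qed

lemma two_le_card_field: "2 \<le> card (UNIV :: 'a::{field,finite} set)"
proof -
  have "card {0, 1 :: 'a} \<le> card (UNIV :: 'a set)" by (intro card_mono) auto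
  thus ?thesis by simp
qed

text \<open>Mutually inverse linear maps give a bijection of vector spaces, so counting vectors
  compares the sizes.\<close>

lemma square_if_two_sided_inverse:
  fixes P :: "'a::{field,finite} mat"
  assumes P: "P \<in> carrier_mat n m" and Q: "Q \<in> carrier_mat m n"
    and PQ: "P * Q = 1\<^sub>m n" and QP: "Q * P = 1\<^sub>m m"
  shows "n = m"
proof -
  have "bij_betw (\<lambda>v. P *\<^sub>v v) (carrier_vec m) (carrier_vec n)"
    using assms by (intro bij_betwI[where g = "\<lambda>v. Q *\<^sub>v v"]) (auto simp flip: assoc_mult_mat_vec)
  hence "card (UNIV :: 'a set) ^ m = card (UNIV :: 'a set) ^ n"
    by (simp add: bij_betw_same_card flip: card_carrier_vec_finite)
  thus ?thesis
    using two_le_card_field[where 'a = 'a] by simp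
qed

section \<open>Polynomials in a matrix\<close>

text \<open>Horner's scheme on the coefficient list, which makes the recursion
  \<open>pmat_pCons\<close> available for induction over polynomials.\<close>

definition pmat :: "'a::field mat \<Rightarrow> 'a poly \<Rightarrow> 'a mat" where
  "pmat A p = foldr (\<lambda>a M. a \<cdot>\<^sub>m 1\<^sub>m (dim_row A) + A * M) (coeffs p) (0\<^sub>m (dim_row A) (dim_row A))"

lemma pmat_0 [simp]: "A \<in> carrier_mat n n \<Longrightarrow> pmat A 0 = 0\<^sub>m n n"
  by (simp add: pmat_def)

lemma pmat_pCons:
  assumes "A \<in> carrier_mat n n"
  shows "pmat A (pCons a p) = a \<cdot>\<^sub>m 1\<^sub>m n + A * pmat A p"
proof (cases "a = 0 \<and> p = 0")
  case True
  moreover have "0 \<cdot>\<^sub>m 1\<^sub>m n + 0\<^sub>m n n = (0\<^sub>m n n :: 'a mat)"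
    by (intro eq_matI) auto
  ultimately show ?thesis
    using assms right_mult_zero_mat[OF assms, of n] by simp
next
  case False
  thus ?thesis using assms by (auto simp: pmat_def cCons_def)
qed

lemma pmat_carrier [simp, intro]:
  assumes "A \<in> carrier_mat n n"
  shows "pmat A p \<in> carrier_mat n n"
proof (induction p)
  case (pCons a p)
  thus ?case using assms by (simp add: pmat_pCons[OF assms])
qed (use assms in simp)

lemma dim_pmat [simp]:
  assumes "dim_col A = dim_row A"
  shows "dim_row (pmat A p) = dim_row A" "dim_col (pmat A p) = dim_row A"
  using pmat_carrier[of A "dim_row A" p] assms by (metis carrier_matD carrier_matI)+

text \<open>The intertwiner may be rectangular, as \<open>B\<close> and \<open>C\<close> are when
  \<open>1 + B C\<close> is compared with \<open>1 + C B\<close>.\<close>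

lemma pmat_intertwine:
  assumes A: "A \<in> carrier_mat n n" and A': "A' \<in> carrier_mat k k" and X: "X \<in> carrier_mat n k"
    and AX: "A * X = X * A'"
  shows "pmat A p * X = X * pmat A' p"
proof (induction p)
  case 0
  thus ?case using A A' X by simp
next
  case (pCons a p)
  let ?P = "pmat A p" and ?P' = "pmat A' p"
  have P: "?P \<in> carrier_mat n n" and P': "?P' \<in> carrier_mat k k" using A A' by auto
  have "(a \<cdot>\<^sub>m 1\<^sub>m n + A * ?P) * X = (a \<cdot>\<^sub>m 1\<^sub>m n) * X + A * ?P * X"
    using A P X by (intro add_mult_distrib_mat) auto
  also have "(a \<cdot>\<^sub>m 1\<^sub>m n) * X = a \<cdot>\<^sub>m X"
    using mult_smult_assoc_mat[OF one_carrier_mat X, of a] X by simp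
  also have "A * ?P * X = X * (A' * ?P')"
    using assoc_mult_mat[OF A P X] assoc_mult_mat[OF A X P'] assoc_mult_mat[OF X A' P'] pCons AX
    by simp
  also have "a \<cdot>\<^sub>m X = X * (a \<cdot>\<^sub>m 1\<^sub>m k)"
    using mult_smult_distrib[OF X one_carrier_mat, of a] X by simp
  also have "X * (a \<cdot>\<^sub>m 1\<^sub>m k) + X * (A' * ?P') = X * (a \<cdot>\<^sub>m 1\<^sub>m k + A' * ?P')"
    using X A' P' by (intro mult_add_distrib_mat[symmetric]) auto
  finally show ?case
    by (simp add: pmat_pCons[OF A] pmat_pCons[OF A'])
qed

lemma pmat_add:
  assumes A: "A \<in> carrier_mat n n"
  shows "pmat A (p + q) = pmat A p + pmat A q"
proof (induction p q rule: poly_induct2)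
  case 0
  thus ?case using A by simp
next
  case (pCons a p b q)
  let ?P = "pmat A p" and ?Q = "pmat A q"
  have P: "?P \<in> carrier_mat n n" and Q: "?Q \<in> carrier_mat n n" using A by auto
  have APQ: "A * ?P \<in> carrier_mat n n" "A * ?Q \<in> carrier_mat n n" using A P Q by auto
  have "A * (?P + ?Q) = A * ?P + A * ?Q"
    by (rule mult_add_distrib_mat[OF A P Q])
  moreover have "(a + b) \<cdot>\<^sub>m 1\<^sub>m n + (A * ?P + A * ?Q) =
      (a \<cdot>\<^sub>m 1\<^sub>m n + A * ?P) + (b \<cdot>\<^sub>m 1\<^sub>m n + A * ?Q)"
    using APQ by (intro eq_matI) (simp_all del: index_mult_mat add: algebra_simps)
  ultimately show ?case
    by (simp add: pmat_pCons[OF A] pCons)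
qed

lemma pmat_smult:
  assumes A: "A \<in> carrier_mat n n"
  shows "pmat A (smult c p) = c \<cdot>\<^sub>m pmat A p"
proof (induction p)
  case 0
  have "c \<cdot>\<^sub>m 0\<^sub>m n n = 0\<^sub>m n n" by (intro eq_matI) auto
  thus ?case using A by simp
next
  case (pCons a p)
  let ?P = "pmat A p"
  have P: "?P \<in> carrier_mat n n" using A by auto
  have AP: "A * ?P \<in> carrier_mat n n" using A P by auto
  have "(c * a) \<cdot>\<^sub>m 1\<^sub>m n + c \<cdot>\<^sub>m (A * ?P) = c \<cdot>\<^sub>m (a \<cdot>\<^sub>m 1\<^sub>m n + A * ?P)"
    using AP by (intro eq_matI) (simp_all del: index_mult_mat add: algebra_simps)
  thus ?case
    by (simp add: pmat_pCons[OF A] pCons mult_smult_distrib[OF A P])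
qed

lemma pmat_mult:
  assumes A: "A \<in> carrier_mat n n"
  shows "pmat A (p * q) = pmat A p * pmat A q"
proof (induction p)
  case 0
  thus ?case using A left_mult_zero_mat[OF pmat_carrier[OF A, of q], of n] by simp
next
  case (pCons a p)
  let ?P = "pmat A p" and ?Q = "pmat A q"
  have P: "?P \<in> carrier_mat n n" and Q: "?Q \<in> carrier_mat n n" using A by auto
  have PQ: "A * (?P * ?Q) \<in> carrier_mat n n" by (rule mult_carrier_mat[OF A mult_carrier_mat[OF P Q]])
  have "(a \<cdot>\<^sub>m 1\<^sub>m n + A * ?P) * ?Q = (a \<cdot>\<^sub>m 1\<^sub>m n) * ?Q + A * ?P * ?Q"
    using A P Q by (intro add_mult_distrib_mat) auto
  also have "(a \<cdot>\<^sub>m 1\<^sub>m n) * ?Q = a \<cdot>\<^sub>m ?Q"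
    using mult_smult_assoc_mat[OF one_carrier_mat Q, of a] Q by simp
  also have "A * ?P * ?Q = A * (?P * ?Q)"
    by (rule assoc_mult_mat[OF A P Q])
  also have "a \<cdot>\<^sub>m ?Q + A * (?P * ?Q) = a \<cdot>\<^sub>m ?Q + (0 \<cdot>\<^sub>m 1\<^sub>m n + A * (?P * ?Q))"
    using Q PQ by (intro eq_matI) (simp_all del: index_mult_mat)
  finally show ?case
    by (simp add: pmat_pCons[OF A] pmat_add[OF A] pmat_smult[OF A] pCons)
qed

lemma pmat_const:
  assumes A: "A \<in> carrier_mat n n"
  shows "pmat A [:c:] = c \<cdot>\<^sub>m 1\<^sub>m n"
  using A right_mult_zero_mat[OF A, of n] by (simp add: pmat_pCons[OF A])

lemma pmat_1 [simp]:
  assumes A: "A \<in> carrier_mat n n"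
  shows "pmat A 1 = 1\<^sub>m n"
proof -
  have "1 \<cdot>\<^sub>m 1\<^sub>m n = (1\<^sub>m n :: 'a mat)" by (intro eq_matI) auto
  thus ?thesis using pmat_const[OF A, of 1] by (simp add: one_pCons)
qed

lemma pmat_linear:
  assumes A: "A \<in> carrier_mat n n"
  shows "pmat A [:c, 1:] = c \<cdot>\<^sub>m 1\<^sub>m n + A"
proof -
  have "pmat A [:1:] = 1\<^sub>m n" using pmat_1[OF A] by (simp add: one_pCons)
  thus ?thesis using A by (simp add: pmat_pCons[OF A, of c])
qed

lemma mult_mat_vec_zero:
  assumes "(A :: 'a::comm_ring_1 mat) \<in> carrier_mat n m"
  shows "A *\<^sub>v 0\<^sub>v m = 0\<^sub>v n"
  using assms by (intro eq_vecI) auto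

lemma pmat_diff:
  assumes A: "A \<in> carrier_mat n n"
  shows "pmat A (p - q) = pmat A p - pmat A q"
proof -
  have "pmat A (p - q) = pmat A p + (-1) \<cdot>\<^sub>m pmat A q"
    using pmat_add[OF A, of p "smult (-1) q"] by (simp only: pmat_smult[OF A]) simp
  also have "\<dots> = pmat A p - pmat A q"
    using pmat_carrier[OF A, of p] pmat_carrier[OF A, of q] by (intro eq_matI) auto
  finally show ?thesis .
qed

lemma pmat_mult_vec:
  assumes A: "A \<in> carrier_mat n n" and v: "v \<in> carrier_vec n"
  shows "pmat A (p * q) *\<^sub>v v = pmat A p *\<^sub>v (pmat A q *\<^sub>v v)"
  by (simp add: pmat_mult[OF A] assoc_mult_mat_vec[OF pmat_carrier[OF A] pmat_carrier[OF A] v])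

lemma pmat_transpose:
  assumes A: "A \<in> carrier_mat n n"
  shows "pmat (transpose_mat A) p = transpose_mat (pmat A p)"
proof (induction p)
  case 0
  thus ?case using A by simp
next
  case (pCons a p)
  have AT: "transpose_mat A \<in> carrier_mat n n" using A by simp
  let ?P = "pmat A p"
  have P: "?P \<in> carrier_mat n n" using A by auto
  have "pmat A p * A = A * pmat A p"
    by (rule pmat_intertwine[OF A A A refl])
  hence "transpose_mat A * transpose_mat ?P = transpose_mat (A * ?P)"
    using transpose_mult[OF P A] by simp
  moreover have "transpose_mat (a \<cdot>\<^sub>m 1\<^sub>m n + A * ?P) = transpose_mat (a \<cdot>\<^sub>m 1\<^sub>m n) + transpose_mat (A * ?P)"
    using A P by (intro transpose_add) auto
  moreover have "transpose_mat (a \<cdot>\<^sub>m 1\<^sub>m n) = a \<cdot>\<^sub>m (1\<^sub>m n)"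
    by (intro eq_matI) auto
  ultimately show ?case
    by (simp add: pmat_pCons[OF A] pmat_pCons[OF AT] pCons)
qed

lemma pmat_sum_vec:
  assumes A: "A \<in> carrier_mat n n" and v: "v \<in> carrier_vec n" and i: "i < n"
  shows "(pmat A (\<Sum>j\<in>J. smult (c j) (g j)) *\<^sub>v v) $ i = (\<Sum>j\<in>J. c j * (pmat A (g j) *\<^sub>v v) $ i)"
proof (induction J rule: infinite_finite_induct)
  case (insert x F)
  have c: "c x \<cdot>\<^sub>m pmat A (g x) \<in> carrier_mat n n" "pmat A (\<Sum>j\<in>F. smult (c j) (g j)) \<in> carrier_mat n n"
    using A by auto
  have "(pmat A (\<Sum>j\<in>insert x F. smult (c j) (g j)) *\<^sub>v v) $ i =
      (c x \<cdot>\<^sub>m pmat A (g x) *\<^sub>v v) $ i + (pmat A (\<Sum>j\<in>F. smult (c j) (g j)) *\<^sub>v v) $ i"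
    using insert(1,2) add_mult_distrib_mat_vec[OF c v] i c
    by (simp add: pmat_add[OF A] pmat_smult[OF A] del: index_mult_mat_vec)
  also have "(c x \<cdot>\<^sub>m pmat A (g x) *\<^sub>v v) $ i = c x * (pmat A (g x) *\<^sub>v v) $ i"
    using i v carrier_matD[OF pmat_carrier[OF A, of "g x"]] by simp
  finally show ?case using insert by simp
qed (use A v i in auto)

section \<open>Annihilator ideals and prime power divisors\<close>

lemma poly_ideal_generator:
  fixes I :: "'a::field poly set"
  assumes nz: "\<exists>p\<in>I. p \<noteq> 0" and diff: "\<And>p q. p \<in> I \<Longrightarrow> q \<in> I \<Longrightarrow> p - q \<in> I"
    and mult: "\<And>p q. p \<in> I \<Longrightarrow> q * p \<in> I"
  shows "\<exists>g. lead_coeff g = 1 \<and> (\<forall>p. p \<in> I \<longleftrightarrow> g dvd p)"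
proof -
  define d where "d = (LEAST d. \<exists>p\<in>I. p \<noteq> 0 \<and> degree p = d)"
  have "\<exists>p\<in>I. p \<noteq> 0 \<and> degree p = d"
    unfolding d_def by (rule LeastI_ex) (use nz in blast)
  then obtain h where h: "h \<in> I" "h \<noteq> 0" "degree h = d" by blast
  have min: "d \<le> degree p" if "p \<in> I" "p \<noteq> 0" for p
    unfolding d_def by (rule Least_le) (use that in blast)
  define g where "g = smult (inverse (lead_coeff h)) h"
  have "g = [:inverse (lead_coeff h):] * h" by (simp add: g_def)
  hence g: "g \<in> I" using mult h(1) by metis
  have lg: "lead_coeff g = 1" using h(2) by (simp add: g_def)
  have dg: "degree g = d" using h(2) by (simp add: g_def flip: h(3))
  have "p \<in> I \<longleftrightarrow> g dvd p" for p
  proof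
    assume p: "p \<in> I"
    have "p mod g = p - (p div g) * g" by (simp add: minus_div_mult_eq_mod)
    hence "p mod g \<in> I" using diff[OF p mult[OF g]] by simp
    moreover have "p mod g = 0 \<or> degree (p mod g) < degree g"
      using lg by (intro degree_mod_less) auto
    ultimately show "g dvd p"
      using min dg by (metis leD mod_eq_0_iff_dvd)
  next
    assume "g dvd p"
    thus "p \<in> I" using mult[OF g] by (auto simp: dvd_def mult.commute)
  qed
  thus ?thesis using lg by blast
qed

lemma vec_annihilator_generator:
  assumes A: "A \<in> carrier_mat n n" and v: "v \<in> carrier_vec n"
    and ex: "\<exists>p. p \<noteq> 0 \<and> pmat A p *\<^sub>v v = 0\<^sub>v n"
  shows "\<exists>g. lead_coeff g = 1 \<and> (\<forall>p. pmat A p *\<^sub>v v = 0\<^sub>v n \<longleftrightarrow> g dvd p)"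
proof -
  let ?I = "{p. pmat A p *\<^sub>v v = 0\<^sub>v n}"
  have "\<exists>g. lead_coeff g = 1 \<and> (\<forall>p. p \<in> ?I \<longleftrightarrow> g dvd p)"
  proof (rule poly_ideal_generator)
    show "\<exists>p\<in>?I. p \<noteq> 0" using ex by blast
    show "p - q \<in> ?I" if "p \<in> ?I" "q \<in> ?I" for p q
      using that minus_mult_distrib_mat_vec[OF pmat_carrier[OF A, of p] pmat_carrier[OF A, of q] v]
      by (simp add: pmat_diff[OF A])
    show "q * p \<in> ?I" if "p \<in> ?I" for p q
      using that mult_mat_vec_zero[OF pmat_carrier[OF A, of q]] by (simp add: pmat_mult_vec[OF A v])
  qed
  thus ?thesis by simp
qed

lemma pmat_annihilator_generator:
  fixes A :: "'a::{field,finite} mat"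
  assumes A: "A \<in> carrier_mat n n"
  shows "\<exists>g. lead_coeff g = 1 \<and> (\<forall>p. pmat A p = 0\<^sub>m n n \<longleftrightarrow> g dvd p)"
proof -
  let ?I = "{p. pmat A p = 0\<^sub>m n n}"
  have "\<exists>g. lead_coeff g = 1 \<and> (\<forall>p. p \<in> ?I \<longleftrightarrow> g dvd p)"
  proof (rule poly_ideal_generator)
    \<comment> \<open>There are only finitely many matrices of size \<open>n\<close>, so two powers
      of \<open>A\<close> agree; the difference of the monomials is a nonzero annihilator.\<close>
    have "\<not> inj (\<lambda>i. pmat A (monom 1 i))"
    proof
      assume "inj (\<lambda>i. pmat A (monom 1 i))"
      moreover have "range (\<lambda>i. pmat A (monom 1 i)) \<subseteq> carrier_mat n n" using A by auto
      ultimately show False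
        using finite_subset[OF _ finite_carrier_mat] finite_imageD infinite_UNIV_nat by blast
    qed
    then obtain i j where ij: "i \<noteq> j" "pmat A (monom 1 i) = pmat A (monom 1 j)"
      by (auto simp: inj_def)
    have "monom 1 i - monom 1 j \<noteq> (0 :: 'a poly)"
      using ij(1) by (metis coeff_monom eq_iff_diff_eq_0 zero_neq_one)
    moreover have "pmat A (monom 1 i - monom 1 j) = 0\<^sub>m n n"
      using ij(2) pmat_carrier[OF A, of "monom 1 j"] by (simp add: pmat_diff[OF A])
    ultimately show "\<exists>p\<in>?I. p \<noteq> 0" by blast
    show "p - q \<in> ?I" if "p \<in> ?I" "q \<in> ?I" for p q
    proof -
      have "0\<^sub>m n n - 0\<^sub>m n n = (0\<^sub>m n n :: 'a mat)" by (intro eq_matI) auto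
      thus ?thesis using that by (simp add: pmat_diff[OF A])
    qed
    show "q * p \<in> ?I" if "p \<in> ?I" for p q
      using that right_mult_zero_mat[OF pmat_carrier[OF A, of q], of n] by (simp add: pmat_mult[OF A])
  qed
  thus ?thesis by simp
qed

lemma monic_irreducible_factor:
  fixes m :: "'a::field poly"
  assumes "degree m \<ge> 1"
  shows "\<exists>p. lead_coeff p = 1 \<and> irreducible p \<and> p dvd m"
  using assms
proof (induction "degree m" arbitrary: m rule: less_induct)
  case less
  have m0: "m \<noteq> 0" using less.prems by auto
  hence m: "m \<noteq> 0" "\<not> is_unit m" using less.prems by (auto simp: is_unit_iff_degree)
  show ?case
  proof (cases "irreducible m")
    case True
    define c where "c = inverse (lead_coeff m)"
    have c: "c \<noteq> 0" using m by (simp add: c_def)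
    have u: "is_unit [:c:]" using c by (simp add: is_unit_const_poly_iff dvd_field_iff)
    have "irreducible ([:c:] * m)" using True irreducible_mult_unit_left[OF u, of m] by (simp only:)
    hence "irreducible (smult c m)" by simp
    moreover have "lead_coeff (smult c m) = 1" using m by (simp add: c_def)
    moreover have "smult c m dvd m" using c by (simp add: smult_dvd_iff)
    ultimately show ?thesis by blast
  next
    case False
    then obtain a b where ab: "m = a * b" "\<not> is_unit a" "\<not> is_unit b"
      using m by (auto simp: irreducible_def)
    have nz: "a \<noteq> 0" "b \<noteq> 0" using ab m by auto
    hence "degree a \<ge> 1" "degree b \<ge> 1" using ab by (auto simp: is_unit_iff_degree)
    moreover have "degree m = degree a + degree b" using ab nz by (simp add: degree_mult_eq)
    ultimately obtain p where p: "lead_coeff p = 1" "irreducible p" "p dvd a"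
      using less.hyps[of a] by auto
    have "p dvd m" unfolding ab(1) using p(3) by (rule dvd_mult2)
    thus ?thesis using p by blast
  qed
qed

lemma monic_divisor_of_irreducible_power:
  fixes p :: "'a::field poly"
  assumes p: "irreducible p" "lead_coeff p = 1" and g: "g dvd p ^ k" "lead_coeff g = 1"
  shows "\<exists>j\<le>k. g = p ^ j"
  using g
proof (induction k arbitrary: g)
  case 0
  hence "is_unit g" by simp
  hence "degree g = 0" by (metis degree_0 is_unit_iff_degree)
  then obtain a where "g = [:a:]" by (rule degree_eq_zeroE)
  thus ?case using 0 by (simp add: one_pCons)
next
  case (Suc k)
  have pr: "prime_elem p" using p(1) by (rule field_poly_irreducible_imp_prime)
  have p0: "p \<noteq> 0" using p(2) by auto
  obtain h where h: "p ^ Suc k = g * h" using Suc.prems(1) by (auto simp: dvd_def)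
  hence "p dvd g * h" by (metis dvd_triv_left power_Suc)
  then consider "p dvd g" | "p dvd h" using pr prime_elem_dvd_multD by blast
  thus ?case
  proof cases
    case 1
    then obtain g' where g': "g = p * g'" by (auto simp: dvd_def)
    have "g' dvd p ^ k" using h p0 by (auto simp: g' dvd_def)
    moreover have "lead_coeff g' = 1" using Suc.prems(2) p(2) by (simp add: g' lead_coeff_mult)
    ultimately obtain j where "j \<le> k" "g' = p ^ j" using Suc.IH by blast
    thus ?thesis using g' by (intro exI[of _ "Suc j"]) simp
  next
    case 2
    then obtain h' where "h = p * h'" by (auto simp: dvd_def)
    hence "g dvd p ^ k" using h p0 by (auto simp: dvd_def)
    thus ?thesis using Suc.IH[of g] Suc.prems(2) le_SucI by blast
  qed
qed

lemma irreducible_power_dvd_mult: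
  fixes p :: "'a::field poly"
  assumes p: "irreducible p" and s: "\<not> p dvd s" and d: "p ^ k dvd s * y"
  shows "p ^ k dvd y"
  using d
proof (induction k arbitrary: y)
  case (Suc k)
  have pr: "prime_elem p" using p by (rule field_poly_irreducible_imp_prime)
  have p0: "p \<noteq> 0" using p by auto
  have "p dvd s * y" using Suc.prems dvd_mult_left[of p "p ^ k" "s * y"] by simp
  hence "p dvd y" using s prime_elem_dvd_mult_iff[OF pr] by blast
  then obtain y' where y': "y = p * y'" by (auto simp: dvd_def)
  have "s * y = p * (s * y')" by (simp add: y')
  hence "p * p ^ k dvd p * (s * y')" using Suc.prems by (simp only: power_Suc)
  hence "p ^ k dvd s * y'" using dvd_times_left_cancel_iff[OF p0] by blast
  hence "p ^ k dvd y'" by (rule Suc.IH)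
  thus ?case unfolding y' power_Suc by (rule mult_dvd_mono[OF dvd_refl])
qed simp

lemma irreducible_power_decomposition:
  fixes m :: "'a::field poly"
  assumes p: "irreducible p" and m: "m \<noteq> 0"
  shows "\<exists>k s. m = p ^ k * s \<and> \<not> p dvd s"
  using m
proof (induction "degree m" arbitrary: m rule: less_induct)
  case less
  show ?case
  proof (cases "p dvd m")
    case True
    then obtain m' where m': "m = p * m'" by (auto simp: dvd_def)
    have p0: "p \<noteq> 0" "\<not> is_unit p" using p by (auto simp: irreducible_def)
    hence "degree p > 0" by (simp add: is_unit_iff_degree)
    hence "degree m' < degree m" using m' less.prems p0 by (simp add: degree_mult_eq)
    then obtain k s where "m' = p ^ k * s" "\<not> p dvd s" using less.hyps[of m'] m' less.prems by auto
    thus ?thesis using m' by (intro exI[of _ "Suc k"] exI[of _ s]) (simp add: mult_ac)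
  next
    case False
    thus ?thesis by (intro exI[of _ 0] exI[of _ m]) simp
  qed
qed

section \<open>Vectors as polynomials, Krylov matrices and companion matrices\<close>

definition vpoly :: "'a::field vec \<Rightarrow> 'a poly" where
  "vpoly x = (\<Sum>j<dim_vec x. smult (x $ j) (monom 1 j))"

lemma coeff_vpoly: "coeff (vpoly x) i = (if i < dim_vec x then x $ i else 0)"
  by (simp add: vpoly_def coeff_sum if_distrib[of "\<lambda>c. _ * c"] sum.delta cong: if_cong)

lemma vpoly_eq_0_iff: "vpoly x = 0 \<longleftrightarrow> x = 0\<^sub>v (dim_vec x)"
proof
  assume "vpoly x = 0"
  hence "\<forall>i. coeff (vpoly x) i = 0" by simp
  thus "x = 0\<^sub>v (dim_vec x)" by (intro eq_vecI) (auto simp: coeff_vpoly split: if_splits)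
next
  assume x: "x = 0\<^sub>v (dim_vec x)"
  have "coeff (vpoly x) i = 0" for i
    using arg_cong[OF x, of "\<lambda>x. x $ i"] by (auto simp: coeff_vpoly)
  thus "vpoly x = 0" by (intro poly_eqI) simp
qed

lemma dvd_vpoly_imp_0:
  assumes f: "f dvd vpoly x" and d: "dim_vec x \<le> degree f"
  shows "vpoly x = 0"
proof (rule ccontr)
  assume nz: "vpoly x \<noteq> 0"
  have "degree f \<le> degree (vpoly x)" by (rule dvd_imp_degree_le[OF f nz])
  moreover have "coeff (vpoly x) (degree (vpoly x)) \<noteq> 0" using nz by simp
  ultimately show False using d by (simp add: coeff_vpoly split: if_splits)
qed

definition krylov :: "'a::field mat \<Rightarrow> 'a vec \<Rightarrow> nat \<Rightarrow> 'a mat" where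
  "krylov A v d = mat (dim_row A) d (\<lambda>(i, j). (pmat A (monom 1 j) *\<^sub>v v) $ i)"

lemma krylov_carrier [simp]: "A \<in> carrier_mat n n \<Longrightarrow> krylov A v d \<in> carrier_mat n d"
  by (simp add: krylov_def)

lemma krylov_mult_vec:
  assumes A: "A \<in> carrier_mat n n" and v: "v \<in> carrier_vec n" and x: "x \<in> carrier_vec d"
  shows "krylov A v d *\<^sub>v x = pmat A (vpoly x) *\<^sub>v v"
proof (rule eq_vecI)
  fix i assume "i < dim_vec (pmat A (vpoly x) *\<^sub>v v)"
  hence i: "i < n" using carrier_matD[OF pmat_carrier[OF A, of "vpoly x"]] by simp
  have "(krylov A v d *\<^sub>v x) $ i = (\<Sum>j<d. x $ j * (pmat A (monom 1 j) *\<^sub>v v) $ i)"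
    using A x i by (auto simp: krylov_def scalar_prod_def atLeast0LessThan mult.commute intro!: sum.cong)
  also have "\<dots> = (pmat A (vpoly x) *\<^sub>v v) $ i"
    unfolding vpoly_def using x by (simp add: pmat_sum_vec[OF A v i] del: index_mult_mat_vec)
  finally show "(krylov A v d *\<^sub>v x) $ i = (pmat A (vpoly x) *\<^sub>v v) $ i" .
qed (use A carrier_matD[OF pmat_carrier[OF A, of "vpoly x"]] in \<open>simp add: krylov_def\<close>)

lemma companion_carrier [simp]: "companion_mat f \<in> carrier_mat (degree f) (degree f)"
  by (simp add: companion_mat_def Let_def)

text \<open>The companion matrix is multiplication by \<open>t\<close> on \<open>F[t]/f\<close> in
  the basis of monomials; only the last monomial has to be reduced by \<open>f\<close>.\<close>

lemma vpoly_companion_col: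
  assumes f: "lead_coeff f = 1" and j: "j < degree f"
  shows "vpoly (col (companion_mat f) j) = monom 1 (Suc j) - (if j = degree f - 1 then f else 0)"
proof (rule poly_eqI)
  fix i
  have "degree f > 0" using j by simp
  show "coeff (vpoly (col (companion_mat f) j)) i =
      coeff (monom 1 (Suc j) - (if j = degree f - 1 then f else 0)) i"
    using j f coeff_eq_0[of f i]
    by (cases "i < degree f"; cases "i = degree f")
       (auto simp: coeff_vpoly companion_mat_def Let_def)
qed

text \<open>\<open>A\<close> shifts the columns \<open>v, A v, ...\<close>; the shift of the last
  one is expressed by the earlier columns through \<open>f(A) v = 0\<close>.\<close>

lemma krylov_companion:
  assumes A: "A \<in> carrier_mat n n" and v: "v \<in> carrier_vec n" and f: "lead_coeff f = 1"
    and fv: "pmat A f *\<^sub>v v = 0\<^sub>v n"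
  shows "A * krylov A v (degree f) = krylov A v (degree f) * companion_mat f"
proof (rule mat_col_eqI)
  let ?K = "krylov A v (degree f)" and ?C = "companion_mat f"
  have K: "?K \<in> carrier_mat n (degree f)" using A by simp
  fix j assume "j < dim_col (?K * ?C)"
  hence j: "j < degree f" using carrier_matD[OF companion_carrier[of f]] by simp
  have colK: "col ?K j = pmat A (monom 1 j) *\<^sub>v v"
    using A j by (intro eq_vecI) (auto simp: krylov_def)
  have "A *\<^sub>v col ?K j = pmat A [:0, 1:] *\<^sub>v (pmat A (monom 1 j) *\<^sub>v v)"
  proof -
    have "0 \<cdot>\<^sub>m 1\<^sub>m n + A = A" using A by (intro eq_matI) auto
    thus ?thesis unfolding colK by (simp add: pmat_linear[OF A])
  qed
  also have "\<dots> = pmat A (monom 1 (Suc j)) *\<^sub>v v"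
    by (simp add: pmat_mult_vec[OF A v, symmetric] monom_Suc)
  finally have 1: "A *\<^sub>v col ?K j = pmat A (monom 1 (Suc j)) *\<^sub>v v" .
  have c: "col ?C j \<in> carrier_vec (degree f)"
    using j col_dim[of ?C j] carrier_matD[OF companion_carrier[of f]] by simp
  have "?K *\<^sub>v col ?C j = pmat A (monom 1 (Suc j) - (if j = degree f - 1 then f else 0)) *\<^sub>v v"
    by (simp add: krylov_mult_vec[OF A v c] vpoly_companion_col[OF f j])
  also have "\<dots> = pmat A (monom 1 (Suc j)) *\<^sub>v v - pmat A (if j = degree f - 1 then f else 0) *\<^sub>v v"
    unfolding pmat_diff[OF A] by (rule minus_mult_distrib_mat_vec[OF pmat_carrier[OF A] pmat_carrier[OF A] v])
  also have "pmat A (if j = degree f - 1 then f else 0) *\<^sub>v v = 0\<^sub>v n"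
    using fv A v by auto
  also have "pmat A (monom 1 (Suc j)) *\<^sub>v v - 0\<^sub>v n = pmat A (monom 1 (Suc j)) *\<^sub>v v"
    using mult_mat_vec_carrier[OF pmat_carrier[OF A] v] by (rule minus_zero_vec)
  finally have 2: "?K *\<^sub>v col ?C j = A *\<^sub>v col ?K j" using 1 by simp
  have "col (A * ?K) j = A *\<^sub>v col ?K j"
    by (rule col_mult2[OF A K j])
  also have "\<dots> = col (?K * ?C) j"
    unfolding 2[symmetric] by (rule col_mult2[OF K companion_carrier j, symmetric])
  finally show "col (A * ?K) j = col (?K * ?C) j" .
qed (use A carrier_matD[OF companion_carrier[of f]] in \<open>simp_all add: krylov_def\<close>)

section \<open>Existence of the primary rational canonical form\<close>

lemma mat_eq_0_if_kills:
  fixes M :: "'a::comm_ring_1 mat"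
  assumes M: "M \<in> carrier_mat n m" and z: "\<And>w. w \<in> carrier_vec m \<Longrightarrow> M *\<^sub>v w = 0\<^sub>v n"
  shows "M = 0\<^sub>m n m"
proof (rule mat_col_eqI)
  fix j assume "j < dim_col (0\<^sub>m n m :: 'a mat)"
  thus "col M j = col (0\<^sub>m n m) j"
    using z[of "unit_vec m j"] mult_mat_unit_vec[OF M, of j] by simp
qed (use M in auto)

text \<open>\<open>K\<close> embeds an invariant subspace, and \<open>R\<close> is a retraction onto
  it that also intertwines \<open>A\<close> with \<open>C\<close>. So \<open>1 - K R\<close>
  projects onto the invariant complement \<open>ker R\<close>, and its full rank factorisation
  supplies coordinates there.\<close>

lemma similar_block_split:
  fixes A :: "'a::{field,finite} mat"
  assumes A: "A \<in> carrier_mat n n" and K: "K \<in> carrier_mat n d" and R: "R \<in> carrier_mat d n"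
    and C: "C \<in> carrier_mat d d" and RK: "R * K = 1\<^sub>m d" and AK: "A * K = K * C" and RA: "R * A = C * R"
  shows "\<exists>r A'. n = d + r \<and> A' \<in> carrier_mat r r \<and>
    similar_mat A (four_block_mat C (0\<^sub>m d r) (0\<^sub>m r d) A')"
proof -
  define E where "E = 1\<^sub>m n - K * R"
  have KR: "K * R \<in> carrier_mat n n" using K R by simp
  have E: "E \<in> carrier_mat n n" by (simp add: E_def minus_carrier_mat[OF KR])
  obtain r B D B' D' where B: "B \<in> carrier_mat n r" and D: "D \<in> carrier_mat r n"
    and B': "B' \<in> carrier_mat r n" and D': "D' \<in> carrier_mat n r"
    and BB: "B' * B = 1\<^sub>m r" and DD: "D * D' = 1\<^sub>m r" and Eeq: "E = B * D"
    using full_rank_factorization[OF E] by blast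
  have EK: "E * K = 0\<^sub>m n d"
  proof -
    have "E * K = 1\<^sub>m n * K - K * R * K"
      unfolding E_def by (rule minus_mult_distrib_mat[OF one_carrier_mat KR K])
    also have "K * R * K = K"
      using assoc_mult_mat[OF K R K] RK right_mult_one_mat[OF K] by simp
    finally show ?thesis using K by simp
  qed
  have RE: "R * E = 0\<^sub>m d n"
  proof -
    have "R * E = R * 1\<^sub>m n - R * (K * R)"
      unfolding E_def by (rule mult_minus_distrib_mat[OF R one_carrier_mat KR])
    also have "R * (K * R) = R"
      by (rule mult_cancel_one[OF R K R RK])
    finally show ?thesis using R by simp
  qed
  have DK: "D * K = 0\<^sub>m r d"
  proof -
    have "D * K = B' * (B * (D * K))"
      by (rule mult_cancel_one[OF B' B mult_carrier_mat[OF D K] BB, symmetric])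
    also have "B * (D * K) = 0\<^sub>m n d"
      using assoc_mult_mat[OF B D K] EK by (simp add: Eeq)
    finally show ?thesis using right_mult_zero_mat[OF B'] by simp
  qed
  have RB: "R * B = 0\<^sub>m d r"
  proof -
    have "R * B = R * B * (D * D')"
      using right_mult_one_mat[OF mult_carrier_mat[OF R B]] by (simp add: DD)
    also have "\<dots> = R * (B * D) * D'"
      using assoc_mult_mat[OF mult_carrier_mat[OF R B] D D'] assoc_mult_mat[OF R B D] by simp
    also have "\<dots> = 0\<^sub>m d r"
      using RE left_mult_zero_mat[OF D', of d] by (simp add: Eeq)
    finally show ?thesis .
  qed
  have EB: "E * B = B"
  proof -
    have "E * B = 1\<^sub>m n * B - K * R * B"
      unfolding E_def by (rule minus_mult_distrib_mat[OF one_carrier_mat KR B])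
    also have "K * R * B = 0\<^sub>m n r"
      using assoc_mult_mat[OF K R B] RB right_mult_zero_mat[OF K] by simp
    finally show ?thesis using B by (auto simp: mat_eq_iff)
  qed
  have DB: "D * B = 1\<^sub>m r"
  proof -
    have "D * B = B' * (B * (D * B))"
      by (rule mult_cancel_one[OF B' B mult_carrier_mat[OF D B] BB, symmetric])
    also have "B * (D * B) = B"
      using assoc_mult_mat[OF B D B] EB by (simp add: Eeq)
    finally show ?thesis using BB by simp
  qed
  define P where "P = hcat K B"
  define Q where "Q = vcat R D"
  have P: "P \<in> carrier_mat n (d + r)" and Q: "Q \<in> carrier_mat (d + r) n"
    using K B R D by (auto simp: P_def Q_def)
  have PQ: "P * Q = 1\<^sub>m n"
  proof -
    have "P * Q = K * R + E" unfolding P_def Q_def Eeq by (rule hcat_mult_vcat[OF K B R D])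
    thus ?thesis using K R by (auto simp: E_def mat_eq_iff)
  qed
  have QP: "Q * P = 1\<^sub>m (d + r)"
    unfolding P_def Q_def by (simp add: vcat_mult_hcat[OF R D K B] RK RB DK DB)
  have n: "n = d + r" by (rule square_if_two_sided_inverse[OF P Q PQ QP])
  define A' where "A' = D * A * B"
  have A': "A' \<in> carrier_mat r r" using D A B by (auto simp: A'_def)
  have QA: "Q * A = vcat (R * A) (D * A)"
    unfolding Q_def by (rule vcat_mult[OF R D A])
  have "Q * A * P = four_block_mat (R * A * K) (R * A * B) (D * A * K) (D * A * B)"
    unfolding QA P_def using R D A by (intro vcat_mult_hcat[OF _ _ K B]) auto
  also have "R * A * K = C"
    unfolding RA using assoc_mult_mat[OF C R K] RK right_mult_one_mat[OF C] by simp
  also have "R * A * B = 0\<^sub>m d r"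
    unfolding RA using assoc_mult_mat[OF C R B] RB right_mult_zero_mat[OF C] by simp
  also have "D * A * K = 0\<^sub>m r d"
    using assoc_mult_mat[OF D A K] assoc_mult_mat[OF D K C] AK DK left_mult_zero_mat[OF C, of r] by simp
  finally have QAP: "Q * A * P = four_block_mat C (0\<^sub>m d r) (0\<^sub>m r d) A'"
    by (simp add: A'_def)
  have "P * (Q * A * P) * Q = A"
  proof -
    have QA: "Q * A \<in> carrier_mat (d + r) n" using Q A by simp
    have "P * (Q * A * P) = P * (Q * A) * P"
      using assoc_mult_mat[OF P QA P] by simp
    also have "P * (Q * A) = A" by (rule mult_cancel_one[OF P Q A PQ])
    finally have "P * (Q * A * P) * Q = A * (P * Q)"
      using assoc_mult_mat[OF A P Q] by simp
    thus ?thesis using A by (simp add: PQ)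
  qed
  hence "similar_mat A (four_block_mat C (0\<^sub>m d r) (0\<^sub>m r d) A')"
    using P Q A C A' PQ QP unfolding QAP n[symmetric]
    by (intro similar_matI[of _ _ P Q n]) (auto simp: n)
  thus ?thesis using n A' by blast
qed

text \<open>If \<open>v\<close> has order \<open>f = p ^ k\<close>, choose a functional \<open>\<psi>\<close> that is killed by \<open>f\<close> and takes the values
  \<open>0, \<dots>, 0, 1\<close> on \<open>v, A v, \<dots>, A ^ (d - 1) v\<close>. The common kernel of all \<open>\<psi> A ^ i\<close> is an invariant complement
  of the cyclic subspace of \<open>v\<close>, because the Hankel matrix \<open>\<psi> A ^ (i + j) v\<close> is antitriangular.\<close>

lemma split_off_primary_companion:
  fixes A :: "'a::{field,finite} mat"
  assumes A: "A \<in> carrier_mat n n" and n: "n > 0"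
  shows "\<exists>p k r A'. lead_coeff p = 1 \<and> irreducible p \<and> k \<ge> 1 \<and> n = degree (p ^ k) + r \<and>
    A' \<in> carrier_mat r r \<and>
    similar_mat A (four_block_mat (companion_mat (p ^ k)) (0\<^sub>m (degree (p ^ k)) r) (0\<^sub>m r (degree (p ^ k))) A')"
proof -
  \<comment> \<open>\<open>m\<close> is the minimal polynomial. Below, \<open>p ^ k\<close> is its
    full \<open>p\<close>-part, so that a vector of order \<open>p ^ k\<close> generates a direct
    summand.\<close>
  obtain m where lm: "lead_coeff m = 1" and m: "\<And>p. pmat A p = 0\<^sub>m n n \<longleftrightarrow> m dvd p"
    using pmat_annihilator_generator[OF A] by blast
  have m0: "m \<noteq> 0" using lm by auto
  have "degree m \<ge> 1"
  proof (rule ccontr)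
    assume "\<not> degree m \<ge> 1"
    hence "m dvd 1" using m0 by (simp add: is_unit_iff_degree)
    hence "1\<^sub>m n = (0\<^sub>m n n :: 'a mat)" using m[of 1] A by simp
    hence "1\<^sub>m n $$ (0, 0) = (0\<^sub>m n n :: 'a mat) $$ (0, 0)" by simp
    thus False using n by simp
  qed
  then obtain p where p: "lead_coeff p = 1" "irreducible p" and pm: "p dvd m"
    using monic_irreducible_factor by blast
  have pr: "prime_elem p" using p(2) by (rule field_poly_irreducible_imp_prime)
  obtain k s where ks: "m = p ^ k * s" "\<not> p dvd s"
    using irreducible_power_decomposition[OF p(2) m0] by blast
  have k: "k \<ge> 1" using ks pm by (cases k) auto
  define f where "f = p ^ k"
  define d where "d = degree f"
  have lf: "lead_coeff f = 1" using p(1) by (simp add: f_def lead_coeff_power)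
  have dp: "degree p > 0" using p(2) by (auto simp: irreducible_def is_unit_iff_degree)
  have p0: "p \<noteq> 0" using dp by auto
  have d: "d \<ge> 1" using k dp p0 by (simp add: d_def f_def degree_power_eq)
  define S where "S = pmat A s"
  have S: "S \<in> carrier_mat n n" using A by (simp add: S_def)
  \<comment> \<open>Minimality of \<open>m\<close> gives a \<open>w\<close> on which this matrix
    does not vanish; then \<open>v = s(A) w\<close> has order exactly \<open>p ^ k\<close>.\<close>
  have "pmat A (p ^ (k - 1) * s) \<noteq> 0\<^sub>m n n"
  proof
    assume "pmat A (p ^ (k - 1) * s) = 0\<^sub>m n n"
    hence "m dvd p ^ (k - 1) * s" using m by simp
    moreover have nz: "p ^ (k - 1) * s \<noteq> 0" using ks m0 by auto
    ultimately have "degree m \<le> degree (p ^ (k - 1) * s)" by (rule dvd_imp_degree_le)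
    moreover have "m = p * (p ^ (k - 1) * s)" using k by (cases k) (auto simp: ks(1) mult_ac)
    ultimately show False using nz p0 dp by (simp add: degree_mult_eq)
  qed
  then obtain w where w: "w \<in> carrier_vec n" and wnz: "pmat A (p ^ (k - 1) * s) *\<^sub>v w \<noteq> 0\<^sub>v n"
    using mat_eq_0_if_kills[OF pmat_carrier[OF A]] by blast
  define v where "v = S *\<^sub>v w"
  have v: "v \<in> carrier_vec n" using S w by (simp add: v_def)
  have hv: "pmat A h *\<^sub>v v = pmat A (h * s) *\<^sub>v w" for h
    by (simp add: v_def S_def pmat_mult_vec[OF A w])
  have fv: "pmat A f *\<^sub>v v = 0\<^sub>v n"
  proof -
    have "0\<^sub>m n n *\<^sub>v w = 0\<^sub>v n" using w by (intro eq_vecI) auto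
    thus ?thesis using m[of m] by (simp add: hv f_def flip: ks(1))
  qed
  have f0: "f \<noteq> 0" using lf by auto
  obtain g where lg: "lead_coeff g = 1" and g: "\<And>h. pmat A h *\<^sub>v v = 0\<^sub>v n \<longleftrightarrow> g dvd h"
    using vec_annihilator_generator[OF A v] fv f0 by blast
  have "g dvd p ^ k" using g[of f] fv by (simp add: f_def)
  then obtain j where j: "j \<le> k" "g = p ^ j"
    using monic_divisor_of_irreducible_power[OF p(2,1) _ lg] by blast
  have "j = k"
  proof (rule ccontr)
    assume "j \<noteq> k"
    hence "g dvd p ^ (k - 1)" using j by (auto intro: le_imp_power_dvd)
    thus False using g[of "p ^ (k - 1)"] wnz by (simp add: hv)
  qed
  hence ann: "pmat A h *\<^sub>v v = 0\<^sub>v n \<longleftrightarrow> f dvd h" for h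
    using g j by (simp add: f_def)
  define K where "K = krylov A v d"
  have K: "K \<in> carrier_mat n d" using A by (simp add: K_def)
  \<comment> \<open>\<open>s\<close> is prime to \<open>f\<close>, so \<open>S\<close> stays
    injective on the cyclic subspace. Taking \<open>R0 S\<close> as the left inverse of
    \<open>K\<close> ensures that multiplication by \<open>f(A)\<close> on the right kills it, since
    \<open>S f(A) = m(A) = 0\<close>.\<close>
  have "\<exists>R0 \<in> carrier_mat d n. R0 * (S * K) = 1\<^sub>m d"
  proof (rule left_inverse_if_kernel_trivial)
    show "S * K \<in> carrier_mat n d" using S K by simp
    fix x assume x: "x \<in> carrier_vec d" and z: "(S * K) *\<^sub>v x = 0\<^sub>v n"
    have "(S * K) *\<^sub>v x = S *\<^sub>v (pmat A (vpoly x) *\<^sub>v v)"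
      unfolding assoc_mult_mat_vec[OF S K x] unfolding K_def krylov_mult_vec[OF A v x] ..
    also have "\<dots> = pmat A (s * vpoly x) *\<^sub>v v"
      by (simp add: S_def pmat_mult_vec[OF A v])
    finally have "pmat A (s * vpoly x) *\<^sub>v v = 0\<^sub>v n" using z by simp
    hence "f dvd s * vpoly x" using ann by blast
    hence "f dvd vpoly x" unfolding f_def by (rule irreducible_power_dvd_mult[OF p(2) ks(2)])
    hence "vpoly x = 0" using x by (intro dvd_vpoly_imp_0) (auto simp: d_def)
    thus "x = 0\<^sub>v d" using x vpoly_eq_0_iff[of x] by simp
  qed
  then obtain R0 where R0: "R0 \<in> carrier_mat d n" and R0SK: "R0 * (S * K) = 1\<^sub>m d" by blast
  define Rs where "Rs = R0 * S"
  have Rs: "Rs \<in> carrier_mat d n" using R0 S by (simp add: Rs_def)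
  have RsK: "Rs * K = 1\<^sub>m d" using assoc_mult_mat[OF R0 S K] R0SK by (simp add: Rs_def)
  \<comment> \<open>The last row of a left inverse of \<open>K\<close> takes the values
    \<open>0, ..., 0, 1\<close> on the columns of \<open>K\<close>.\<close>
  define \<psi> where "\<psi> = row Rs (d - 1)"
  have \<psi>: "\<psi> \<in> carrier_vec n" using row_carrier[of Rs "d - 1"] by (simp only: \<psi>_def carrier_matD[OF Rs])
  have AT: "transpose_mat A \<in> carrier_mat n n" using A by simp
  have Rsf: "Rs * pmat A f = 0\<^sub>m d n"
  proof -
    have "Rs * pmat A f = R0 * (S * pmat A f)"
      unfolding Rs_def by (rule assoc_mult_mat[OF R0 S pmat_carrier[OF A]])
    also have "S * pmat A f = pmat A m"
      by (simp add: S_def f_def ks(1) mult.commute flip: pmat_mult[OF A])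
    also have "\<dots> = 0\<^sub>m n n" using m[of m] by simp
    finally show ?thesis using right_mult_zero_mat[OF R0] by simp
  qed
  have f\<psi>: "pmat (transpose_mat A) f *\<^sub>v \<psi> = 0\<^sub>v n"
  proof (rule eq_vecI)
    fix i assume "i < dim_vec (0\<^sub>v n :: 'a vec)"
    hence i: "i < n" by simp
    have "(pmat (transpose_mat A) f *\<^sub>v \<psi>) $ i = col (pmat A f) i \<bullet> \<psi>"
      using A i by (simp add: pmat_transpose[OF A])
    also have "\<dots> = \<psi> \<bullet> col (pmat A f) i"
      using \<psi> A i by (intro comm_scalar_prod[of _ n]) auto
    also have "\<dots> = (Rs * pmat A f) $$ (d - 1, i)"
      using Rs A i d by (simp add: \<psi>_def)
    also have "\<dots> = 0" using i d by (simp add: Rsf)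
    finally show "(pmat (transpose_mat A) f *\<^sub>v \<psi>) $ i = 0\<^sub>v n $ i" using i by simp
  qed (use A in \<open>simp add: pmat_transpose[OF A]\<close>)
  define C where "C = companion_mat f"
  have C: "C \<in> carrier_mat d d" by (simp add: C_def d_def)
  \<comment> \<open>The rows of its transpose \<open>R\<close> are
    \<open>\<psi>, \<psi> A, ..., \<psi> A ^ (d - 1)\<close>, so \<open>R K\<close> is the Hankel
    matrix and \<open>ker R\<close> the complement.\<close>
  define K' where "K' = krylov (transpose_mat A) \<psi> d"
  have K': "K' \<in> carrier_mat n d" using krylov_carrier[OF AT] by (simp add: K'_def)
  define R where "R = transpose_mat K'"
  have R: "R \<in> carrier_mat d n" using K' by (simp add: R_def)
  have AK: "A * K = K * C"
    unfolding K_def d_def C_def by (rule krylov_companion[OF A v lf fv])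
  have "transpose_mat A * K' = K' * C"
    unfolding K'_def d_def C_def by (rule krylov_companion[OF AT \<psi> lf f\<psi>])
  hence "transpose_mat (transpose_mat A * K') = transpose_mat (K' * C)" by simp
  hence RA: "R * A = transpose_mat C * R"
    using transpose_mult[OF AT K'] transpose_mult[OF K' C] by (simp add: R_def)
  define N where "N = R * K"
  have N: "N \<in> carrier_mat d d" using R K by (simp add: N_def)
  have Nij: "N $$ (i, j) = \<psi> \<bullet> (pmat A (monom 1 (i + j)) *\<^sub>v v)" if ij: "i < d" "j < d" for i j
  proof -
    have y: "pmat A (monom 1 j) *\<^sub>v v \<in> carrier_vec n"
      by (rule mult_mat_vec_carrier[OF pmat_carrier[OF A] v])
    have c1: "col K' i = transpose_mat (pmat A (monom 1 i)) *\<^sub>v \<psi>"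
      using A ij by (intro eq_vecI) (auto simp: K'_def krylov_def pmat_transpose[OF A])
    have c2: "col K j = pmat A (monom 1 j) *\<^sub>v v"
      using A ij by (intro eq_vecI) (auto simp: K_def krylov_def)
    have "N $$ (i, j) = col K' i \<bullet> col K j"
      using ij R K K' by (simp add: N_def R_def)
    also have "\<dots> = \<psi> \<bullet> (pmat A (monom 1 i) *\<^sub>v (pmat A (monom 1 j) *\<^sub>v v))"
      unfolding c1 c2 by (rule transpose_vec_mult_scalar[OF pmat_carrier[OF A] y \<psi>])
    also have "pmat A (monom 1 i) *\<^sub>v (pmat A (monom 1 j) *\<^sub>v v) = pmat A (monom 1 (i + j)) *\<^sub>v v"
      by (simp add: pmat_mult_vec[OF A v, symmetric] mult_monom)
    finally show ?thesis .
  qed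
  have Nlow: "N $$ (i, j) = (if i + j = d - 1 then 1 else 0)" if ij: "i + j < d" for i j
  proof -
    have c2: "col K (i + j) = pmat A (monom 1 (i + j)) *\<^sub>v v"
      using A ij by (intro eq_vecI) (auto simp: K_def krylov_def)
    have "N $$ (i, j) = (Rs * K) $$ (d - 1, i + j)"
      using Nij[of i j] ij Rs K d by (simp add: \<psi>_def flip: c2)
    thus ?thesis using ij d by (auto simp: RsK)
  qed
  have "\<exists>H \<in> carrier_mat d d. H * N = 1\<^sub>m d"
  proof (rule left_inverse_if_kernel_trivial[OF N])
    fix x assume x: "x \<in> carrier_vec d" and z: "N *\<^sub>v x = 0\<^sub>v d"
    show "x = 0\<^sub>v d"
    proof (rule ccontr)
      assume "x \<noteq> 0\<^sub>v d"
      hence ne: "{j. j < d \<and> x $ j \<noteq> 0} \<noteq> {}" using x by (auto simp: vec_eq_iff)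
      \<comment> \<open>The last nonzero coordinate of \<open>x\<close>. Row
        \<open>d - 1 - j0\<close> of \<open>N\<close> meets the antidiagonal in column
        \<open>j0\<close>: to the left its entries vanish, to the right those of \<open>x\<close>
        do.\<close>
      define j0 where "j0 = Max {j. j < d \<and> x $ j \<noteq> 0}"
      have fin: "finite {j. j < d \<and> x $ j \<noteq> 0}" by simp
      have j0: "j0 < d" "x $ j0 \<noteq> 0" using Max_in[OF fin ne] by (auto simp: j0_def)
      have j0max: "x $ j = 0" if "j0 < j" "j < d" for j
      proof (rule ccontr)
        assume "x $ j \<noteq> 0"
        hence "j \<le> j0" unfolding j0_def using that by (intro Max_ge[OF fin]) simp
        thus False using that by simp
      qed
      define i where "i = d - 1 - j0"
      have i: "i < d" using d by (simp add: i_def)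
      have "(N *\<^sub>v x) $ i = (\<Sum>j = 0..<d. N $$ (i, j) * x $ j)"
        using N x i by (auto simp: scalar_prod_def)
      also have "\<dots> = (\<Sum>j = 0..<d. if j = j0 then x $ j0 else 0)"
      proof (rule sum.cong)
        fix j assume "j \<in> {0..<d}"
        hence j: "j < d" by simp
        consider "j < j0" | "j = j0" | "j > j0" by linarith
        thus "N $$ (i, j) * x $ j = (if j = j0 then x $ j0 else 0)"
        proof cases
          case 1
          hence "i + j < d" "i + j \<noteq> d - 1" using j0 by (auto simp: i_def)
          thus ?thesis using Nlow[of i j] 1 by simp
        next
          case 2
          hence "i + j < d" "i + j = d - 1" using j0 by (auto simp: i_def)
          thus ?thesis using Nlow[of i j] 2 by simp
        qed (use j0max j in simp)
      qed simp
      also have "\<dots> = x $ j0" using j0 by simp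
      finally show False using z i j0 by simp
    qed
  qed
  then obtain H where H: "H \<in> carrier_mat d d" and HN: "H * N = 1\<^sub>m d" by blast
  have NH: "N * H = 1\<^sub>m d" by (rule mat_mult_left_right_inverse[OF H N HN])
  define R1 where "R1 = H * R"
  have R1: "R1 \<in> carrier_mat d n" using H R by (simp add: R1_def)
  have R1K: "R1 * K = 1\<^sub>m d"
    using assoc_mult_mat[OF H R K] HN by (simp add: R1_def N_def)
  have CT: "transpose_mat C \<in> carrier_mat d d" using C by simp
  have R1A: "R1 * A = H * transpose_mat C * R"
    using assoc_mult_mat[OF H R A] assoc_mult_mat[OF H CT R] RA by (simp add: R1_def)
  have HC: "H * transpose_mat C \<in> carrier_mat d d" using H CT by simp
  \<comment> \<open>\<open>R1 A K\<close> is evaluated in two ways. This shows that \<open>N\<close>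
    conjugates \<open>C\<close> to its transpose, which turns the relation for \<open>R\<close> into
    the required one for \<open>R1\<close>.\<close>
  have Ceq: "C = H * transpose_mat C * N"
  proof -
    have "C = R1 * K * C" using C by (simp add: R1K)
    also have "\<dots> = R1 * A * K"
      using assoc_mult_mat[OF R1 K C] assoc_mult_mat[OF R1 A K] AK by simp
    also have "\<dots> = H * transpose_mat C * N"
      unfolding R1A N_def by (rule assoc_mult_mat[OF HC R K])
    finally show ?thesis .
  qed
  have "C * R1 = H * transpose_mat C * (N * (H * R))"
    by (subst Ceq) (simp only: R1_def assoc_mult_mat[OF HC N mult_carrier_mat[OF H R]])
  also have "N * (H * R) = R" by (rule mult_cancel_one[OF N H R NH])
  finally have R1A': "R1 * A = C * R1" using R1A by simp
  obtain r A' where "n = d + r" "A' \<in> carrier_mat r r"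
    "similar_mat A (four_block_mat C (0\<^sub>m d r) (0\<^sub>m r d) A')"
    using similar_block_split[OF A K R1 C R1K AK R1A'] by blast
  thus ?thesis
    using p k unfolding C_def d_def f_def by blast
qed

section \<open>Direct sums of companion blocks\<close>

definition primary_form :: "('a::field poly \<times> nat) list \<Rightarrow> 'a mat" where
  "primary_form xs = diag_block_mat (map (\<lambda>(r, i). companion_mat (r ^ i)) xs)"

definition primary_list :: "('a::field poly \<times> nat) list \<Rightarrow> bool" where
  "primary_list xs \<longleftrightarrow> (\<forall>x\<in>set xs. lead_coeff (fst x) = 1 \<and> irreducible (fst x) \<and> snd x \<ge> 1)"

lemma primary_form_carrier:
  "primary_form xs \<in> carrier_mat (\<Sum>x\<leftarrow>xs. degree (fst x ^ snd x)) (\<Sum>x\<leftarrow>xs. degree (fst x ^ snd x))"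
  unfolding primary_form_def
  by (intro carrier_matI)
     (auto simp: dim_diag_block_mat carrier_matD[OF companion_carrier] o_def case_prod_beta)

lemma primary_form_Cons:
  assumes "primary_form xs \<in> carrier_mat r r"
  shows "primary_form ((p, k) # xs) = four_block_mat (companion_mat (p ^ k)) (0\<^sub>m (degree (p ^ k)) r)
    (0\<^sub>m r (degree (p ^ k))) (primary_form xs)"
  using assms by (simp add: primary_form_def Let_def carrier_matD[OF companion_carrier])

theorem primary_form_exists:
  fixes A :: "'a::{field,finite} mat"
  assumes "A \<in> carrier_mat n n"
  shows "\<exists>xs. primary_list xs \<and> similar_mat A (primary_form xs)"
  using assms
proof (induction n arbitrary: A rule: less_induct)
  case (less n)
  show ?case
  proof (cases "n = 0")
    case True
    hence "A = primary_form []" using less.prems by (auto simp: primary_form_def)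
    thus ?thesis
      using less.prems by (intro exI[of _ "[]"]) (auto simp: primary_list_def intro: similar_mat_refl)
  next
    case False
    then obtain p k r A' where p: "lead_coeff p = 1" "irreducible p" "k \<ge> 1"
      and n: "n = degree (p ^ k) + r" and A': "A' \<in> carrier_mat r r"
      and sim: "similar_mat A (four_block_mat (companion_mat (p ^ k)) (0\<^sub>m (degree (p ^ k)) r)
        (0\<^sub>m r (degree (p ^ k))) A')"
      using split_off_primary_companion[OF less.prems] by blast
    have "degree p > 0" using p(2) by (auto simp: irreducible_def is_unit_iff_degree)
    hence "degree (p ^ k) > 0" using p(3) by (subst degree_power_eq) auto
    hence "r < n" using n by simp
    then obtain xs where xs: "primary_list xs" "similar_mat A' (primary_form xs)"
      using less.IH A' by blast
    have "primary_form xs \<in> carrier_mat r r"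
      using similar_matD[OF xs(2)] A' by auto
    moreover have "similar_mat A (four_block_mat (companion_mat (p ^ k)) (0\<^sub>m (degree (p ^ k)) r)
        (0\<^sub>m r (degree (p ^ k))) (primary_form xs))"
      by (rule similar_mat_trans[OF sim similar_mat_four_block_0_0[OF
            similar_mat_refl[OF companion_carrier] xs(2) companion_carrier A']])
    ultimately have "similar_mat A (primary_form ((p, k) # xs))"
      by (simp add: primary_form_Cons)
    thus ?thesis
      using xs(1) p by (intro exI[of _ "(p, k) # xs"]) (auto simp: primary_list_def)
  qed
qed

section \<open>Uniqueness of the elementary divisors\<close>

text \<open>Over a finite field the cardinality of a kernel carries the information of its dimension.\<close>

definition ker_card :: "'a::field mat \<Rightarrow> 'a poly \<Rightarrow> nat" where
  "ker_card A p = card {v \<in> carrier_vec (dim_row A). pmat A p *\<^sub>v v = 0\<^sub>v (dim_row A)}"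

lemma ker_card_altdef:
  "A \<in> carrier_mat n n \<Longrightarrow> ker_card A p = card {v \<in> carrier_vec n. pmat A p *\<^sub>v v = 0\<^sub>v n}"
  by (simp add: ker_card_def)

text \<open>\<open>X\<close> maps the kernel of \<open>p(A')\<close> into that of
  \<open>p(A)\<close>. Injectivity is asked for on that kernel only, because \<open>C\<close> may
  have a kernel of its own when it serves as intertwiner.\<close>

lemma ker_card_le_if_intertwined:
  fixes A :: "'a::{field,finite} mat"
  assumes A: "A \<in> carrier_mat n n" and A': "A' \<in> carrier_mat k k" and X: "X \<in> carrier_mat n k"
    and AX: "A * X = X * A'"
    and inj: "\<And>v. v \<in> carrier_vec k \<Longrightarrow> pmat A' p *\<^sub>v v = 0\<^sub>v k \<Longrightarrow> X *\<^sub>v v = 0\<^sub>v n \<Longrightarrow> v = 0\<^sub>v k"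
  shows "ker_card A' p \<le> ker_card A p"
  unfolding ker_card_altdef[OF A] ker_card_altdef[OF A']
proof (rule card_inj_on_le[where f = "\<lambda>v. X *\<^sub>v v"])
  show "inj_on (\<lambda>v. X *\<^sub>v v) {v \<in> carrier_vec k. pmat A' p *\<^sub>v v = 0\<^sub>v k}"
  proof (rule inj_onI, clarify)
    fix u v assume u: "u \<in> carrier_vec k" "pmat A' p *\<^sub>v u = 0\<^sub>v k"
      and v: "v \<in> carrier_vec k" "pmat A' p *\<^sub>v v = 0\<^sub>v k" and eq: "X *\<^sub>v u = X *\<^sub>v v"
    have "X *\<^sub>v (u - v) = X *\<^sub>v u - X *\<^sub>v v" by (rule mult_minus_distrib_mat_vec[OF X u(1) v(1)])
    also have "\<dots> = 0\<^sub>v n"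
      unfolding eq using mult_mat_vec_carrier[OF X v(1)] by (rule minus_cancel_vec)
    finally have 1: "X *\<^sub>v (u - v) = 0\<^sub>v n" .
    have "pmat A' p *\<^sub>v (u - v) = pmat A' p *\<^sub>v u - pmat A' p *\<^sub>v v"
      by (rule mult_minus_distrib_mat_vec[OF pmat_carrier[OF A'] u(1) v(1)])
    also have "\<dots> = 0\<^sub>v k" by (simp add: u v)
    finally have "u - v = 0\<^sub>v k" using inj[of "u - v"] u v 1 by simp
    thus "u = v" using u v by (auto simp: vec_eq_iff)
  qed
  show "(\<lambda>v. X *\<^sub>v v) ` {v \<in> carrier_vec k. pmat A' p *\<^sub>v v = 0\<^sub>v k} \<subseteq>
      {v \<in> carrier_vec n. pmat A p *\<^sub>v v = 0\<^sub>v n}"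
  proof clarify
    fix v assume v: "v \<in> carrier_vec k" "pmat A' p *\<^sub>v v = 0\<^sub>v k"
    have "pmat A p *\<^sub>v (X *\<^sub>v v) = X *\<^sub>v (pmat A' p *\<^sub>v v)"
      using assoc_mult_mat_vec[OF pmat_carrier[OF A, of p] X v(1)]
        assoc_mult_mat_vec[OF X pmat_carrier[OF A', of p] v(1)] pmat_intertwine[OF A A' X AX, of p]
      by simp
    thus "X *\<^sub>v v \<in> carrier_vec n \<and> pmat A p *\<^sub>v (X *\<^sub>v v) = 0\<^sub>v n"
      using v X mult_mat_vec_zero[OF X] by auto
  qed
qed simp

lemma ker_card_similar:
  fixes A :: "'a::{field,finite} mat"
  assumes "similar_mat A B"
  shows "ker_card A p = ker_card B p"
proof -
  have le: "ker_card B p \<le> ker_card A p" if "similar_mat A B" for A B :: "'a mat"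
  proof -
    from similar_matD[OF that] obtain n P Q where c: "{A, B, P, Q} \<subseteq> carrier_mat n n"
      and PQ: "P * Q = 1\<^sub>m n" and QP: "Q * P = 1\<^sub>m n" and AB: "A = P * B * Q" by blast
    from c have A: "A \<in> carrier_mat n n" and B: "B \<in> carrier_mat n n"
      and P: "P \<in> carrier_mat n n" and Q: "Q \<in> carrier_mat n n" by auto
    have PB: "P * B \<in> carrier_mat n n" using P B by simp
    have "A * P = P * B"
      unfolding AB using assoc_mult_mat[OF PB Q P] QP right_mult_one_mat[OF PB] by simp
    thus ?thesis
    proof (rule ker_card_le_if_intertwined[OF A B P])
      fix v assume v: "v \<in> carrier_vec n" "P *\<^sub>v v = 0\<^sub>v n"
      have "v = (Q * P) *\<^sub>v v" using v by (simp add: QP)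
      also have "\<dots> = 0\<^sub>v n"
        using assoc_mult_mat_vec[OF Q P v(1)] v(2) mult_mat_vec_zero[OF Q] by simp
      finally show "v = 0\<^sub>v n" .
    qed
  qed
  show ?thesis using le[OF assms] le[OF similar_mat_sym[OF assms]] by simp
qed

lemma pmat_four_block:
  assumes A: "A \<in> carrier_mat a a" and B: "B \<in> carrier_mat b b"
  shows "pmat (four_block_mat A (0\<^sub>m a b) (0\<^sub>m b a) B) p =
    four_block_mat (pmat A p) (0\<^sub>m a b) (0\<^sub>m b a) (pmat B p)"
proof (induction p)
  case 0
  show ?case
    using A B by (simp add: pmat_0[of _ "a + b"])
next
  case (pCons c p)
  let ?F = "four_block_mat A (0\<^sub>m a b) (0\<^sub>m b a) B"
  have F: "?F \<in> carrier_mat (a + b) (a + b)" using A B by simp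
  have P: "pmat A p \<in> carrier_mat a a" "pmat B p \<in> carrier_mat b b" using A B by auto
  have AP: "A * pmat A p \<in> carrier_mat a a" "B * pmat B p \<in> carrier_mat b b" using A B P by auto
  have "pmat ?F (pCons c p) = c \<cdot>\<^sub>m 1\<^sub>m (a + b) +
      four_block_mat (A * pmat A p) (0\<^sub>m a b) (0\<^sub>m b a) (B * pmat B p)"
    unfolding pmat_pCons[OF F] pCons four_block_mult_0[OF A B P] ..
  also have "\<dots> = four_block_mat (c \<cdot>\<^sub>m 1\<^sub>m a + A * pmat A p) (0\<^sub>m a b) (0\<^sub>m b a) (c \<cdot>\<^sub>m 1\<^sub>m b + B * pmat B p)"
  proof -
    have "c \<cdot>\<^sub>m 1\<^sub>m (a + b) + four_block_mat M (0\<^sub>m a b) (0\<^sub>m b a) N =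
        four_block_mat (c \<cdot>\<^sub>m 1\<^sub>m a + M) (0\<^sub>m a b) (0\<^sub>m b a) (c \<cdot>\<^sub>m 1\<^sub>m b + N)"
      if "M \<in> carrier_mat a a" "N \<in> carrier_mat b b" for M N :: "'a mat"
      using that by (intro eq_matI) auto
    thus ?thesis using AP by blast
  qed
  finally show ?case by (simp add: pmat_pCons[OF A] pmat_pCons[OF B])
qed

lemma ker_card_four_block:
  fixes A :: "'a::{field,finite} mat"
  assumes A: "A \<in> carrier_mat a a" and B: "B \<in> carrier_mat b b"
  shows "ker_card (four_block_mat A (0\<^sub>m a b) (0\<^sub>m b a) B) p = ker_card A p * ker_card B p"
proof -
  let ?F = "four_block_mat A (0\<^sub>m a b) (0\<^sub>m b a) B"
  have F: "?F \<in> carrier_mat (a + b) (a + b)" using A B by simp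
  let ?KA = "{v \<in> carrier_vec a. pmat A p *\<^sub>v v = 0\<^sub>v a}"
  let ?KB = "{v \<in> carrier_vec b. pmat B p *\<^sub>v v = 0\<^sub>v b}"
  let ?K = "{v \<in> carrier_vec (a + b). pmat ?F p *\<^sub>v v = 0\<^sub>v (a + b)}"
  have app0: "x @\<^sub>v y = 0\<^sub>v (a + b) \<longleftrightarrow> x = 0\<^sub>v a \<and> y = 0\<^sub>v b"
    if "x \<in> carrier_vec a" "y \<in> carrier_vec b" for x y :: "'a vec"
  proof -
    have "0\<^sub>v (a + b) = 0\<^sub>v a @\<^sub>v (0\<^sub>v b :: 'a vec)" by (intro eq_vecI) auto
    thus ?thesis using append_vec_eq[OF that(1), of "0\<^sub>v a" y "0\<^sub>v b"] by simp
  qed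
  have mem: "u @\<^sub>v v \<in> ?K \<longleftrightarrow> u \<in> ?KA \<and> v \<in> ?KB" if u: "u \<in> carrier_vec a" and v: "v \<in> carrier_vec b" for u v
  proof -
    have "pmat ?F p *\<^sub>v (u @\<^sub>v v) = pmat A p *\<^sub>v u @\<^sub>v pmat B p *\<^sub>v v"
      unfolding pmat_four_block[OF A B] by (rule mult_mat_vec_split[OF pmat_carrier[OF A] pmat_carrier[OF B] u v])
    thus ?thesis
      using u v app0[OF mult_mat_vec_carrier[OF pmat_carrier[OF A] u] mult_mat_vec_carrier[OF pmat_carrier[OF B] v]]
      by simp
  qed
  have "bij_betw (\<lambda>(u, v). u @\<^sub>v v) (?KA \<times> ?KB) ?K"
  proof (rule bij_betw_imageI)
    show "inj_on (\<lambda>(u, v). u @\<^sub>v v) (?KA \<times> ?KB)"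
      by (rule inj_onI) (auto simp: append_vec_eq)
    show "(\<lambda>(u, v). u @\<^sub>v v) ` (?KA \<times> ?KB) = ?K"
    proof (intro equalityI subsetI)
      fix x assume "x \<in> (\<lambda>(u, v). u @\<^sub>v v) ` (?KA \<times> ?KB)"
      then obtain u v where x: "x = u @\<^sub>v v" and uv: "u \<in> ?KA" "v \<in> ?KB" by auto
      have "u \<in> carrier_vec a" "v \<in> carrier_vec b" using uv by auto
      from mem[OF this] show "x \<in> ?K" using uv x by blast
    next
      fix x assume x: "x \<in> ?K"
      let ?u = "vec_first x a" and ?v = "vec_last x b"
      have e: "?u @\<^sub>v ?v = x" using x by (intro vec_first_last_append) simp
      have "?u \<in> ?KA \<and> ?v \<in> ?KB" using mem[of ?u ?v] x e by simp
      thus "x \<in> (\<lambda>(u, v). u @\<^sub>v v) ` (?KA \<times> ?KB)"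
        using e by (intro image_eqI[where x = "(?u, ?v)"]) auto
    qed
  qed
  from bij_betw_same_card[OF this] show ?thesis
    by (simp add: ker_card_altdef[OF A] ker_card_altdef[OF B] ker_card_altdef[OF F] card_cartesian_product)
qed

section \<open>Kernels of polynomials in a companion matrix\<close>

lemma vpoly_add_smult:
  assumes "x \<in> carrier_vec d" "y \<in> carrier_vec d"
  shows "vpoly (a \<cdot>\<^sub>v x + y) = smult a (vpoly x) + vpoly y"
  using assms by (intro poly_eqI) (simp add: coeff_vpoly)

lemma vpoly_companion_mult:
  assumes f: "lead_coeff f = 1" and y: "y \<in> carrier_vec (degree f)"
  shows "f dvd vpoly (companion_mat f *\<^sub>v y) - [:0, 1:] * vpoly y"
proof -
  let ?d = "degree f" and ?C = "companion_mat f"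
  have C: "?C \<in> carrier_mat ?d ?d" by simp
  have "vpoly (?C *\<^sub>v y) = (\<Sum>j<?d. smult (y $ j) (vpoly (col ?C j)))"
  proof (rule poly_eqI)
    fix i
    show "coeff (vpoly (?C *\<^sub>v y)) i = coeff (\<Sum>j<?d. smult (y $ j) (vpoly (col ?C j))) i"
      using y carrier_matD[OF C]
      by (cases "i < ?d")
         (auto simp: coeff_vpoly coeff_sum scalar_prod_def atLeast0LessThan mult.commute intro!: sum.cong)
  qed
  moreover have "[:0, 1:] * vpoly y = (\<Sum>j<?d. smult (y $ j) (monom 1 (Suc j)))"
  proof -
    have "[:0, 1:] * vpoly y = (\<Sum>j<?d. [:0, 1:] * smult (y $ j) (monom 1 j))"
      using y by (simp only: vpoly_def sum_distrib_left carrier_vecD)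
    also have "\<dots> = (\<Sum>j<?d. smult (y $ j) (monom 1 (Suc j)))"
      by (intro sum.cong) (auto simp: monom_Suc)
    finally show ?thesis .
  qed
  ultimately have "vpoly (?C *\<^sub>v y) - [:0, 1:] * vpoly y =
      (\<Sum>j<?d. smult (y $ j) (vpoly (col ?C j) - monom 1 (Suc j)))"
    by (simp add: sum_subtractf smult_diff_right)
  also have "f dvd \<dots>"
    using f by (intro dvd_sum dvd_smult) (auto simp: vpoly_companion_col)
  finally show ?thesis .
qed

text \<open>As the companion matrix acts by multiplication by \<open>t\<close>, its value under
  \<open>p\<close> acts by multiplication by \<open>p\<close>. A congruence modulo \<open>f\<close>
  suffices, so remainders are never computed.\<close>

lemma vpoly_pmat_companion:
  assumes f: "lead_coeff f = 1" and x: "x \<in> carrier_vec (degree f)"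
  shows "f dvd vpoly (pmat (companion_mat f) p *\<^sub>v x) - p * vpoly x"
proof (induction p)
  case 0
  have "vpoly (pmat (companion_mat f) 0 *\<^sub>v x) = 0"
    using x by (intro poly_eqI) (simp add: coeff_vpoly pmat_0[OF companion_carrier])
  thus ?case by simp
next
  case (pCons a p)
  let ?C = "companion_mat f" and ?d = "degree f"
  have C: "?C \<in> carrier_mat ?d ?d" by simp
  define y where "y = pmat ?C p *\<^sub>v x"
  have y: "y \<in> carrier_vec ?d" unfolding y_def by (rule mult_mat_vec_carrier[OF pmat_carrier[OF C] x])
  have "pmat ?C (pCons a p) *\<^sub>v x = (a \<cdot>\<^sub>m 1\<^sub>m ?d) *\<^sub>v x + (?C * pmat ?C p) *\<^sub>v x"
    unfolding pmat_pCons[OF C]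
    by (rule add_mult_distrib_mat_vec[OF _ mult_carrier_mat[OF C pmat_carrier[OF C]] x]) simp
  also have "(a \<cdot>\<^sub>m 1\<^sub>m ?d) *\<^sub>v x = a \<cdot>\<^sub>v x"
    using x by (intro eq_vecI) auto
  also have "(?C * pmat ?C p) *\<^sub>v x = ?C *\<^sub>v y"
    unfolding y_def by (rule assoc_mult_mat_vec[OF C pmat_carrier[OF C] x])
  finally have "vpoly (pmat ?C (pCons a p) *\<^sub>v x) = smult a (vpoly x) + vpoly (?C *\<^sub>v y)"
    using vpoly_add_smult[OF x mult_mat_vec_carrier[OF C y]] by simp
  hence "vpoly (pmat ?C (pCons a p) *\<^sub>v x) - pCons a p * vpoly x =
      (vpoly (?C *\<^sub>v y) - [:0, 1:] * vpoly y) + [:0, 1:] * (vpoly y - p * vpoly x)"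
    by (simp add: algebra_simps)
  also have "f dvd \<dots>"
    using pCons vpoly_companion_mult[OF f y] unfolding y_def by (intro dvd_add dvd_mult)
  finally show ?case .
qed

text \<open>Vectors stand for polynomials of degree below \<open>degree f\<close>, where vanishing
  is the same as divisibility by \<open>f\<close>.\<close>

lemma ker_card_companion:
  assumes f: "lead_coeff f = 1"
  shows "ker_card (companion_mat f) p = card {x \<in> carrier_vec (degree f). f dvd p * vpoly x}"
proof -
  let ?C = "companion_mat f" and ?d = "degree f"
  have C: "?C \<in> carrier_mat ?d ?d" by simp
  have "pmat ?C p *\<^sub>v x = 0\<^sub>v ?d \<longleftrightarrow> f dvd p * vpoly x" if x: "x \<in> carrier_vec ?d" for x
  proof -
    let ?y = "pmat ?C p *\<^sub>v x"
    have y: "?y \<in> carrier_vec ?d" by (rule mult_mat_vec_carrier[OF pmat_carrier[OF C] x])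
    have "?y = 0\<^sub>v ?d \<longleftrightarrow> vpoly ?y = 0" using y by (simp only: vpoly_eq_0_iff carrier_vecD)
    also have "\<dots> \<longleftrightarrow> f dvd vpoly ?y"
      using dvd_vpoly_imp_0[of f ?y] carrier_vecD[OF y] by auto
    also have "\<dots> \<longleftrightarrow> f dvd p * vpoly x"
      using dvd_add_right_iff[OF vpoly_pmat_companion[OF f x, of p], of "p * vpoly x"] by simp
    finally show ?thesis .
  qed
  hence "{v \<in> carrier_vec ?d. pmat ?C p *\<^sub>v v = 0\<^sub>v ?d} = {x \<in> carrier_vec ?d. f dvd p * vpoly x}"
    by blast
  thus ?thesis unfolding ker_card_altdef[OF C] by simp
qed

lemma vpoly_vec_coeff:
  assumes "\<And>i. i \<ge> d \<Longrightarrow> coeff h i = 0"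
  shows "vpoly (vec d (coeff h)) = h"
  using assms by (intro poly_eqI) (simp add: coeff_vpoly)

lemma vpoly_inj: "x \<in> carrier_vec d \<Longrightarrow> y \<in> carrier_vec d \<Longrightarrow> vpoly x = vpoly y \<Longrightarrow> x = y"
  using coeff_vpoly[of x] coeff_vpoly[of y] by (intro eq_vecI) (metis carrier_vecD)+

text \<open>Multiplication by \<open>g\<close> is a bijection from the polynomials of degree below
  \<open>d - degree g\<close>.\<close>

lemma card_multiples:
  fixes g :: "'a::{field,finite} poly"
  assumes g: "g \<noteq> 0" "degree g \<le> d"
  shows "card {x \<in> carrier_vec d. g dvd vpoly x} = card (UNIV :: 'a set) ^ (d - degree g)"
proof -
  let ?e = "d - degree g"
  have low: "coeff (g * vpoly y) i = 0" if "y \<in> carrier_vec ?e" "i \<ge> d" for y i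
  proof (cases "vpoly y = 0")
    case False
    have "coeff (vpoly y) (degree (vpoly y)) \<noteq> 0" using False by simp
    hence "degree (vpoly y) < ?e" using that(1) by (simp add: coeff_vpoly split: if_splits)
    hence "degree (g * vpoly y) < d" using g False by (simp add: degree_mult_eq)
    thus ?thesis using that(2) by (intro coeff_eq_0) simp
  qed simp
  define \<phi> where "\<phi> = (\<lambda>y. vec d (coeff (g * vpoly y)))"
  have \<phi>: "vpoly (\<phi> y) = g * vpoly y" if "y \<in> carrier_vec ?e" for y
    unfolding \<phi>_def using low[OF that] by (rule vpoly_vec_coeff)
  have "bij_betw \<phi> (carrier_vec ?e) {x \<in> carrier_vec d. g dvd vpoly x}"
  proof (rule bij_betw_imageI)
    show "inj_on \<phi> (carrier_vec ?e)"
    proof (rule inj_onI)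
      fix x y assume xy: "x \<in> carrier_vec ?e" "y \<in> carrier_vec ?e" "\<phi> x = \<phi> y"
      hence "g * vpoly x = g * vpoly y" using \<phi> by metis
      hence "vpoly x = vpoly y" using g by simp
      thus "x = y" using xy vpoly_inj by blast
    qed
    show "\<phi> ` carrier_vec ?e = {x \<in> carrier_vec d. g dvd vpoly x}"
    proof (intro equalityI subsetI)
      fix x assume "x \<in> \<phi> ` carrier_vec ?e"
      thus "x \<in> {x \<in> carrier_vec d. g dvd vpoly x}" using \<phi> by (auto simp: \<phi>_def)
    next
      fix x assume x: "x \<in> {x \<in> carrier_vec d. g dvd vpoly x}"
      then obtain h where h: "vpoly x = g * h" by (auto simp: dvd_def)
      have "coeff h i = 0" if "i \<ge> ?e" for i
      proof (cases "h = 0")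
        case False
        hence nz: "vpoly x \<noteq> 0" using h g by simp
        hence "coeff (vpoly x) (degree (vpoly x)) \<noteq> 0" by simp
        hence "degree (vpoly x) < d" using x by (simp add: coeff_vpoly split: if_splits)
        hence "degree g + degree h < d" using h False g by (simp add: degree_mult_eq)
        thus ?thesis using that by (intro coeff_eq_0) simp
      qed simp
      hence "vpoly (vec ?e (coeff h)) = h" by (rule vpoly_vec_coeff)
      hence "vpoly (\<phi> (vec ?e (coeff h))) = vpoly x" using \<phi>[of "vec ?e (coeff h)"] h by simp
      hence "\<phi> (vec ?e (coeff h)) = x" using x by (intro vpoly_inj[of _ d]) (auto simp: \<phi>_def)
      thus "x \<in> \<phi> ` carrier_vec ?e" by (intro image_eqI[where x = "vec ?e (coeff h)"]) simp_all
    qed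
  qed
  from bij_betw_same_card[OF this] show ?thesis by (simp add: card_carrier_vec_finite)
qed

text \<open>In \<open>F[t]/p^i\<close> the kernel of \<open>p^j\<close> is generated by
  \<open>p^(i - j)\<close>.\<close>

lemma ker_card_companion_power:
  fixes p :: "'a::{field,finite} poly"
  assumes p: "lead_coeff p = 1" "irreducible p"
  shows "ker_card (companion_mat (p ^ i)) (p ^ j) = card (UNIV :: 'a set) ^ (degree p * min i j)"
proof -
  have p0: "p \<noteq> 0" using p by auto
  have lf: "lead_coeff (p ^ i) = 1" using p by (simp add: lead_coeff_power)
  \<comment> \<open>For \<open>j > i\<close> the exponent \<open>i - j\<close> truncates to
    \<open>0\<close>, and both divisibilities hold.\<close>
  have "p ^ i dvd p ^ j * y \<longleftrightarrow> p ^ (i - j) dvd y" for y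
  proof (cases "j \<le> i")
    case True
    hence "p ^ i = p ^ j * p ^ (i - j)" by (simp flip: power_add)
    thus ?thesis using p0 dvd_times_left_cancel_iff[of "p ^ j" "p ^ (i - j)" y] by simp
  qed (simp add: dvd_mult2 le_imp_power_dvd)
  hence "{x \<in> carrier_vec (degree (p ^ i)). p ^ i dvd p ^ j * vpoly x} =
      {x \<in> carrier_vec (degree (p ^ i)). p ^ (i - j) dvd vpoly x}" by simp
  moreover have "degree (p ^ i) - degree (p ^ (i - j)) = degree p * min i j"
    using p0 by (simp add: degree_power_eq min_def flip: diff_mult_distrib)
  ultimately show ?thesis
    unfolding ker_card_companion[OF lf]
    using card_multiples[of "p ^ (i - j)" "degree (p ^ i)"] p0 by (simp add: degree_power_eq)
qed

lemma monic_irreducible_dvd_imp_eq: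
  fixes p r :: "'a::field poly"
  assumes p: "lead_coeff p = 1" "irreducible p" and r: "lead_coeff r = 1" "irreducible r" and d: "r dvd p"
  shows "r = p"
proof -
  have "r dvd p ^ 1" using d by simp
  from monic_divisor_of_irreducible_power[OF p(2,1) this r(1)] obtain j where "j \<le> 1" "r = p ^ j" by blast
  moreover have "r \<noteq> 1" using r(2) by auto
  ultimately show ?thesis by (cases j) auto
qed

text \<open>\<open>p ^ j\<close> is a unit modulo \<open>r ^ i\<close>, so the kernel is
  zero.\<close>

lemma ker_card_companion_power_other:
  fixes p :: "'a::{field,finite} poly"
  assumes p: "lead_coeff p = 1" "irreducible p" and r: "lead_coeff r = 1" "irreducible r" and ne: "r \<noteq> p"
  shows "ker_card (companion_mat (r ^ i)) (p ^ j) = 1"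
proof -
  have lf: "lead_coeff (r ^ i) = 1" using r by (simp add: lead_coeff_power)
  have "\<not> r dvd p ^ j"
    using monic_irreducible_dvd_imp_eq[OF p r] ne field_poly_irreducible_imp_prime[OF r(2)]
      prime_elem_dvd_power by blast
  hence dvd: "r ^ i dvd p ^ j * vpoly x \<longleftrightarrow> vpoly x = 0" if "x \<in> carrier_vec (degree (r ^ i))" for x
    using that irreducible_power_dvd_mult[OF r(2), of "p ^ j" i "vpoly x"] dvd_vpoly_imp_0[of "r ^ i" x]
    by auto
  have "{x \<in> carrier_vec (degree (r ^ i)). r ^ i dvd p ^ j * vpoly x} = {0\<^sub>v (degree (r ^ i))}"
  proof -
    have "vpoly x = 0 \<longleftrightarrow> x = 0\<^sub>v (degree (r ^ i))" if "x \<in> carrier_vec (degree (r ^ i))" for x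
      using vpoly_eq_0_iff[of x] that by (simp only: carrier_vecD)
    thus ?thesis using dvd zero_carrier_vec by blast
  qed
  thus ?thesis by (simp add: ker_card_companion[OF lf])
qed

text \<open>The partition at \<open>p\<close> for an arbitrary multiset, so that it can be used
  before \<open>elem_divs\<close> is known to be well defined.\<close>

definition prime_parts :: "('a poly \<times> nat) multiset \<Rightarrow> 'a::field poly \<Rightarrow> nat multiset" where
  "prime_parts D p = image_mset snd (filter_mset (\<lambda>x. fst x = p) D)"

lemma count_prime_parts: "count (prime_parts D p) i = count D (p, i)"
  by (induction D) (auto simp: prime_parts_def)

lemma primary_list_Cons:
  "primary_list (x # xs) \<longleftrightarrow> lead_coeff (fst x) = 1 \<and> irreducible (fst x) \<and> snd x \<ge> 1 \<and> primary_list xs"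
  by (auto simp: primary_list_def)

lemma ker_card_primary_form:
  fixes p :: "'a::{field,finite} poly"
  assumes p: "lead_coeff p = 1" "irreducible p" and xs: "primary_list xs"
  shows "ker_card (primary_form xs) (p ^ j) =
    card (UNIV :: 'a set) ^ (degree p * (\<Sum>i\<in>#prime_parts (mset xs) p. min i j))"
  using xs
proof (induction xs)
  case Nil
  have "primary_form [] = (0\<^sub>m 0 0 :: 'a mat)" by (simp add: primary_form_def)
  moreover have "{v \<in> carrier_vec 0. pmat (0\<^sub>m 0 0) (p ^ j) *\<^sub>v v = 0\<^sub>v 0} = (carrier_vec 0 :: 'a vec set)"
    using mult_mat_vec_carrier[OF pmat_carrier[of "0\<^sub>m 0 0 :: 'a mat" 0 "p ^ j"]]
    by (auto simp: vec_eq_iff)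
  ultimately show ?case
    by (simp add: ker_card_def card_carrier_vec_finite prime_parts_def)
next
  case (Cons x xs)
  obtain r i where x: "x = (r, i)" by force
  let ?n = "\<Sum>x\<leftarrow>xs. degree (fst x ^ snd x)"
  have r: "lead_coeff r = 1" "irreducible r" and xs: "primary_list xs"
    using Cons.prems by (auto simp: primary_list_Cons x)
  have "ker_card (primary_form (x # xs)) (p ^ j) = ker_card (companion_mat (r ^ i)) (p ^ j) * ker_card (primary_form xs) (p ^ j)"
    unfolding x primary_form_Cons[OF primary_form_carrier]
    by (rule ker_card_four_block[OF companion_carrier primary_form_carrier])
  thus ?case
    using Cons.IH[OF xs] ker_card_companion_power[OF p, of i j] ker_card_companion_power_other[OF p r, of i j]
    by (cases "r = p") (auto simp: x prime_parts_def power_add distrib_left)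
qed

text \<open>The first differences in \<open>j\<close> count the parts larger than \<open>j\<close>,
  the second differences the parts equal to \<open>j + 1\<close>. Parts equal to 0 leave no trace in
  the sums and are therefore excluded.\<close>

lemma multiset_eq_if_min_sums_eq:
  fixes M N :: "nat multiset"
  assumes eq: "\<And>j. (\<Sum>i\<in>#M. min i j) = (\<Sum>i\<in>#N. min i j)" and pos: "0 \<notin># M" "0 \<notin># N"
  shows "M = N"
proof (rule multiset_eqI)
  have step: "(\<Sum>i\<in>#M. min i (Suc j)) = (\<Sum>i\<in>#M. min i j) + size (filter_mset (\<lambda>i. j < i) M)"
    for M :: "nat multiset" and j
    by (induction M) auto
  have cnt: "size (filter_mset (\<lambda>i. j < i) M) = count M (Suc j) + size (filter_mset (\<lambda>i. Suc j < i) M)"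
    for M :: "nat multiset" and j
    by (induction M) auto
  have sz: "size (filter_mset (\<lambda>i. j < i) M) = size (filter_mset (\<lambda>i. j < i) N)" for j
    using step[of j M] step[of j N] eq by simp
  fix i
  show "count M i = count N i"
    using pos cnt[of "i - 1" M] cnt[of "i - 1" N] sz[of "i - 1"] sz[of i]
    by (cases i) (simp_all add: not_in_iff)
qed

lemma prime_parts_pos: "primary_list xs \<Longrightarrow> 0 \<notin># prime_parts (mset xs) p"
  by (auto simp: primary_list_def prime_parts_def)

text \<open>Kernel sizes are similarity invariants, and by \<open>ker_card_primary_form\<close>
  their exponents are the sums of \<open>min i j\<close> that determine the parts at each
  \<open>p\<close>.\<close>

lemma primary_form_unique:
  fixes A :: "'a::{field,finite} mat"
  assumes xs: "primary_list xs" "similar_mat A (primary_form xs)"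
    and ys: "primary_list ys" "similar_mat A (primary_form ys)"
  shows "mset xs = mset ys"
proof -
  have parts: "prime_parts (mset xs) p = prime_parts (mset ys) p" if p: "lead_coeff p = 1" "irreducible p" for p
  proof (rule multiset_eq_if_min_sums_eq[OF _ prime_parts_pos[OF xs(1)] prime_parts_pos[OF ys(1)]])
    fix j
    have dp: "degree p > 0" using p by (auto simp: irreducible_def is_unit_iff_degree)
    have "ker_card (primary_form xs) (p ^ j) = ker_card (primary_form ys) (p ^ j)"
      using ker_card_similar[OF xs(2)] ker_card_similar[OF ys(2)] by metis
    hence "degree p * (\<Sum>i\<in>#prime_parts (mset xs) p. min i j) =
        degree p * (\<Sum>i\<in>#prime_parts (mset ys) p. min i j)"
      unfolding ker_card_primary_form[OF p xs(1)] ker_card_primary_form[OF p ys(1)]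
      using two_le_card_field[where 'a = 'a] by (subst (asm) power_inject_exp) auto
    thus "(\<Sum>i\<in>#prime_parts (mset xs) p. min i j) = (\<Sum>i\<in>#prime_parts (mset ys) p. min i j)"
      using dp nat_mult_eq_cancel1 by blast
  qed
  show ?thesis
  proof (rule multiset_eqI)
    fix x :: "'a poly \<times> nat"
    obtain p i where x: "x = (p, i)" by force
    show "count (mset xs) x = count (mset ys) x"
    proof (cases "lead_coeff p = 1 \<and> irreducible p")
      case True
      thus ?thesis using parts[of p] count_prime_parts[of _ p i] unfolding x by metis
    next
      case False
      hence "x \<notin> set xs" "x \<notin> set ys" using xs(1) ys(1) by (auto simp: x primary_list_def)
      thus ?thesis by (metis count_eq_zero_iff set_mset_mset)
    qed
  qed
qed

text \<open>Uniqueness resolves the definite description in \<open>elem_divs\<close>: any block form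
  found for \<open>A\<close> computes it.\<close>

lemma elem_divs_eqI:
  fixes A :: "'a::{field,finite} mat"
  assumes xs: "primary_list xs" "similar_mat A (primary_form xs)"
  shows "elem_divs A = mset xs"
  unfolding elem_divs_def
proof (rule the_equality)
  show "(\<forall>x\<in>#mset xs. lead_coeff (fst x) = 1 \<and> irreducible (fst x) \<and> snd x \<ge> 1) \<and>
      (\<exists>ys. mset ys = mset xs \<and> similar_mat A (diag_block_mat (map (\<lambda>(r, i). companion_mat (r ^ i)) ys)))"
    using xs by (auto simp: primary_list_def primary_form_def)
next
  fix D assume D: "(\<forall>x\<in>#D. lead_coeff (fst x) = 1 \<and> irreducible (fst x) \<and> snd x \<ge> 1) \<and>
      (\<exists>ys. mset ys = D \<and> similar_mat A (diag_block_mat (map (\<lambda>(r, i). companion_mat (r ^ i)) ys)))"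
  then obtain ys where "mset ys = D" "similar_mat A (primary_form ys)"
    by (auto simp: primary_form_def)
  moreover from this D have "primary_list ys" by (auto simp: primary_list_def)
  ultimately show "D = mset xs" using primary_form_unique[OF xs] by metis
qed

lemma elem_divs_primary_list:
  fixes A :: "'a::{field,finite} mat"
  assumes "A \<in> carrier_mat n n"
  obtains xs where "primary_list xs" "similar_mat A (primary_form xs)" "elem_divs A = mset xs"
  using primary_form_exists[OF assms] elem_divs_eqI by blast

lemma elem_divs_similar:
  fixes A :: "'a::{field,finite} mat"
  assumes A: "A \<in> carrier_mat n n" and sim: "similar_mat A B"
  shows "elem_divs A = elem_divs B"
proof -
  obtain xs where xs: "primary_list xs" "similar_mat A (primary_form xs)" "elem_divs A = mset xs"
    using elem_divs_primary_list[OF A] .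
  have "similar_mat B (primary_form xs)"
    by (rule similar_mat_trans[OF similar_mat_sym[OF sim] xs(2)])
  thus ?thesis using elem_divs_eqI[OF xs(1)] xs(3) by simp
qed

lemma mod_type_of_similar:
  fixes A :: "'a::{field,finite} mat"
  assumes "A \<in> carrier_mat n n" "similar_mat A B"
  shows "mod_type_of A = mod_type_of B"
  using elem_divs_similar[OF assms] by (simp add: mod_type_of_def type_of_def fun_eq_iff)

lemma type_of_prime_parts: "type_of A p = prime_parts (elem_divs A) p"
  by (simp add: type_of_def prime_parts_def)

lemma ker_card_type_of:
  fixes A :: "'a::{field,finite} mat"
  assumes A: "A \<in> carrier_mat n n" and p: "lead_coeff p = 1" "irreducible p"
  shows "ker_card A (p ^ j) = card (UNIV :: 'a set) ^ (degree p * (\<Sum>i\<in>#type_of A p. min i j))"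
proof -
  obtain xs where xs: "primary_list xs" "similar_mat A (primary_form xs)" "elem_divs A = mset xs"
    using elem_divs_primary_list[OF A] .
  show ?thesis
    unfolding ker_card_similar[OF xs(2)] ker_card_primary_form[OF p xs(1)] type_of_prime_parts xs(3) ..
qed

lemma type_of_pos:
  fixes A :: "'a::{field,finite} mat"
  assumes A: "A \<in> carrier_mat n n"
  shows "0 \<notin># type_of A p"
  using elem_divs_primary_list[OF A] prime_parts_pos unfolding type_of_prime_parts by metis

lemma type_of_nonempty:
  fixes A :: "'a::{field,finite} mat"
  assumes A: "A \<in> carrier_mat n n" and ne: "type_of A p \<noteq> {#}"
  shows "lead_coeff p = 1 \<and> irreducible p"
proof -
  obtain xs where xs: "primary_list xs" "elem_divs A = mset xs"
    using elem_divs_primary_list[OF A] by metis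
  obtain i where "i \<in># type_of A p" using ne by blast
  hence "\<exists>x\<in>set xs. fst x = p"
    by (auto simp: type_of_prime_parts prime_parts_def xs)
  thus ?thesis using xs(1) by (auto simp: primary_list_def)
qed

lemma finite_type_of_support: "finite {p. type_of A p \<noteq> {#}}"
proof (rule finite_subset)
  show "{p. type_of A p \<noteq> {#}} \<subseteq> fst ` set_mset (elem_divs A)"
    by (force simp: type_of_prime_parts prime_parts_def dest!: multiset_nonemptyE)
qed simp

lemma elem_divs_eq_if_type_of_eq:
  assumes "type_of A = type_of B"
  shows "elem_divs A = elem_divs B"
proof (rule multiset_eqI)
  fix x :: "'a poly \<times> nat"
  show "count (elem_divs A) x = count (elem_divs B) x"
    using fun_cong[OF assms, of "fst x"] count_prime_parts[of _ "fst x" "snd x"]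
    unfolding type_of_prime_parts by (metis prod.collapse)
qed

lemma dim_elem_divs:
  fixes A :: "'a::{field,finite} mat"
  assumes A: "A \<in> carrier_mat n n"
  shows "n = (\<Sum>x\<in>#elem_divs A. degree (fst x ^ snd x))"
proof -
  obtain xs where xs: "similar_mat A (primary_form xs)" "elem_divs A = mset xs"
    using elem_divs_primary_list[OF A] by metis
  have "dim_row (primary_form xs) = n" using similar_matD[OF xs(1)] A by auto
  moreover have "dim_row (primary_form xs) = (\<Sum>x\<leftarrow>xs. degree (fst x ^ snd x))"
    using carrier_matD(1)[OF primary_form_carrier] .
  ultimately show ?thesis by (simp add: xs(2) sum_mset_sum_list flip: mset_map)
qed

section \<open>Modified types and full rank factorisations\<close>

text \<open>Injectivity of \<open>B\<close> and surjectivity of \<open>C\<close> are recorded by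
  one-sided inverses; \<open>a\<close> is then the rank of \<open>B C\<close>.\<close>

definition full_rank_pair :: "nat \<Rightarrow> nat \<Rightarrow> 'a::field mat \<Rightarrow> 'a mat \<Rightarrow> bool" where
  "full_rank_pair m a B C \<longleftrightarrow> B \<in> carrier_mat m a \<and> C \<in> carrier_mat a m \<and>
    (\<exists>B' \<in> carrier_mat a m. B' * B = 1\<^sub>m a) \<and> (\<exists>C' \<in> carrier_mat m a. C * C' = 1\<^sub>m a)"

lemma full_rank_pair_exists:
  assumes "A \<in> carrier_mat m m"
  shows "\<exists>a B C. full_rank_pair m a B C \<and> A = 1\<^sub>m m + B * C"
proof -
  have "A - 1\<^sub>m m \<in> carrier_mat m m" by (rule minus_carrier_mat[OF one_carrier_mat])
  from full_rank_factorization[OF this] obtain a B C B' C' where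
    f: "B \<in> carrier_mat m a" "C \<in> carrier_mat a m" "B' \<in> carrier_mat a m" "C' \<in> carrier_mat m a"
      "B' * B = 1\<^sub>m a" "C * C' = 1\<^sub>m a" and eq: "A - 1\<^sub>m m = B * C" by blast
  have "A = 1\<^sub>m m + (A - 1\<^sub>m m)" using assms by (intro eq_matI) auto
  thus ?thesis using f unfolding eq full_rank_pair_def by blast
qed

lemma pmat_fixed_vec:
  assumes A: "A \<in> carrier_mat n n" and v: "v \<in> carrier_vec n" and Av: "A *\<^sub>v v = v"
  shows "pmat A p *\<^sub>v v = poly p 1 \<cdot>\<^sub>v v"
proof (induction p)
  case 0
  show ?case using A v by (intro eq_vecI) auto
next
  case (pCons a p)
  have P: "pmat A p \<in> carrier_mat n n" using A by auto
  have "pmat A (pCons a p) *\<^sub>v v = (a \<cdot>\<^sub>m 1\<^sub>m n) *\<^sub>v v + (A * pmat A p) *\<^sub>v v"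
    unfolding pmat_pCons[OF A] by (rule add_mult_distrib_mat_vec[OF _ mult_carrier_mat[OF A P] v]) simp
  also have "(a \<cdot>\<^sub>m 1\<^sub>m n) *\<^sub>v v = a \<cdot>\<^sub>v v"
    using v by (intro eq_vecI) auto
  also have "(A * pmat A p) *\<^sub>v v = poly p 1 \<cdot>\<^sub>v v"
    using assoc_mult_mat_vec[OF A P v] mult_mat_vec[OF A v, of "poly p 1"] pCons Av by simp
  also have "a \<cdot>\<^sub>v v + poly p 1 \<cdot>\<^sub>v v = poly (pCons a p) 1 \<cdot>\<^sub>v v"
    by (intro eq_vecI) (auto simp: algebra_simps)
  finally show ?case .
qed

lemma left_inverse_imp_inj:
  fixes B :: "'a::field mat"
  assumes B: "B \<in> carrier_mat m a" and B': "B' \<in> carrier_mat a m" and BB: "B' * B = 1\<^sub>m a"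
    and v: "v \<in> carrier_vec a" and Bv: "B *\<^sub>v v = 0\<^sub>v m"
  shows "v = 0\<^sub>v a"
  using assoc_mult_mat_vec[OF B' B v] mult_mat_vec_zero[OF B'] BB Bv v by simp

lemma one_plus_intertwine:
  fixes B :: "'a::field mat"
  assumes B: "B \<in> carrier_mat m a" and C: "C \<in> carrier_mat a m"
  shows "(1\<^sub>m m + B * C) * B = B * (1\<^sub>m a + C * B)" "(1\<^sub>m a + C * B) * C = C * (1\<^sub>m m + B * C)"
proof -
  have BC: "B * C \<in> carrier_mat m m" and CB: "C * B \<in> carrier_mat a a" using B C by auto
  show "(1\<^sub>m m + B * C) * B = B * (1\<^sub>m a + C * B)"
    using add_mult_distrib_mat[OF one_carrier_mat BC B] mult_add_distrib_mat[OF B one_carrier_mat CB]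
      assoc_mult_mat[OF B C B] B by simp
  show "(1\<^sub>m a + C * B) * C = C * (1\<^sub>m m + B * C)"
    using add_mult_distrib_mat[OF one_carrier_mat CB C] mult_add_distrib_mat[OF C one_carrier_mat BC]
      assoc_mult_mat[OF C B C] C by simp
qed

text \<open>\<open>B\<close> and \<open>C\<close> intertwine the two matrices in opposite
  directions. \<open>B\<close> is injective, and the kernel of \<open>C\<close> consists of fixed
  vectors of \<open>1 + B C\<close>, on which \<open>p\<close> acts as the nonzero scalar
  \<open>p(1)\<close>.\<close>

lemma ker_card_one_plus:
  fixes B :: "'a::{field,finite} mat"
  assumes r: "full_rank_pair m a B C" and p: "poly p 1 \<noteq> 0"
  shows "ker_card (1\<^sub>m m + B * C) p = ker_card (1\<^sub>m a + C * B) p"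
proof -
  from r obtain B' where B: "B \<in> carrier_mat m a" and C: "C \<in> carrier_mat a m"
    and B': "B' \<in> carrier_mat a m" "B' * B = 1\<^sub>m a" by (auto simp: full_rank_pair_def)
  have A: "1\<^sub>m m + B * C \<in> carrier_mat m m" and A': "1\<^sub>m a + C * B \<in> carrier_mat a a"
    using B C by auto
  have BC: "B * C \<in> carrier_mat m m" using B C by auto
  have "ker_card (1\<^sub>m a + C * B) p \<le> ker_card (1\<^sub>m m + B * C) p"
    by (rule ker_card_le_if_intertwined[OF A A' B one_plus_intertwine(1)[OF B C]])
       (rule left_inverse_imp_inj[OF B B'])
  moreover have "ker_card (1\<^sub>m m + B * C) p \<le> ker_card (1\<^sub>m a + C * B) p"
  proof (rule ker_card_le_if_intertwined[OF A' A C one_plus_intertwine(2)[OF B C]])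
    fix v assume v: "v \<in> carrier_vec m" and z: "pmat (1\<^sub>m m + B * C) p *\<^sub>v v = 0\<^sub>v m"
      and Cv: "C *\<^sub>v v = 0\<^sub>v a"
    have "(1\<^sub>m m + B * C) *\<^sub>v v = 1\<^sub>m m *\<^sub>v v + (B * C) *\<^sub>v v"
      by (rule add_mult_distrib_mat_vec[OF one_carrier_mat BC v])
    also have "(B * C) *\<^sub>v v = 0\<^sub>v m"
      using assoc_mult_mat_vec[OF B C v] Cv mult_mat_vec_zero[OF B] by simp
    finally have "(1\<^sub>m m + B * C) *\<^sub>v v = v" using v by simp
    hence pv: "poly p 1 \<cdot>\<^sub>v v = 0\<^sub>v m" using pmat_fixed_vec[OF A v] z by simp
    show "v = 0\<^sub>v m"
    proof (rule eq_vecI)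
      fix i assume i: "i < dim_vec (0\<^sub>v m :: 'a vec)"
      have "(poly p 1 \<cdot>\<^sub>v v) $ i = 0" using pv i by simp
      thus "v $ i = 0\<^sub>v m $ i" using p v i by simp
    qed (use v in simp)
  qed
  ultimately show ?thesis by simp
qed

text \<open>For \<open>A = 1 + B C\<close> and \<open>A' = 1 + C B\<close> one has
  \<open>(A - 1) ^ (j + 1) = B (A' - 1) ^ j C\<close>. So the kernel on the left is the preimage of
  the kernel of \<open>(A' - 1) ^ j\<close> under the surjection \<open>C\<close>, and
  \<open>ker C = ker (A - 1)\<close>.\<close>

lemma ker_card_one_plus_unipotent:
  fixes B :: "'a::{field,finite} mat"
  assumes r: "full_rank_pair m a B C"
  shows "ker_card (1\<^sub>m m + B * C) ([:-1, 1:] ^ Suc j) =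
    ker_card (1\<^sub>m m + B * C) [:-1, 1:] * ker_card (1\<^sub>m a + C * B) ([:-1, 1:] ^ j)"
proof -
  let ?A = "1\<^sub>m m + B * C" and ?A' = "1\<^sub>m a + C * B" and ?l = "[:-1, 1:] :: 'a poly"
  from r obtain B' C' where B: "B \<in> carrier_mat m a" and C: "C \<in> carrier_mat a m"
    and B': "B' \<in> carrier_mat a m" "B' * B = 1\<^sub>m a"
    and C': "C' \<in> carrier_mat m a" "C * C' = 1\<^sub>m a" by (auto simp: full_rank_pair_def)
  have A: "?A \<in> carrier_mat m m" and A': "?A' \<in> carrier_mat a a" and BC: "B * C \<in> carrier_mat m m"
    using B C by auto
  have Al: "pmat ?A ?l = B * C"
  proof -
    have "-1 \<cdot>\<^sub>m 1\<^sub>m m + (1\<^sub>m m + M) = M" if "M \<in> carrier_mat m m" for M :: "'a mat"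
      using that by (intro eq_matI) auto
    from this[OF BC] show ?thesis unfolding pmat_linear[OF A] .
  qed
  define P where "P = pmat ?A' (?l ^ j)"
  have P: "P \<in> carrier_mat a a" unfolding P_def using A' by (rule pmat_carrier)
  have "pmat ?A (?l ^ Suc j) = pmat ?A (?l ^ j) * (B * C)"
    unfolding power_Suc2 pmat_mult[OF A] Al ..
  also have "\<dots> = (pmat ?A (?l ^ j) * B) * C"
    by (rule assoc_mult_mat[OF pmat_carrier[OF A] B C, symmetric])
  also have "pmat ?A (?l ^ j) * B = B * P"
    unfolding P_def by (rule pmat_intertwine[OF A A' B one_plus_intertwine(1)[OF B C]])
  finally have Alj: "pmat ?A (?l ^ Suc j) = B * P * C" .
  have Binj: "B *\<^sub>v u = 0\<^sub>v m \<longleftrightarrow> u = 0\<^sub>v a" if "u \<in> carrier_vec a" for u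
    using left_inverse_imp_inj[OF B B' that] mult_mat_vec_zero[OF B] by auto
  let ?K1 = "{v \<in> carrier_vec m. C *\<^sub>v v = 0\<^sub>v a}"
  let ?K' = "{u \<in> carrier_vec a. P *\<^sub>v u = 0\<^sub>v a}"
  let ?K = "{v \<in> carrier_vec m. P *\<^sub>v (C *\<^sub>v v) = 0\<^sub>v a}"
  have 1: "ker_card ?A ?l = card ?K1"
  proof -
    have "(B * C) *\<^sub>v v = 0\<^sub>v m \<longleftrightarrow> C *\<^sub>v v = 0\<^sub>v a" if "v \<in> carrier_vec m" for v
      using Binj[OF mult_mat_vec_carrier[OF C that]] assoc_mult_mat_vec[OF B C that] by simp
    thus ?thesis unfolding ker_card_altdef[OF A] Al by metis
  qed
  have 2: "ker_card ?A (?l ^ Suc j) = card ?K"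
  proof -
    have "(B * P * C) *\<^sub>v v = 0\<^sub>v m \<longleftrightarrow> P *\<^sub>v (C *\<^sub>v v) = 0\<^sub>v a" if v: "v \<in> carrier_vec m" for v
    proof -
      have Cv: "C *\<^sub>v v \<in> carrier_vec a" by (rule mult_mat_vec_carrier[OF C v])
      have "(B * P * C) *\<^sub>v v = B *\<^sub>v (P *\<^sub>v (C *\<^sub>v v))"
        using assoc_mult_mat_vec[OF mult_carrier_mat[OF B P] C v] assoc_mult_mat_vec[OF B P Cv] by simp
      thus ?thesis using Binj[OF mult_mat_vec_carrier[OF P Cv]] by simp
    qed
    thus ?thesis unfolding ker_card_altdef[OF A] Alj by metis
  qed
  have CC': "C *\<^sub>v (C' *\<^sub>v u) = u" if "u \<in> carrier_vec a" for u
    using assoc_mult_mat_vec[OF C C'(1) that] C'(2) that by simp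
  have add: "C *\<^sub>v (w + C' *\<^sub>v u) = C *\<^sub>v w + u" if "w \<in> carrier_vec m" "u \<in> carrier_vec a" for w u
    using mult_add_distrib_mat_vec[OF C that(1) mult_mat_vec_carrier[OF C'(1) that(2)]] CC'[OF that(2)]
    by simp
  have cancel: "w + y - y = w" "w - y + y = w" if "w \<in> carrier_vec m" "y \<in> carrier_vec m" for w y :: "'a vec"
    using that by (auto simp: vec_eq_iff)
  \<comment> \<open>\<open>C'\<close> is a section of \<open>C\<close>, which splits the preimage as
    a product.\<close>
  have "bij_betw (\<lambda>(w, u). w + C' *\<^sub>v u) (?K1 \<times> ?K') ?K"
  proof (rule bij_betwI[where g = "\<lambda>v. (v - C' *\<^sub>v (C *\<^sub>v v), C *\<^sub>v v)"])
    show "(\<lambda>(w, u). w + C' *\<^sub>v u) \<in> ?K1 \<times> ?K' \<rightarrow> ?K"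
      using add C' by auto
    show "(\<lambda>v. (v - C' *\<^sub>v (C *\<^sub>v v), C *\<^sub>v v)) \<in> ?K \<rightarrow> ?K1 \<times> ?K'"
    proof
      fix v assume v: "v \<in> ?K"
      hence Cv: "C *\<^sub>v v \<in> carrier_vec a" using C by simp
      have C'Cv: "C' *\<^sub>v (C *\<^sub>v v) \<in> carrier_vec m" by (rule mult_mat_vec_carrier[OF C'(1) Cv])
      have "C *\<^sub>v (v - C' *\<^sub>v (C *\<^sub>v v)) = C *\<^sub>v v - C *\<^sub>v v"
        using mult_minus_distrib_mat_vec[OF C _ C'Cv, of v] v CC'[OF Cv] by simp
      also have "\<dots> = 0\<^sub>v a" by (rule minus_cancel_vec[OF Cv])
      finally show "(v - C' *\<^sub>v (C *\<^sub>v v), C *\<^sub>v v) \<in> ?K1 \<times> ?K'"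
        using v Cv C'Cv by simp
    qed
    show "(\<lambda>v. (v - C' *\<^sub>v (C *\<^sub>v v), C *\<^sub>v v)) ((\<lambda>(w, u). w + C' *\<^sub>v u) x) = x" if "x \<in> ?K1 \<times> ?K'" for x
    proof -
      obtain w u where x: "x = (w, u)" and w: "w \<in> carrier_vec m" "C *\<^sub>v w = 0\<^sub>v a" and u: "u \<in> carrier_vec a"
        using \<open>x \<in> _\<close> by auto
      have "C *\<^sub>v (w + C' *\<^sub>v u) = u" using add[OF w(1) u] w u by simp
      moreover have "w + C' *\<^sub>v u - C' *\<^sub>v u = w"
        by (rule cancel(1)[OF w(1) mult_mat_vec_carrier[OF C'(1) u]])
      ultimately show ?thesis by (simp add: x)
    qed
    show "(\<lambda>(w, u). w + C' *\<^sub>v u) ((\<lambda>v. (v - C' *\<^sub>v (C *\<^sub>v v), C *\<^sub>v v)) v) = v" if "v \<in> ?K" for v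
      using that cancel(2)[OF _ mult_mat_vec_carrier[OF C'(1) mult_mat_vec_carrier[OF C]], of v v] by simp
  qed
  from bij_betw_same_card[OF this] show ?thesis
    unfolding 1 2 ker_card_altdef[OF A'] P_def[symmetric] by (simp add: card_cartesian_product)
qed

lemma irreducible_t_minus_1: "irreducible ([:-1, 1:] :: 'a::field poly)"
  by (rule irreducible_linear_field_poly) simp

text \<open>At \<open>t - 1\<close> the kernel of \<open>1 + B C\<close> at exponent
  \<open>j + 1\<close> exceeds that of \<open>1 + C B\<close> at exponent \<open>j\<close> by the
  factor \<open>q ^ size M\<close>, exactly as lowering every part by one predicts. At any other
  \<open>p\<close> the kernel sizes agree because \<open>p(1) \<noteq> 0\<close>.\<close>

theorem mod_type_of_one_plus:
  fixes B :: "'a::{field,finite} mat"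
  assumes r: "full_rank_pair m a B C"
  shows "mod_type_of (1\<^sub>m m + B * C) = type_of (1\<^sub>m a + C * B)"
proof
  fix p :: "'a poly"
  let ?A = "1\<^sub>m m + B * C" and ?A' = "1\<^sub>m a + C * B" and ?l = "[:-1, 1:] :: 'a poly"
  have B: "B \<in> carrier_mat m a" and C: "C \<in> carrier_mat a m" using r by (auto simp: full_rank_pair_def)
  have A: "?A \<in> carrier_mat m m" and A': "?A' \<in> carrier_mat a a"
    using B C by auto
  have q: "card (UNIV :: 'a set) > 1" using two_le_card_field[where 'a = 'a] by simp
  show "mod_type_of ?A p = type_of ?A' p"
  proof (cases "p = ?l")
    case True
    define M where "M = type_of ?A ?l"
    define N where "N = type_of ?A' ?l"
    have M0: "0 \<notin># M" and N0: "0 \<notin># N"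
      using type_of_pos[OF A] type_of_pos[OF A'] by (auto simp: M_def N_def)
    \<comment> \<open>A positive part \<open>i\<close> contributes
      \<open>min i (j + 1) = 1 + min (i - 1) j\<close>.\<close>
    have sh: "(\<Sum>i\<in>#M. min i (Suc j)) = size M + (\<Sum>i\<in>#filter_mset (\<lambda>i. i \<noteq> 0) (image_mset (\<lambda>i. i - 1) M). min i j)" for j
      using M0
    proof (induction M)
      case (add x M)
      thus ?case by (cases x) auto
    qed simp
    have "filter_mset (\<lambda>i. i \<noteq> 0) (image_mset (\<lambda>i. i - 1) M) = N"
    proof (rule multiset_eq_if_min_sums_eq[OF _ _ N0])
      fix j
      have "ker_card ?A (?l ^ Suc j) = ker_card ?A (?l ^ 1) * ker_card ?A' (?l ^ j)"
        using ker_card_one_plus_unipotent[OF r] by simp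
      hence "card (UNIV :: 'a set) ^ (\<Sum>i\<in>#M. min i (Suc j)) =
          card (UNIV :: 'a set) ^ ((\<Sum>i\<in>#M. min i 1) + (\<Sum>i\<in>#N. min i j))"
        using ker_card_type_of[OF A _ irreducible_t_minus_1, of "Suc j"] ker_card_type_of[OF A _ irreducible_t_minus_1, of 1]
          ker_card_type_of[OF A' _ irreducible_t_minus_1, of j]
        by (simp add: M_def N_def power_add)
      hence "(\<Sum>i\<in>#M. min i (Suc j)) = (\<Sum>i\<in>#M. min i 1) + (\<Sum>i\<in>#N. min i j)"
        using q by (subst (asm) power_inject_exp) auto
      moreover have "(\<Sum>i\<in>#M. min i 1) = size M"
        using M0 by (induction M) auto
      ultimately show "(\<Sum>i\<in>#filter_mset (\<lambda>i. i \<noteq> 0) (image_mset (\<lambda>i. i - 1) M). min i j) = (\<Sum>i\<in>#N. min i j)"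
        using sh[of j] by simp
    qed simp
    moreover have "mod_type_of ?A ?l = filter_mset (\<lambda>i. i \<noteq> 0) (image_mset (\<lambda>i. i - 1) M)"
      unfolding mod_type_of_def M_def by (rule if_P) (rule refl)
    ultimately have "mod_type_of ?A ?l = N" by (rule trans[rotated])
    thus ?thesis unfolding N_def True .
  next
    case False
    hence mt: "mod_type_of ?A p = type_of ?A p" by (simp add: mod_type_of_def)
    show ?thesis
    proof (cases "lead_coeff p = 1 \<and> irreducible p")
      case True
      hence p: "lead_coeff p = 1" "irreducible p" by auto
      have p1: "poly p 1 \<noteq> 0"
      proof
        assume "poly p 1 = 0"
        hence "?l dvd p" using poly_eq_0_iff_dvd[of p 1] by simp
        hence "?l = p" by (intro monic_irreducible_dvd_imp_eq[OF p _ irreducible_t_minus_1]) simp_all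
        thus False using False by simp
      qed
      have "type_of ?A p = type_of ?A' p"
      proof (rule multiset_eq_if_min_sums_eq[OF _ type_of_pos[OF A] type_of_pos[OF A']])
        fix j
        have "ker_card ?A (p ^ j) = ker_card ?A' (p ^ j)"
          using p1 by (intro ker_card_one_plus[OF r]) (simp add: poly_power)
        hence "degree p * (\<Sum>i\<in>#type_of ?A p. min i j) = degree p * (\<Sum>i\<in>#type_of ?A' p. min i j)"
          unfolding ker_card_type_of[OF A p] ker_card_type_of[OF A' p]
          using q by (subst (asm) power_inject_exp) auto
        moreover have "degree p > 0" using p by (auto simp: irreducible_def is_unit_iff_degree)
        ultimately show "(\<Sum>i\<in>#type_of ?A p. min i j) = (\<Sum>i\<in>#type_of ?A' p. min i j)"
          using nat_mult_eq_cancel1 by blast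
      qed
      thus ?thesis by (simp add: mt)
    next
      case False
      hence "type_of ?A p = {#}" "type_of ?A' p = {#}"
        using type_of_nonempty[OF A, of p] type_of_nonempty[OF A', of p] by blast+
      thus ?thesis by (simp add: mt)
    qed
  qed
qed

text \<open>The modified type determines the elementary divisors of \<open>1 + C B\<close>, whose
  total degree is \<open>a\<close>. So the rank of \<open>g - 1\<close> depends on the modified type
  alone and not on the size of \<open>g\<close>.\<close>

lemma full_rank_pair_rank_unique:
  fixes B :: "'a::{field,finite} mat"
  assumes r: "full_rank_pair m a B C" and r': "full_rank_pair m' a' B' C'"
    and eq: "mod_type_of (1\<^sub>m m + B * C) = mod_type_of (1\<^sub>m m' + B' * C')"
  shows "a = a'"
proof -
  let ?A = "1\<^sub>m a + C * B" and ?A' = "1\<^sub>m a' + C' * B'"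
  have eq': "elem_divs ?A = elem_divs ?A'"
    using eq mod_type_of_one_plus[OF r] mod_type_of_one_plus[OF r'] by (intro elem_divs_eq_if_type_of_eq) simp
  have A: "?A \<in> carrier_mat a a" and A': "?A' \<in> carrier_mat a' a'"
    using r r' by (auto simp: full_rank_pair_def)
  have "a = (\<Sum>x\<in>#elem_divs ?A. degree (fst x ^ snd x))" by (rule dim_elem_divs[OF A])
  also have "\<dots> = a'" unfolding eq' by (rule dim_elem_divs[OF A', symmetric])
  finally show ?thesis .
qed

section \<open>Reordering blocks and padding by the identity\<close>

lemma similar_swap_blocks:
  fixes A :: "'a::field mat"
  assumes A: "A \<in> carrier_mat a a" and B: "B \<in> carrier_mat b b"
  shows "similar_mat (four_block_mat A (0\<^sub>m a b) (0\<^sub>m b a) B) (four_block_mat B (0\<^sub>m b a) (0\<^sub>m a b) A)"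
proof -
  let ?P = "four_block_mat (0\<^sub>m a b) (1\<^sub>m a) (1\<^sub>m b) (0\<^sub>m b a) :: 'a mat"
  let ?Q = "four_block_mat (0\<^sub>m b a) (1\<^sub>m b) (1\<^sub>m a) (0\<^sub>m a b) :: 'a mat"
  have PQ: "?P * ?Q = 1\<^sub>m (a + b)"
    by (subst mult_four_block_mat[of _ a b _ a _ b _ _ a _ b]) auto
  have QP: "?Q * ?P = 1\<^sub>m (a + b)"
    by (subst mult_four_block_mat[of _ b a _ b _ a _ _ b _ a]) (auto simp: add.commute)
  have "?P * four_block_mat B (0\<^sub>m b a) (0\<^sub>m a b) A = four_block_mat (0\<^sub>m a b) A B (0\<^sub>m b a)"
    using A B by (subst mult_four_block_mat[of _ a b _ a _ b _ _ b _ a]) auto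
  hence "?P * four_block_mat B (0\<^sub>m b a) (0\<^sub>m a b) A * ?Q = four_block_mat A (0\<^sub>m a b) (0\<^sub>m b a) B"
    using A B by simp (subst mult_four_block_mat[of _ a b _ a _ b _ _ a _ b], auto)
  thus ?thesis
    using A B PQ QP by (intro similar_matI[of _ _ ?P ?Q "a + b"]) (auto simp: add.commute)
qed

lemma primary_form_Cons_carrier:
  "primary_form (x # xs) = four_block_mat (companion_mat (fst x ^ snd x))
    (0\<^sub>m (degree (fst x ^ snd x)) (\<Sum>x\<leftarrow>xs. degree (fst x ^ snd x)))
    (0\<^sub>m (\<Sum>x\<leftarrow>xs. degree (fst x ^ snd x)) (degree (fst x ^ snd x))) (primary_form xs)"
  using primary_form_Cons[OF primary_form_carrier, of "fst x" "snd x" xs] by simp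

lemma similar_primary_form_Cons:
  assumes "similar_mat (primary_form xs) (primary_form ys)"
  shows "similar_mat (primary_form (x # xs)) (primary_form (x # ys))"
proof -
  let ?n = "\<lambda>xs. \<Sum>x\<leftarrow>xs. degree (fst x ^ snd x)"
  have "dim_row (primary_form xs) = dim_row (primary_form ys)"
    using similar_matD[OF assms] by auto
  hence "?n xs = ?n ys"
    by (simp only: carrier_matD[OF primary_form_carrier])
  thus ?thesis
    unfolding primary_form_Cons_carrier
    using similar_mat_four_block_0_0[OF similar_mat_refl[OF companion_carrier] assms
        companion_carrier primary_form_carrier]
    by simp
qed

lemma similar_primary_form_swap:
  "similar_mat (primary_form (x # y # zs)) (primary_form (y # x # zs :: ('a::field poly \<times> nat) list))"
proof -
  define X Y Z where "X = companion_mat (fst x ^ snd x)" and "Y = companion_mat (fst y ^ snd y)"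
    and "Z = primary_form zs"
  define a b c where "a = degree (fst x ^ snd x)" and "b = degree (fst y ^ snd y)"
    and "c = (\<Sum>x\<leftarrow>zs. degree (fst x ^ snd x))"
  have car: "X \<in> carrier_mat a a" "Y \<in> carrier_mat b b" "Z \<in> carrier_mat c c"
    using primary_form_carrier[of zs] by (auto simp: X_def Y_def Z_def a_def b_def c_def)
  have form: "primary_form (x # y # zs) = four_block_mat (four_block_mat X (0\<^sub>m a b) (0\<^sub>m b a) Y)
      (0\<^sub>m (a + b) c) (0\<^sub>m c (a + b)) Z"
    if "X = companion_mat (fst x ^ snd x)" "Y = companion_mat (fst y ^ snd y)"
      "a = degree (fst x ^ snd x)" "b = degree (fst y ^ snd y)" for x y :: "'a poly \<times> nat" and X Y a b
  proof -
    have "X \<in> carrier_mat a a" "Y \<in> carrier_mat b b" using that by auto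
    thus ?thesis
      using assoc_four_block_mat[of X Y Z] car(3) unfolding primary_form_Cons_carrier
      by (simp add: that Z_def c_def carrier_matD[OF companion_carrier])
  qed
  show ?thesis
    unfolding form[OF X_def Y_def a_def b_def] form[OF Y_def X_def b_def a_def] add.commute[of b a]
    using car by (intro similar_mat_four_block_0_0[OF similar_swap_blocks similar_mat_refl]) auto
qed

lemma similar_primary_form_move:
  "similar_mat (primary_form (us @ x # vs)) (primary_form (x # us @ vs))"
proof (induction us)
  case Nil
  show ?case using similar_mat_refl[OF primary_form_carrier] by simp
next
  case (Cons u us)
  have "similar_mat (primary_form (u # us @ x # vs)) (primary_form (u # x # us @ vs))"
    by (rule similar_primary_form_Cons[OF Cons])
  from similar_mat_trans[OF this similar_primary_form_swap] show ?case by simp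
qed

text \<open>Bridges the gap between \<open>elem_divs\<close>, which is a multiset, and a block
  matrix, which depends on the order of its blocks.\<close>

lemma similar_primary_form_mset:
  assumes "mset xs = mset ys"
  shows "similar_mat (primary_form xs) (primary_form ys)"
  using assms
proof (induction xs arbitrary: ys)
  case Nil
  thus ?case using similar_mat_refl[OF primary_form_carrier] by simp
next
  case (Cons x xs)
  hence "x \<in> set ys" by (metis list.set_intros(1) set_mset_mset)
  then obtain us vs where ys: "ys = us @ x # vs" by (meson split_list)
  have "mset xs = mset (us @ vs)" using Cons.prems ys by simp
  hence "similar_mat (primary_form (x # xs)) (primary_form (x # us @ vs))"
    by (intro similar_primary_form_Cons Cons.IH)
  thus ?case
    unfolding ys by (rule similar_mat_trans[OF _ similar_mat_sym[OF similar_primary_form_move]])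
qed

lemma primary_form_append:
  "primary_form (xs @ ys) = four_block_mat (primary_form xs)
    (0\<^sub>m (dim_row (primary_form xs)) (dim_col (primary_form ys)))
    (0\<^sub>m (dim_row (primary_form ys)) (dim_col (primary_form xs))) (primary_form ys)"
  unfolding primary_form_def map_append diag_block_mat_append Let_def ..

text \<open>The companion matrix of \<open>t - 1\<close> is the \<open>1 x 1\<close> identity, so
  adjoining an identity block means adjoining copies of the elementary divisor
  \<open>t - 1\<close>.\<close>

lemma primary_form_replicate_one:
  "primary_form (replicate c ([:-1, 1:], 1)) = (1\<^sub>m c :: 'a::field mat)"
proof (induction c)
  case 0
  show ?case by (auto simp: primary_form_def)
next
  case (Suc c)
  let ?l = "[:-1, 1:] :: 'a poly"
  have 1: "companion_mat (?l ^ 1) = 1\<^sub>m 1"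
    by (intro eq_matI) (auto simp: companion_mat_def Let_def)
  have "primary_form (replicate (Suc c) (?l, 1)) = four_block_mat (companion_mat (?l ^ 1))
      (0\<^sub>m (degree (?l ^ 1)) c) (0\<^sub>m c (degree (?l ^ 1))) (primary_form (replicate c (?l, 1)))"
    unfolding replicate_Suc by (rule primary_form_Cons) (simp only: Suc one_carrier_mat)
  also have "\<dots> = 1\<^sub>m (Suc c)"
    unfolding Suc 1 by simp
  finally show ?case .
qed

lemma count_decremented:
  "count (filter_mset (\<lambda>i. i \<noteq> 0) (image_mset (\<lambda>i. i - 1) M)) (Suc k) = count M (Suc (Suc k))"
  by (induction M) auto

text \<open>The modified type forgets only the multiplicity of \<open>t - 1\<close> itself: a part 1
  at \<open>t - 1\<close> becomes 0 and is dropped, while every part of size at least 2 survives the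
  decrement.\<close>

lemma elem_divs_eq_outside_trivial:
  fixes A B :: "'a::{field,finite} mat"
  assumes A: "A \<in> carrier_mat n n" and B: "B \<in> carrier_mat m m" and eq: "mod_type_of A = mod_type_of B"
  shows "filter_mset (\<lambda>x. x \<noteq> ([:-1, 1:], 1)) (elem_divs A) = filter_mset (\<lambda>x. x \<noteq> ([:-1, 1:], 1)) (elem_divs B)"
proof (rule multiset_eqI)
  fix x :: "'a poly \<times> nat"
  obtain p i where x: "x = (p, i)" by force
  have "count (elem_divs A) x = count (elem_divs B) x" if ne: "x \<noteq> ([:-1, 1:], 1)"
  proof -
    have cnt: "count (elem_divs A) x = count (type_of A p) i" "count (elem_divs B) x = count (type_of B p) i"
      by (simp_all add: x type_of_prime_parts count_prime_parts)
    show ?thesis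
    proof (cases "p = [:-1, 1:]")
      case False
      thus ?thesis using fun_cong[OF eq, of p] by (simp add: cnt mod_type_of_def)
    next
      case True
      consider "i = 0" | k where "i = Suc (Suc k)"
        using ne x True by (cases i; cases "i - 1") auto
      thus ?thesis
      proof cases
        case 1
        thus ?thesis using type_of_pos[OF A, of p] type_of_pos[OF B, of p] by (simp add: cnt not_in_iff)
      next
        case 2
        thus ?thesis
          using fun_cong[OF eq, of p] count_decremented[of "type_of A p" k] count_decremented[of "type_of B p" k] True
          by (simp add: cnt mod_type_of_def)
      qed
    qed
  qed
  thus "count (filter_mset (\<lambda>x. x \<noteq> ([:-1, 1:], 1)) (elem_divs A)) x =
      count (filter_mset (\<lambda>x. x \<noteq> ([:-1, 1:], 1)) (elem_divs B)) x"
    by simp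
qed

text \<open>The one forgotten multiplicity, that of \<open>t - 1\<close>, is recovered from the
  size, which is the total degree of the elementary divisors.\<close>

theorem similar_extend_by_identity:
  fixes g g0 :: "'a::{field,finite} mat"
  assumes g: "g \<in> carrier_mat m m" and g0: "g0 \<in> carrier_mat m0 m0"
    and eq: "mod_type_of g = mod_type_of g0" and le: "m0 \<le> m"
  shows "similar_mat g (four_block_mat g0 (0\<^sub>m m0 (m - m0)) (0\<^sub>m (m - m0) m0) (1\<^sub>m (m - m0)))"
proof -
  let ?x = "([:-1, 1:], 1) :: 'a poly \<times> nat"
  let ?w = "\<lambda>D :: ('a poly \<times> nat) multiset. \<Sum>x\<in>#D. degree (fst x ^ snd x)"
  obtain xs where xs: "similar_mat g (primary_form xs)" "elem_divs g = mset xs"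
    using elem_divs_primary_list[OF g] by metis
  obtain xs0 where xs0: "similar_mat g0 (primary_form xs0)" "elem_divs g0 = mset xs0"
    using elem_divs_primary_list[OF g0] by metis
  define E where "E = filter_mset (\<lambda>x. x \<noteq> ?x) (elem_divs g0)"
  define c c0 where "c = count (elem_divs g) ?x" and "c0 = count (elem_divs g0) ?x"
  have split: "D = filter_mset (\<lambda>x. x \<noteq> ?x) D + replicate_mset (count D ?x) ?x" for D
    by (rule multiset_eqI) auto
  have D: "elem_divs g = E + replicate_mset c ?x"
    using split[of "elem_divs g"] elem_divs_eq_outside_trivial[OF g g0 eq] by (simp add: E_def c_def)
  have D0: "elem_divs g0 = E + replicate_mset c0 ?x"
    using split[of "elem_divs g0"] by (simp add: E_def c0_def)
  have "m = ?w E + c" "m0 = ?w E + c0"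
    using dim_elem_divs[OF g] dim_elem_divs[OF g0] by (simp_all add: D D0)
  hence "c = c0 + (m - m0)" using le by simp
  hence "mset xs = mset (xs0 @ replicate (m - m0) ?x)"
    using D D0 xs(2) xs0(2) by (simp add: multiset_eq_iff)
  hence "similar_mat g (primary_form (xs0 @ replicate (m - m0) ?x))"
    using similar_mat_trans[OF xs(1) similar_primary_form_mset] by blast
  moreover have car0: "primary_form xs0 \<in> carrier_mat m0 m0"
    using similar_matD[OF xs0(1)] g0 by auto
  ultimately have "similar_mat g (four_block_mat (primary_form xs0) (0\<^sub>m m0 (m - m0)) (0\<^sub>m (m - m0) m0) (1\<^sub>m (m - m0)))"
    unfolding primary_form_append primary_form_replicate_one by simp
  thus ?thesis
    by (rule similar_mat_trans)
       (rule similar_mat_four_block_0_0[OF similar_mat_sym[OF xs0(1)] similar_mat_refl[OF one_carrier_mat] car0 one_carrier_mat])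
qed

lemma GL_D:
  assumes "g \<in> GL n"
  obtains h where "g \<in> carrier_mat n n" "h \<in> carrier_mat n n" "g * h = 1\<^sub>m n" "h * g = 1\<^sub>m n"
proof -
  from assms obtain h where g: "g \<in> carrier_mat n n" and h: "g * h = 1\<^sub>m n" "h * g = 1\<^sub>m (dim_row h)"
    by (auto simp: GL_def invertible_mat_def inverts_mat_def)
  have "dim_col h = n" using arg_cong[OF h(1), of dim_col] by simp
  moreover have "dim_row h = n" using arg_cong[OF h(2), of dim_col] g by simp
  ultimately have "h \<in> carrier_mat n n" by (intro carrier_matI)
  thus ?thesis using that g h by simp
qed

lemma GL_I:
  assumes "g \<in> carrier_mat n n" "h \<in> carrier_mat n n" "g * h = 1\<^sub>m n" "h * g = 1\<^sub>m n"
  shows "g \<in> GL n"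
  using assms by (auto simp: GL_def invertible_mat_def inverts_mat_def)

text \<open>Invertibility enters only in the exclusion of \<open>t\<close>: the kernel of
  \<open>g\<close> is zero, so \<open>t\<close> has no parts.\<close>

lemma is_mod_type_mod_type_of:
  fixes g :: "'a::{field,finite} mat"
  assumes "g \<in> GL n"
  shows "is_mod_type (mod_type_of g)"
proof -
  obtain h where g: "g \<in> carrier_mat n n" and h: "h \<in> carrier_mat n n" "h * g = 1\<^sub>m n"
    using GL_D[OF assms] by metis
  let ?t = "[:0, 1:] :: 'a poly"
  have irr: "irreducible ?t" by (rule irreducible_linear_field_poly) simp
  have "pmat g (?t ^ 1) = g"
  proof -
    have "0 \<cdot>\<^sub>m 1\<^sub>m n + g = g" using g by (intro eq_matI) auto
    thus ?thesis by (simp add: pmat_linear[OF g])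
  qed
  hence "{v \<in> carrier_vec n. pmat g (?t ^ 1) *\<^sub>v v = 0\<^sub>v n} = {0\<^sub>v n}"
    using left_inverse_imp_inj[OF g h] mult_mat_vec_zero[OF g] by auto
  hence "ker_card g (?t ^ 1) = 1" by (simp add: ker_card_altdef[OF g])
  hence "card (UNIV :: 'a set) ^ (\<Sum>i\<in>#type_of g ?t. min i 1) = 1"
    using ker_card_type_of[OF g _ irr, of 1] by simp
  hence "(\<Sum>i\<in>#type_of g ?t. min i 1) = 0"
    using two_le_card_field[where 'a = 'a] by (auto simp: power_eq_1_iff)
  hence min0: "\<forall>i\<in>#type_of g ?t. min i 1 = 0"
    by (simp add: sum_mset_0_iff)
  have t: "type_of g ?t = {#}"
  proof (rule ccontr)
    assume "type_of g ?t \<noteq> {#}"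
    then obtain i where i: "i \<in># type_of g ?t" by blast
    hence "i = 0" using min0 by (metis min_def zero_neq_one)
    thus False using i type_of_pos[OF g] by blast
  qed
  have sub: "type_of g r \<noteq> {#}" if "mod_type_of g r \<noteq> {#}" for r
    using that by (auto simp: mod_type_of_def split: if_splits)
  show ?thesis
    unfolding is_mod_type_def
  proof (intro conjI allI impI)
    fix r assume "mod_type_of g r \<noteq> {#}"
    from sub[OF this] show "r \<in> Phi"
      using type_of_nonempty[OF g] t by (auto simp: Phi_def)
  next
    fix r show "0 \<notin># mod_type_of g r"
      using type_of_pos[OF g, of r] by (auto simp: mod_type_of_def)
  next
    show "finite {r. mod_type_of g r \<noteq> {#}}"
      by (rule finite_subset[OF _ finite_type_of_support[of g]]) (use sub in blast)
  qed
qed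

section \<open>Counting matrices with given kernel and image\<close>

text \<open>The index set is arbitrary: a count may be indexed by \<open>n\<close> together with a matrix of that size, while
  its value is a polynomial in \<open>q ^ n\<close> alone.\<close>

definition poly_expr :: "'i set \<Rightarrow> ('i \<Rightarrow> rat) \<Rightarrow> ('i \<Rightarrow> rat) \<Rightarrow> bool" where
  "poly_expr I h f \<longleftrightarrow> (\<exists>p. \<forall>i\<in>I. f i = poly p (h i))"

lemma poly_expr_const: "poly_expr I h (\<lambda>_. c)"
  unfolding poly_expr_def by (intro exI[of _ "[:c:]"]) simp

lemma poly_expr_power: "poly_expr I h (\<lambda>i. h i ^ j)"
  unfolding poly_expr_def by (intro exI[of _ "monom 1 j"]) (simp add: poly_monom)

lemma poly_expr_mult:
  assumes "poly_expr I h f" "poly_expr I h g"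
  shows "poly_expr I h (\<lambda>i. f i * g i)"
proof -
  from assms obtain p r where "\<forall>i\<in>I. f i = poly p (h i)" "\<forall>i\<in>I. g i = poly r (h i)"
    unfolding poly_expr_def by blast
  thus ?thesis unfolding poly_expr_def by (intro exI[of _ "p * r"]) simp
qed

lemma poly_expr_add:
  assumes "poly_expr I h f" "poly_expr I h g"
  shows "poly_expr I h (\<lambda>i. f i + g i)"
proof -
  from assms obtain p r where "\<forall>i\<in>I. f i = poly p (h i)" "\<forall>i\<in>I. g i = poly r (h i)"
    unfolding poly_expr_def by blast
  thus ?thesis unfolding poly_expr_def by (intro exI[of _ "p + r"]) simp
qed

lemma poly_expr_diff:
  assumes "poly_expr I h f" "poly_expr I h g"
  shows "poly_expr I h (\<lambda>i. f i - g i)"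
proof -
  from assms obtain p r where "\<forall>i\<in>I. f i = poly p (h i)" "\<forall>i\<in>I. g i = poly r (h i)"
    unfolding poly_expr_def by blast
  thus ?thesis unfolding poly_expr_def by (intro exI[of _ "p - r"]) simp
qed

lemma poly_expr_sum:
  assumes "\<And>j. j \<in> J \<Longrightarrow> poly_expr I h (f j)"
  shows "poly_expr I h (\<lambda>i. \<Sum>j\<in>J. f j i)"
  using assms
proof (induction J rule: infinite_finite_induct)
  case (insert x F)
  thus ?case using poly_expr_add[of I h "f x"] by simp
qed (use poly_expr_const[of I h 0] in simp_all)

lemma poly_expr_cong:
  assumes "\<And>i. i \<in> I \<Longrightarrow> f i = g i"
  shows "poly_expr I h f \<longleftrightarrow> poly_expr I h g"
  using assms unfolding poly_expr_def by simp

lemma card_sum_fibres: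
  assumes "finite A" "finite V" "f ` A \<subseteq> V"
  shows "card A = (\<Sum>v\<in>V. card {x \<in> A. f x = v})"
  using sum.group[OF assms, of "\<lambda>_. 1::nat"] by simp

text \<open>Moebius inversion by descending induction, so that the Moebius function itself is never needed.\<close>

lemma poly_expr_fibre_if_upper:
  fixes \<kappa> :: "'i \<Rightarrow> 'a \<Rightarrow> 'u set"
  assumes U: "finite U" "F \<subseteq> Pow U" and fin: "\<And>i. i \<in> I \<Longrightarrow> finite (A i)"
    and \<kappa>: "\<And>i x. i \<in> I \<Longrightarrow> x \<in> A i \<Longrightarrow> \<kappa> i x \<in> F"
    and up: "\<And>K. K \<in> F \<Longrightarrow> poly_expr I h (\<lambda>i. of_nat (card {x \<in> A i. K \<subseteq> \<kappa> i x}))"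
  shows "poly_expr I h (\<lambda>i. of_nat (card {x \<in> A i. \<kappa> i x = K}))"
proof (induction "card (U - K)" arbitrary: K rule: less_induct)
  case less
  show ?case
  proof (cases "K \<in> F")
    case False
    have "poly_expr I h (\<lambda>i. of_nat (card {x \<in> A i. \<kappa> i x = K})) \<longleftrightarrow> poly_expr I h (\<lambda>_. 0)"
      using \<kappa> False by (intro poly_expr_cong) (auto intro!: card_eq_0_iff[THEN iffD2])
    thus ?thesis using poly_expr_const by blast
  next
    case True
    \<comment> \<open>The objects whose value contains \<open>K\<close> are sorted by their exact
      value; the proper supersets of \<open>K\<close> are covered by the induction
      hypothesis.\<close>
    define V where "V = {K' \<in> F. K \<subset> K'}"
    have finF: "finite F" using finite_subset[OF U(2)] U(1) by simp
    hence finV: "finite V" by (simp add: V_def)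
    have "of_nat (card {x \<in> A i. \<kappa> i x = K}) = (of_nat (card {x \<in> A i. K \<subseteq> \<kappa> i x}) -
        (\<Sum>K'\<in>V. of_nat (card {x \<in> A i. \<kappa> i x = K'})) :: rat)" if i: "i \<in> I" for i
    proof -
      have "card {x \<in> A i. K \<subseteq> \<kappa> i x} =
          (\<Sum>K'\<in>insert K V. card {x \<in> {x \<in> A i. K \<subseteq> \<kappa> i x}. \<kappa> i x = K'})"
        using fin[OF i] finV \<kappa>[OF i] by (intro card_sum_fibres) (auto simp: V_def)
      also have "\<dots> = (\<Sum>K'\<in>insert K V. card {x \<in> A i. \<kappa> i x = K'})"
        by (intro sum.cong arg_cong[where f = card]) (auto simp: V_def)
      also have "\<dots> = card {x \<in> A i. \<kappa> i x = K} + (\<Sum>K'\<in>V. card {x \<in> A i. \<kappa> i x = K'})"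
        using finV by (intro sum.insert) (auto simp: V_def)
      finally show ?thesis by simp
    qed
    hence "poly_expr I h (\<lambda>i. of_nat (card {x \<in> A i. \<kappa> i x = K})) \<longleftrightarrow>
        poly_expr I h (\<lambda>i. of_nat (card {x \<in> A i. K \<subseteq> \<kappa> i x}) -
          (\<Sum>K'\<in>V. of_nat (card {x \<in> A i. \<kappa> i x = K'})))"
      by (rule poly_expr_cong)
    moreover have "poly_expr I h (\<lambda>i. of_nat (card {x \<in> A i. \<kappa> i x = K'}))" if "K' \<in> V" for K'
    proof (rule less)
      have "K \<subset> K'" "K' \<subseteq> U" using that U(2) by (auto simp: V_def)
      thus "card (U - K') < card (U - K)" using U(1) by (intro psubset_card_mono) auto
    qed
    ultimately show ?thesis using up[OF True] by (simp add: poly_expr_diff poly_expr_sum)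
  qed
qed

text \<open>Complementation in \<open>U\<close> reverses inclusion and reduces this to
  \<open>poly_expr_fibre_if_upper\<close>. Both versions occur because linear conditions bound a
  kernel from below but an image from above.\<close>

lemma poly_expr_fibre_if_lower:
  fixes \<kappa> :: "'i \<Rightarrow> 'a \<Rightarrow> 'u set"
  assumes U: "finite U" "F \<subseteq> Pow U" and fin: "\<And>i. i \<in> I \<Longrightarrow> finite (A i)"
    and \<kappa>: "\<And>i x. i \<in> I \<Longrightarrow> x \<in> A i \<Longrightarrow> \<kappa> i x \<in> F"
    and low: "\<And>L. L \<in> F \<Longrightarrow> poly_expr I h (\<lambda>i. of_nat (card {x \<in> A i. \<kappa> i x \<subseteq> L}))"
  shows "poly_expr I h (\<lambda>i. of_nat (card {x \<in> A i. \<kappa> i x = L}))"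
proof (cases "L \<subseteq> U")
  case True
  have "poly_expr I h (\<lambda>i. of_nat (card {x \<in> A i. U - \<kappa> i x = U - L}))"
  proof (rule poly_expr_fibre_if_upper[where F = "(\<lambda>K. U - K) ` F"])
    show "finite U" by fact
    show "(\<lambda>K. U - K) ` F \<subseteq> Pow U" by auto
    show "finite (A i)" if "i \<in> I" for i using fin that .
    show "U - \<kappa> i x \<in> (\<lambda>K. U - K) ` F" if "i \<in> I" "x \<in> A i" for i x using \<kappa>[OF that] by blast
    fix K assume "K \<in> (\<lambda>K. U - K) ` F"
    then obtain L where L: "L \<in> F" "K = U - L" by blast
    have "{x \<in> A i. K \<subseteq> U - \<kappa> i x} = {x \<in> A i. \<kappa> i x \<subseteq> L}" if "i \<in> I" for i
      using \<kappa>[OF that] U(2) L by blast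
    hence "poly_expr I h (\<lambda>i. of_nat (card {x \<in> A i. K \<subseteq> U - \<kappa> i x})) \<longleftrightarrow>
        poly_expr I h (\<lambda>i. of_nat (card {x \<in> A i. \<kappa> i x \<subseteq> L}))"
      by (intro poly_expr_cong) simp
    thus "poly_expr I h (\<lambda>i. of_nat (card {x \<in> A i. K \<subseteq> U - \<kappa> i x}))" using low[OF L(1)] by simp
  qed
  moreover have "{x \<in> A i. U - \<kappa> i x = U - L} = {x \<in> A i. \<kappa> i x = L}" if "i \<in> I" for i
    using \<kappa>[OF that] U(2) True by blast
  ultimately show ?thesis
    using poly_expr_cong[of I "\<lambda>i. of_nat (card {x \<in> A i. U - \<kappa> i x = U - L})"
        "\<lambda>i. of_nat (card {x \<in> A i. \<kappa> i x = L})" h] by simp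
next
  case False
  have "poly_expr I h (\<lambda>i. of_nat (card {x \<in> A i. \<kappa> i x = L})) \<longleftrightarrow> poly_expr I h (\<lambda>_. 0)"
    using \<kappa> False U(2) by (intro poly_expr_cong) (auto intro!: card_eq_0_iff[THEN iffD2])
  thus ?thesis using poly_expr_const by blast
qed

section \<open>Subspaces, kernels and images as sets of vectors\<close>

definition vec_subspace :: "nat \<Rightarrow> 'a::field vec set \<Rightarrow> bool" where
  "vec_subspace e L \<longleftrightarrow> L \<subseteq> carrier_vec e \<and> 0\<^sub>v e \<in> L \<and> (\<forall>x\<in>L. \<forall>y\<in>L. x + y \<in> L) \<and> (\<forall>c. \<forall>x\<in>L. c \<cdot>\<^sub>v x \<in> L)"

lemma vec_subspace_diff:
  assumes "vec_subspace e L" "x \<in> L" "y \<in> L"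
  shows "x - y \<in> L"
proof -
  have "x - y = x + (-1) \<cdot>\<^sub>v y" using assms by (auto simp: vec_subspace_def vec_eq_iff subset_iff)
  thus ?thesis using assms by (simp add: vec_subspace_def)
qed

lemma card_vec_subspace_extend:
  fixes M :: "'a::{field,finite} vec set"
  assumes M: "vec_subspace e M" and u: "u \<in> carrier_vec e" "u \<notin> M"
  shows "vec_subspace e ((\<lambda>(x, c). x + c \<cdot>\<^sub>v u) ` (M \<times> UNIV))"
    and "card ((\<lambda>(x, c). x + c \<cdot>\<^sub>v u) ` (M \<times> UNIV)) = card M * card (UNIV :: 'a set)"
proof -
  let ?f = "\<lambda>(x, c). x + c \<cdot>\<^sub>v u"
  have car: "x \<in> carrier_vec e" if "x \<in> M" for x using M that by (auto simp: vec_subspace_def)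
  show "vec_subspace e (?f ` (M \<times> UNIV))"
    unfolding vec_subspace_def
  proof (intro conjI ballI allI)
    show "?f ` (M \<times> UNIV) \<subseteq> carrier_vec e" using car u by auto
    have "0\<^sub>v e = ?f (0\<^sub>v e, 0)" using u by (auto simp: vec_eq_iff)
    thus "0\<^sub>v e \<in> ?f ` (M \<times> UNIV)" using M unfolding vec_subspace_def by blast
  next
    fix x y assume "x \<in> ?f ` (M \<times> UNIV)" "y \<in> ?f ` (M \<times> UNIV)"
    then obtain m c m' c' where x: "x = m + c \<cdot>\<^sub>v u" "m \<in> M" and y: "y = m' + c' \<cdot>\<^sub>v u" "m' \<in> M" by auto
    have "x + y = ?f (m + m', c + c')"
      using u car[OF x(2)] car[OF y(2)] by (auto simp: x(1) y(1) vec_eq_iff algebra_simps)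
    moreover have "m + m' \<in> M" using M x y by (auto simp: vec_subspace_def)
    ultimately show "x + y \<in> ?f ` (M \<times> UNIV)" by blast
  next
    fix d x assume "x \<in> ?f ` (M \<times> UNIV)"
    then obtain m c where x: "x = m + c \<cdot>\<^sub>v u" "m \<in> M" by auto
    have "d \<cdot>\<^sub>v x = ?f (d \<cdot>\<^sub>v m, d * c)"
      using u car[OF x(2)] by (auto simp: x(1) vec_eq_iff algebra_simps)
    moreover have "d \<cdot>\<^sub>v m \<in> M" using M x by (auto simp: vec_subspace_def)
    ultimately show "d \<cdot>\<^sub>v x \<in> ?f ` (M \<times> UNIV)" by blast
  qed
  have "inj_on ?f (M \<times> UNIV)"
  proof (rule inj_onI)
    fix y z assume "y \<in> M \<times> (UNIV :: 'a set)" "z \<in> M \<times> (UNIV :: 'a set)" and eq: "?f y = ?f z"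
    then obtain m c m' c' where y: "y = (m, c)" "m \<in> M" and z: "z = (m', c')" "m' \<in> M" by auto
    note cm = car[OF y(2)] car[OF z(2)]
    have e: "m $ i + c * u $ i = m' $ i + c' * u $ i" if "i < e" for i
      using arg_cong[OF eq, of "\<lambda>x. x $ i"] cm u that by (simp add: y z)
    have "c = c'"
    proof (rule ccontr)
      assume "c \<noteq> c'"
      hence "u = inverse (c - c') \<cdot>\<^sub>v (m' - m)"
        using cm u e by (auto simp: vec_eq_iff field_simps)
      moreover have "inverse (c - c') \<cdot>\<^sub>v (m' - m) \<in> M"
        using M vec_subspace_diff[OF M z(2) y(2)] by (auto simp: vec_subspace_def)
      ultimately show False using u by simp
    qed
    moreover from this have "m = m'" using e cm by (auto simp: vec_eq_iff)
    ultimately show "y = z" by (simp add: y z)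
  qed
  thus "card (?f ` (M \<times> UNIV)) = card M * card (UNIV :: 'a set)"
    by (simp add: card_image card_cartesian_product)
qed

text \<open>Among the subspaces of \<open>L\<close> whose cardinality is a power of
  \<open>q\<close>, a largest one is all of \<open>L\<close>: adjoining a missing vector would
  multiply its cardinality by \<open>q\<close>. Bases are avoided in this way.\<close>

lemma card_vec_subspace:
  fixes L :: "'a::{field,finite} vec set"
  assumes L: "vec_subspace e L"
  shows "\<exists>j. card L = card (UNIV :: 'a set) ^ j"
proof -
  have fin: "finite L" using L finite_subset[OF _ finite_carrier_vec_finite] by (auto simp: vec_subspace_def)
  let ?P = "\<lambda>M. M \<subseteq> L \<and> vec_subspace e M \<and> (\<exists>j. card M = card (UNIV :: 'a set) ^ j)"
  have "?P {0\<^sub>v e}" using L by (auto simp: vec_subspace_def intro!: exI[of _ 0])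
  moreover have "card M < Suc (card L)" if "?P M" for M
    using card_mono[OF fin, of M] that by (simp add: less_Suc_eq_le)
  ultimately obtain M where M: "?P M" and max: "\<And>M'. ?P M' \<Longrightarrow> card M' \<le> card M"
    using ex_has_greatest_nat[of ?P "{0\<^sub>v e}" card "Suc (card L)"] by (auto simp: less_imp_le)
  have "M = L"
  proof (rule ccontr)
    assume "M \<noteq> L"
    then obtain u where u: "u \<in> L" "u \<notin> M" using M by blast
    have uc: "u \<in> carrier_vec e" using u L by (auto simp: vec_subspace_def)
    from M have MM: "vec_subspace e M" by blast
    let ?M' = "(\<lambda>(x, c). x + c \<cdot>\<^sub>v u) ` (M \<times> UNIV)"
    have "?M' \<subseteq> L" using u M L by (auto simp: vec_subspace_def)
    moreover have c: "card ?M' = card M * card (UNIV :: 'a set)"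
      by (rule card_vec_subspace_extend(2)[OF MM uc u(2)])
    moreover have "\<exists>j. card M * card (UNIV :: 'a set) = card (UNIV :: 'a set) ^ j"
      using M by (metis power_Suc2)
    ultimately have "?P ?M'" using card_vec_subspace_extend(1)[OF MM uc u(2)] by simp
    hence "card M * card (UNIV :: 'a set) \<le> card M" using max c by metis
    moreover have "card M > 0"
      using MM finite_subset[OF _ fin] M by (auto simp: card_gt_0_iff vec_subspace_def)
    ultimately show False using two_le_card_field[where 'a = 'a] by simp
  qed
  thus ?thesis using M by blast
qed

definition ker_mat :: "nat \<Rightarrow> 'a::field mat \<Rightarrow> 'a vec set" where
  "ker_mat e S = {v \<in> carrier_vec e. S *\<^sub>v v = 0\<^sub>v (dim_row S)}"

definition im_mat :: "nat \<Rightarrow> 'a::field mat \<Rightarrow> 'a vec set" where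
  "im_mat n T = (\<lambda>x. T *\<^sub>v x) ` carrier_vec n"

text \<open>The kernel contains \<open>K\<close> iff all rows of \<open>S\<close> are orthogonal to
  \<open>K\<close>. The rows then range over a subspace of \<open>q ^ j\<close> vectors, which gives
  \<open>(q ^ n) ^ j\<close> matrices; inversion over larger kernels does the rest.\<close>

lemma poly_expr_card_kernel:
  fixes K :: "'a::{field,finite} vec set"
  shows "poly_expr UNIV (\<lambda>n. of_nat (card (UNIV :: 'a set)) ^ n)
    (\<lambda>n. of_nat (card {S \<in> carrier_mat n e. ker_mat e S = K}))"
proof (rule poly_expr_fibre_if_upper[where U = "carrier_vec e" and F = "Pow (carrier_vec e)"])
  fix K :: "'a vec set" assume "K \<in> Pow (carrier_vec e)"
  hence K: "K \<subseteq> carrier_vec e" by simp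
  define N where "N = {s \<in> carrier_vec e. \<forall>v\<in>K. s \<bullet> v = 0}"
  have "vec_subspace e N"
    using K by (auto simp: vec_subspace_def N_def add_scalar_prod_distrib subset_iff)
  then obtain j where j: "card N = card (UNIV :: 'a set) ^ j" using card_vec_subspace by blast
  have N: "N \<subseteq> carrier_vec e" by (auto simp: N_def)
  have "card {S \<in> carrier_mat n e. K \<subseteq> ker_mat e S} = card N ^ n" for n
  proof -
    have "{S \<in> carrier_mat n e. K \<subseteq> ker_mat e S} = {S \<in> carrier_mat n e. \<forall>i<n. row S i \<in> N}"
      using K by (auto simp: ker_mat_def N_def vec_eq_iff subset_iff)
    thus ?thesis using card_mat_rows_in(2)[OF N finite_subset[OF N finite_carrier_vec_finite]] by simp
  qed
  hence "(\<lambda>n. of_nat (card {S \<in> carrier_mat n e. K \<subseteq> ker_mat e S})) =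
      (\<lambda>n. (of_nat (card (UNIV :: 'a set)) ^ n) ^ j :: rat)"
    by (simp add: j fun_eq_iff flip: power_mult) (simp add: mult.commute)
  thus "poly_expr UNIV (\<lambda>n. of_nat (card (UNIV :: 'a set)) ^ n)
      (\<lambda>n. of_nat (card {S \<in> carrier_mat n e. K \<subseteq> ker_mat e S}))"
    using poly_expr_power[of UNIV "\<lambda>n. of_nat (card (UNIV :: 'a set)) ^ n" j] by simp
qed (auto simp: ker_mat_def)

lemma vec_subspace_im_mat:
  assumes T: "T \<in> carrier_mat e n"
  shows "vec_subspace e (im_mat n T)"
  unfolding vec_subspace_def im_mat_def
proof (intro conjI ballI allI)
  show "(\<lambda>x. T *\<^sub>v x) ` carrier_vec n \<subseteq> carrier_vec e" using T by auto
  show "0\<^sub>v e \<in> (\<lambda>x. T *\<^sub>v x) ` carrier_vec n"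
    using mult_mat_vec_zero[OF T] by (intro image_eqI[where x = "0\<^sub>v n"]) auto
next
  fix x y assume "x \<in> (\<lambda>x. T *\<^sub>v x) ` carrier_vec n" "y \<in> (\<lambda>x. T *\<^sub>v x) ` carrier_vec n"
  then obtain u v where "x = T *\<^sub>v u" "y = T *\<^sub>v v" "u \<in> carrier_vec n" "v \<in> carrier_vec n" by auto
  thus "x + y \<in> (\<lambda>x. T *\<^sub>v x) ` carrier_vec n"
    using mult_add_distrib_mat_vec[OF T] by (intro image_eqI[where x = "u + v"]) auto
next
  fix c x assume "x \<in> (\<lambda>x. T *\<^sub>v x) ` carrier_vec n"
  then obtain u where "x = T *\<^sub>v u" "u \<in> carrier_vec n" by auto
  thus "c \<cdot>\<^sub>v x \<in> (\<lambda>x. T *\<^sub>v x) ` carrier_vec n"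
    using mult_mat_vec[OF T] by (intro image_eqI[where x = "c \<cdot>\<^sub>v u"]) auto
qed

lemma im_mat_subset_iff_cols:
  fixes L :: "'a::field vec set"
  assumes T: "T \<in> carrier_mat e n" and L: "vec_subspace e L"
  shows "im_mat n T \<subseteq> L \<longleftrightarrow> (\<forall>j<n. col T j \<in> L)"
proof
  assume s: "im_mat n T \<subseteq> L"
  show "\<forall>j<n. col T j \<in> L"
  proof (intro allI impI)
    fix j assume "j < n"
    hence "col T j = T *\<^sub>v unit_vec n j" using mult_mat_unit_vec[OF T] by simp
    thus "col T j \<in> L" using s by (auto simp: im_mat_def)
  qed
next
  assume c: "\<forall>j<n. col T j \<in> L"
  have partial: "vec e (\<lambda>i. \<Sum>j<k. T $$ (i, j) * x $ j) \<in> L" if "k \<le> n" for k x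
    using that
  proof (induction k)
    case 0
    have "vec e (\<lambda>i. \<Sum>j<0. T $$ (i, j) * x $ j) = 0\<^sub>v e" by (intro eq_vecI) auto
    thus ?case using L by (simp add: vec_subspace_def)
  next
    case (Suc k)
    have "vec e (\<lambda>i. \<Sum>j<Suc k. T $$ (i, j) * x $ j) = vec e (\<lambda>i. \<Sum>j<k. T $$ (i, j) * x $ j) + x $ k \<cdot>\<^sub>v col T k"
      using T Suc.prems by (intro eq_vecI) (auto simp: mult.commute)
    thus ?case using L Suc c by (simp add: vec_subspace_def)
  qed
  show "im_mat n T \<subseteq> L"
    unfolding im_mat_def
  proof (rule image_subsetI)
    fix x :: "'a vec" assume x: "x \<in> carrier_vec n"
    have "T *\<^sub>v x = vec e (\<lambda>i. \<Sum>j<n. T $$ (i, j) * x $ j)"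
      using T x by (intro eq_vecI) (auto simp: scalar_prod_def atLeast0LessThan)
    thus "T *\<^sub>v x \<in> L" using partial[OF order_refl] by simp
  qed
qed

lemma im_mat_minus:
  assumes T: "T \<in> carrier_mat e n" and T': "T' \<in> carrier_mat e n" and L: "vec_subspace e L"
    and "im_mat n T \<subseteq> L" "im_mat n T' \<subseteq> L"
  shows "im_mat n (T - T') \<subseteq> L"
  using assms minus_mult_distrib_mat_vec[OF T T'] vec_subspace_diff[OF L] by (auto simp: im_mat_def subset_iff)

lemma im_mat_add:
  assumes T: "T \<in> carrier_mat e n" and T': "T' \<in> carrier_mat e n" and L: "vec_subspace e L"
    and "im_mat n T \<subseteq> L" "im_mat n T' \<subseteq> L"
  shows "im_mat n (T + T') \<subseteq> L"
  using assms add_mult_distrib_mat_vec[OF T T'] by (auto simp: im_mat_def subset_iff vec_subspace_def)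

text \<open>All fibres of the additive map \<open>T \<mapsto> T S\<close> are translates of each other, and its image depends only
  on the kernel of \<open>S\<close>.\<close>

lemma card_left_multiples:
  fixes S :: "'a::{field,finite} mat"
  assumes S: "S \<in> carrier_mat n e" and L: "vec_subspace e L"
  defines "\<W> \<equiv> {W \<in> carrier_mat e e. im_mat e W \<subseteq> L \<and> (\<forall>v\<in>ker_mat e S. W *\<^sub>v v = 0\<^sub>v e)}"
  shows "W \<notin> \<W> \<Longrightarrow> {T \<in> carrier_mat e n. im_mat n T \<subseteq> L \<and> T * S = W} = {}"
    and "W \<in> \<W> \<Longrightarrow> card \<W> * card {T \<in> carrier_mat e n. im_mat n T \<subseteq> L \<and> T * S = W} = card L ^ n"
proof -
  define \<T> where "\<T> = {T \<in> carrier_mat e n. im_mat n T \<subseteq> L}"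
  have TS: "T * S \<in> \<W>" if T: "T \<in> \<T>" for T
  proof -
    have Tc: "T \<in> carrier_mat e n" and im: "im_mat n T \<subseteq> L" using T by (auto simp: \<T>_def)
    have "(T * S) *\<^sub>v v = T *\<^sub>v (S *\<^sub>v v)" if "v \<in> carrier_vec e" for v
      by (rule assoc_mult_mat_vec[OF Tc S that])
    thus ?thesis
      using im Tc S mult_mat_vec_zero[OF Tc] by (auto simp: \<W>_def im_mat_def ker_mat_def)
  qed
  show "{T \<in> carrier_mat e n. im_mat n T \<subseteq> L \<and> T * S = W} = {}" if "W \<notin> \<W>"
    using TS that by (auto simp: \<T>_def)
  obtain S' where S': "S' \<in> carrier_mat e n" and SS: "S * S' * S = S"
    using generalized_inverse[OF S] by blast
  \<comment> \<open>\<open>S' S x - x\<close> lies in the kernel of \<open>S\<close>, where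
    \<open>W\<close> vanishes; hence \<open>W S' S = W\<close>. Moreover the image of
    \<open>W S'\<close> lies in that of \<open>W\<close>.\<close>
  have onto: "\<exists>T\<in>\<T>. T * S = W" if W: "W \<in> \<W>" for W
  proof (intro bexI)
    have Wc: "W \<in> carrier_mat e e" using W by (auto simp: \<W>_def)
    show "W * S' * S = W"
    proof (rule mat_col_eqI)
      fix j assume "j < dim_col W"
      hence j: "j < e" using Wc by simp
      let ?u = "unit_vec e j :: 'a vec"
      have u: "?u \<in> carrier_vec e" by simp
      have Su: "S *\<^sub>v ?u \<in> carrier_vec n" by (rule mult_mat_vec_carrier[OF S u])
      have x: "S' *\<^sub>v (S *\<^sub>v ?u) \<in> carrier_vec e" by (rule mult_mat_vec_carrier[OF S' Su])
      have "S *\<^sub>v (S' *\<^sub>v (S *\<^sub>v ?u)) = (S * S' * S) *\<^sub>v ?u"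
        using assoc_mult_mat_vec[OF mult_carrier_mat[OF S S'] S u] assoc_mult_mat_vec[OF S S' Su] by simp
      hence "S *\<^sub>v (S' *\<^sub>v (S *\<^sub>v ?u) - ?u) = S *\<^sub>v ?u - S *\<^sub>v ?u"
        using mult_minus_distrib_mat_vec[OF S x u] SS by simp
      hence "S' *\<^sub>v (S *\<^sub>v ?u) - ?u \<in> ker_mat e S"
        using minus_cancel_vec[OF Su] x S by (auto simp: ker_mat_def)
      hence "W *\<^sub>v (S' *\<^sub>v (S *\<^sub>v ?u) - ?u) = 0\<^sub>v e" using W by (auto simp: \<W>_def)
      hence z: "W *\<^sub>v (S' *\<^sub>v (S *\<^sub>v ?u)) - W *\<^sub>v ?u = 0\<^sub>v e"
        using mult_minus_distrib_mat_vec[OF Wc x u] by simp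
      have eq0: "y = z" if "y - z = 0\<^sub>v e" "y \<in> carrier_vec e" "z \<in> carrier_vec e" for y z :: "'a vec"
        using that by (auto simp: vec_eq_iff)
      have "W *\<^sub>v (S' *\<^sub>v (S *\<^sub>v ?u)) = W *\<^sub>v ?u"
        by (rule eq0[OF z mult_mat_vec_carrier[OF Wc x] mult_mat_vec_carrier[OF Wc u]])
      moreover have "(W * S' * S) *\<^sub>v ?u = W *\<^sub>v (S' *\<^sub>v (S *\<^sub>v ?u))"
        using assoc_mult_mat_vec[OF mult_carrier_mat[OF Wc S'] S u] assoc_mult_mat_vec[OF Wc S' Su] by simp
      ultimately have "(W * S' * S) *\<^sub>v ?u = W *\<^sub>v ?u" by simp
      thus "col (W * S' * S) j = col W j"
        using mult_mat_unit_vec[OF Wc j]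
          mult_mat_unit_vec[OF mult_carrier_mat[OF mult_carrier_mat[OF Wc S'] S] j] by simp
    qed (use Wc S in auto)
    have "(W * S') *\<^sub>v x = W *\<^sub>v (S' *\<^sub>v x)" if "x \<in> carrier_vec n" for x
      by (rule assoc_mult_mat_vec[OF Wc S' that])
    thus "W * S' \<in> \<T>"
      using W Wc S' mult_mat_vec_carrier[OF S'] by (auto simp: \<T>_def \<W>_def im_mat_def)
  qed
  have fT: "finite \<T>" unfolding \<T>_def by (rule finite_subset[OF _ finite_carrier_mat]) auto
  have fW: "finite \<W>" unfolding \<W>_def by (rule finite_subset[OF _ finite_carrier_mat]) auto
  have transl: "card {T \<in> \<T>. T * S = W} = card {T \<in> \<T>. T * S = 0\<^sub>m e e}" if W: "W \<in> \<W>" for W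
  proof -
    obtain T0 where T0: "T0 \<in> \<T>" "T0 * S = W" using onto[OF W] by blast
    have T0c: "T0 \<in> carrier_mat e n" and Wc: "W \<in> carrier_mat e e"
      using T0 W by (auto simp: \<T>_def \<W>_def)
    have "bij_betw (\<lambda>T. T - T0) {T \<in> \<T>. T * S = W} {T \<in> \<T>. T * S = 0\<^sub>m e e}"
    proof (rule bij_betwI[where g = "\<lambda>T. T + T0"])
      show "(\<lambda>T. T - T0) \<in> {T \<in> \<T>. T * S = W} \<rightarrow> {T \<in> \<T>. T * S = 0\<^sub>m e e}"
      proof
        fix T assume T: "T \<in> {T \<in> \<T>. T * S = W}"
        hence Tc: "T \<in> carrier_mat e n" by (auto simp: \<T>_def)
        have "(T - T0) * S = W - W" using minus_mult_distrib_mat[OF Tc T0c S] T T0 by simp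
        also have "\<dots> = 0\<^sub>m e e" using Wc by (intro eq_matI) auto
        finally show "T - T0 \<in> {T \<in> \<T>. T * S = 0\<^sub>m e e}"
          using T T0 Tc T0c im_mat_minus[OF Tc T0c L] by (auto simp: \<T>_def minus_carrier_mat)
      qed
      show "(\<lambda>T. T + T0) \<in> {T \<in> \<T>. T * S = 0\<^sub>m e e} \<rightarrow> {T \<in> \<T>. T * S = W}"
      proof
        fix T assume T: "T \<in> {T \<in> \<T>. T * S = 0\<^sub>m e e}"
        hence Tc: "T \<in> carrier_mat e n" by (auto simp: \<T>_def)
        have "(T + T0) * S = W" using add_mult_distrib_mat[OF Tc T0c S] T T0 Wc by simp
        thus "T + T0 \<in> {T \<in> \<T>. T * S = W}"
          using T T0 Tc T0c im_mat_add[OF Tc T0c L] by (auto simp: \<T>_def)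
      qed
      have c: "T - T0 + T0 = T" "T + T0 - T0 = T" if "T \<in> carrier_mat e n" for T
        using that T0c by (auto simp: mat_eq_iff)
      show "T - T0 + T0 = T" if "T \<in> {T \<in> \<T>. T * S = W}" for T using that c by (auto simp: \<T>_def)
      show "T + T0 - T0 = T" if "T \<in> {T \<in> \<T>. T * S = 0\<^sub>m e e}" for T using that c by (auto simp: \<T>_def)
    qed
    thus ?thesis by (rule bij_betw_same_card)
  qed
  have "card \<T> = card L ^ n"
  proof -
    have "\<T> = {T \<in> carrier_mat e n. \<forall>j<n. col T j \<in> L}"
      using im_mat_subset_iff_cols[OF _ L] by (auto simp: \<T>_def)
    moreover have Lc: "L \<subseteq> carrier_vec e" using L by (auto simp: vec_subspace_def)
    ultimately show ?thesis
      using card_mat_cols_in[OF Lc finite_subset[OF Lc finite_carrier_vec_finite], of n] by simp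
  qed
  moreover have "card \<T> = card \<W> * card {T \<in> \<T>. T * S = 0\<^sub>m e e}"
    using card_sum_fibres[OF fT fW, of "\<lambda>T. T * S"] TS transl by auto
  ultimately show "card \<W> * card {T \<in> carrier_mat e n. im_mat n T \<subseteq> L \<and> T * S = W} = card L ^ n"
    if "W \<in> \<W>" using transl[OF that] by (simp add: \<T>_def conj_assoc)
qed

text \<open>Indexing by \<open>(n, S)\<close> expresses that one polynomial serves all
  \<open>S\<close> with the same kernel: by \<open>card_left_multiples\<close> the number of
  \<open>T\<close> with image inside a subspace involves \<open>S\<close> only through its
  kernel.\<close>

lemma poly_expr_card_image:
  fixes K L :: "'a::{field,finite} vec set"
  shows "poly_expr {(n, S). S \<in> carrier_mat n e \<and> ker_mat e S = K} (\<lambda>(n, S). of_nat (card (UNIV :: 'a set)) ^ n)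
    (\<lambda>(n, S). of_nat (card {T \<in> carrier_mat e n. im_mat n T = L \<and> T * S = W}))"
proof -
  let ?I = "{(n, S). S \<in> carrier_mat n e \<and> ker_mat e S = K}"
  let ?h = "\<lambda>(n, S :: 'a mat). of_nat (card (UNIV :: 'a set)) ^ n :: rat"
  let ?A = "\<lambda>(n, S). {T \<in> carrier_mat e n. T * S = W}"
  have "poly_expr ?I ?h (\<lambda>i. of_nat (card {T \<in> ?A i. im_mat (fst i) T = L}))"
  proof (rule poly_expr_fibre_if_lower[where U = "carrier_vec e" and F = "{L. vec_subspace e L}"])
    show "{L. vec_subspace e L} \<subseteq> Pow (carrier_vec e :: 'a vec set)" by (auto simp: vec_subspace_def)
    show "finite (?A i)" if "i \<in> ?I" for i
      using finite_subset[OF _ finite_carrier_mat] by (auto split: prod.split)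
    show "im_mat (fst i) T \<in> {L. vec_subspace e L}" if "i \<in> ?I" "T \<in> ?A i" for i T
      using that vec_subspace_im_mat by (auto split: prod.splits)
    fix L :: "'a vec set" assume "L \<in> {L. vec_subspace e L}"
    hence L: "vec_subspace e L" by simp
    obtain j where j: "card L = card (UNIV :: 'a set) ^ j" using card_vec_subspace[OF L] by blast
    define V where "V = {W \<in> carrier_mat e e. im_mat e W \<subseteq> L \<and> (\<forall>v\<in>K. W *\<^sub>v v = 0\<^sub>v e)}"
    have fV: "finite V" unfolding V_def by (rule finite_subset[OF _ finite_carrier_mat]) auto
    \<comment> \<open>\<open>V\<close> consists of the attainable products \<open>T S\<close>, all
      equally frequent; dividing by its cardinality can make coefficients non-integral.\<close>
    define c :: rat where "c = (if W \<in> V then 1 / of_nat (card V) else 0)"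
    have fibre_eq: "of_nat (card {T \<in> ?A i. im_mat (fst i) T \<subseteq> L}) = c * ?h i ^ j" if "i \<in> ?I" for i
    proof -
      obtain n S where i: "i = (n, S)" by force
      have S: "S \<in> carrier_mat n e" "ker_mat e S = K" using that by (auto simp: i)
      have set: "{T \<in> ?A i. im_mat (fst i) T \<subseteq> L} = {T \<in> carrier_mat e n. im_mat n T \<subseteq> L \<and> T * S = W}"
        by (auto simp: i)
      show ?thesis
      proof (cases "W \<in> V")
        case True
        hence "card V > 0" using fV by (auto simp: card_gt_0_iff)
        moreover have "card V * card {T \<in> carrier_mat e n. im_mat n T \<subseteq> L \<and> T * S = W} = card L ^ n"
          using card_left_multiples(2)[OF S(1) L] True by (simp add: S(2) V_def)
        hence "of_nat (card V * card {T \<in> carrier_mat e n. im_mat n T \<subseteq> L \<and> T * S = W}) =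
            (of_nat (card L ^ n) :: rat)"
          by (simp only:)
        hence "of_nat (card V) * of_nat (card {T \<in> carrier_mat e n. im_mat n T \<subseteq> L \<and> T * S = W}) =
            (of_nat (card L) ^ n :: rat)"
          by (simp only: of_nat_mult of_nat_power)
        ultimately show ?thesis
          unfolding set using True
          by (simp add: c_def i j field_simps flip: power_mult)
      next
        case False
        hence "{T \<in> carrier_mat e n. im_mat n T \<subseteq> L \<and> T * S = W} = {}"
          using card_left_multiples(1)[OF S(1) L] by (simp add: S(2) V_def)
        thus ?thesis unfolding set using False by (simp add: c_def)
      qed
    qed
    have "poly_expr ?I ?h (\<lambda>i. c * ?h i ^ j)"
      by (intro poly_expr_mult poly_expr_const poly_expr_power)
    thus "poly_expr ?I ?h (\<lambda>i. of_nat (card {T \<in> ?A i. im_mat (fst i) T \<subseteq> L}))"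
      by (subst poly_expr_cong[OF fibre_eq])
  qed simp
  moreover have "of_nat (card {T \<in> ?A i. im_mat (fst i) T = L}) =
      (\<lambda>(n, S). of_nat (card {T \<in> carrier_mat e n. im_mat n T = L \<and> T * S = W}) :: rat) i" for i
  proof -
    obtain n S where i: "i = (n, S)" by force
    have "{T \<in> ?A i. im_mat (fst i) T = L} = {T \<in> carrier_mat e n. im_mat n T = L \<and> T * S = W}"
      unfolding i by auto
    thus ?thesis unfolding i by simp
  qed
  ultimately show ?thesis by (simp only:)
qed

text \<open>The quadruples \<open>(x, K, L, W)\<close> lie in a finite set independent of
  \<open>n\<close>, so an arbitrary condition \<open>Q\<close> just selects some of them. For each,
  the count is the number of \<open>S\<close> with kernel \<open>K\<close> times a number of
  \<open>T\<close> that is the same for all these \<open>S\<close>.\<close>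

theorem poly_expr_card_pairs:
  fixes Q :: "'x \<Rightarrow> 'a::{field,finite} vec set \<Rightarrow> 'a vec set \<Rightarrow> 'a mat \<Rightarrow> bool"
  assumes X: "finite X"
  shows "poly_expr UNIV (\<lambda>n. of_nat (card (UNIV :: 'a set)) ^ n) (\<lambda>n. of_nat (card
    {(x, S, T). x \<in> X \<and> S \<in> carrier_mat n e \<and> T \<in> carrier_mat e n \<and> Q x (ker_mat e S) (im_mat n T) (T * S)}))"
proof -
  let ?h = "\<lambda>n :: nat. of_nat (card (UNIV :: 'a set)) ^ n :: rat"
  define V where "V = {(x, K, L, W). x \<in> X \<and> K \<subseteq> (carrier_vec e :: 'a vec set) \<and>
    L \<subseteq> (carrier_vec e :: 'a vec set) \<and> W \<in> (carrier_mat e e :: 'a mat set) \<and> Q x K L W}"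
  have fV: "finite V"
    by (rule finite_subset[of _ "X \<times> Pow (carrier_vec e) \<times> Pow (carrier_vec e) \<times> carrier_mat e e"])
       (use X in \<open>auto simp: V_def\<close>)
  define D where "D = (\<lambda>n. {(x, S, T). x \<in> X \<and> S \<in> carrier_mat n e \<and> T \<in> carrier_mat e n \<and>
    Q x (ker_mat e S) (im_mat n T) (T * S)})"
  have fD: "finite (D n)" for n
    by (rule finite_subset[of _ "X \<times> carrier_mat n e \<times> carrier_mat e n"])
       (use X in \<open>auto simp: D_def\<close>)
  define C where "C = (\<lambda>K L W n. {(S, T). S \<in> carrier_mat n e \<and> T \<in> carrier_mat e n \<and>
    ker_mat e S = K \<and> im_mat n T = L \<and> T * S = (W :: 'a mat)})"
  have cardD: "card (D n) = (\<Sum>(x, K, L, W)\<in>V. card (C K L W n))" for n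
  proof -
    let ?f = "\<lambda>(x :: 'x, S :: 'a mat, T :: 'a mat). (x, ker_mat e S, im_mat n T, T * S)"
    have "?f ` D n \<subseteq> V"
    proof (rule image_subsetI)
      fix d assume "d \<in> D n"
      then obtain x S T where d: "d = (x, S, T)" "x \<in> X" "S \<in> carrier_mat n e" "T \<in> carrier_mat e n"
        "Q x (ker_mat e S) (im_mat n T) (T * S)" by (auto simp: D_def)
      show "?f d \<in> V" using d vec_subspace_im_mat[OF d(4)] by (auto simp: V_def ker_mat_def vec_subspace_def)
    qed
    from card_sum_fibres[OF fD fV this]
    have "card (D n) = (\<Sum>v\<in>V. card {d \<in> D n. ?f d = v})" .
    also have "\<dots> = (\<Sum>(x, K, L, W)\<in>V. card (C K L W n))"
    proof (rule sum.cong, rule refl)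
      fix v assume v: "v \<in> V"
      then obtain x K L W where vv: "v = (x, K, L, W)" "x \<in> X" "Q x K L W" by (auto simp: V_def)
      have "{d \<in> D n. ?f d = v} = Pair x ` C K L W n"
        using vv by (auto simp: D_def C_def)
      thus "card {d \<in> D n. ?f d = v} = (case v of (x, K, L, W) \<Rightarrow> card (C K L W n))"
        by (simp add: vv card_image inj_on_def)
    qed
    finally show ?thesis .
  qed
  have C: "poly_expr UNIV ?h (\<lambda>n. of_nat (card (C K L W n)))" for K L W
  proof -
    obtain p where p: "\<And>n S. S \<in> carrier_mat n e \<Longrightarrow> ker_mat e S = K \<Longrightarrow>
        of_nat (card {T \<in> carrier_mat e n. im_mat n T = L \<and> T * S = W}) = poly p (?h n)"
      using poly_expr_card_image[of e K L W] unfolding poly_expr_def by auto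
    have "of_nat (card (C K L W n)) = of_nat (card {S \<in> carrier_mat n e. ker_mat e S = K}) * poly p (?h n)" for n
    proof -
      let ?B = "{S \<in> carrier_mat n e. ker_mat e S = K}"
      have fB: "finite ?B" by (rule finite_subset[OF _ finite_carrier_mat]) auto
      have "C K L W n = Sigma ?B (\<lambda>S. {T \<in> carrier_mat e n. im_mat n T = L \<and> T * S = W})"
        by (auto simp: C_def)
      moreover have "finite {T \<in> carrier_mat e n. im_mat n T = L \<and> T * S = W}" for S
        by (rule finite_subset[OF _ finite_carrier_mat]) auto
      ultimately have "card (C K L W n) = (\<Sum>S\<in>?B. card {T \<in> carrier_mat e n. im_mat n T = L \<and> T * S = W})"
        using fB by simp
      hence "of_nat (card (C K L W n)) = (\<Sum>S\<in>?B. of_nat (card {T \<in> carrier_mat e n. im_mat n T = L \<and> T * S = W}) :: rat)"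
        by simp
      also have "\<dots> = (\<Sum>S\<in>?B. poly p (?h n))"
        by (intro sum.cong refl p) auto
      finally show ?thesis by simp
    qed
    moreover have "poly_expr UNIV ?h (\<lambda>n. poly p (?h n))" unfolding poly_expr_def by blast
    ultimately show ?thesis using poly_expr_mult[OF poly_expr_card_kernel[of e K]] by simp
  qed
  have "poly_expr UNIV ?h (\<lambda>n. \<Sum>v\<in>V. (case v of (x, K, L, W) \<Rightarrow> of_nat (card (C K L W n))))"
    by (rule poly_expr_sum) (auto intro!: C split: prod.split)
  hence "poly_expr UNIV ?h (\<lambda>n. of_nat (card (D n)))"
    by (simp add: cardD case_prod_beta)
  thus ?thesis by (simp add: D_def)
qed

section \<open>Counting factorisations\<close>

text \<open>In this form with vectors, the conditions can be read off from the kernel of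
  \<open>[B D]\<close> and the image of \<open>C\<close> on top of \<open>E\<close>.\<close>

lemma full_rank_pair_iff:
  fixes B :: "'a::field mat"
  assumes B: "B \<in> carrier_mat m a" and C: "C \<in> carrier_mat a m"
  shows "full_rank_pair m a B C \<longleftrightarrow> (\<forall>x\<in>carrier_vec a. B *\<^sub>v x = 0\<^sub>v m \<longrightarrow> x = 0\<^sub>v a) \<and>
    (\<forall>y\<in>carrier_vec a. \<exists>u\<in>carrier_vec m. C *\<^sub>v u = y)"
proof
  assume "full_rank_pair m a B C"
  then obtain B' C' where B': "B' \<in> carrier_mat a m" "B' * B = 1\<^sub>m a"
    and C': "C' \<in> carrier_mat m a" "C * C' = 1\<^sub>m a" by (auto simp: full_rank_pair_def)
  have "\<exists>u\<in>carrier_vec m. C *\<^sub>v u = y" if y: "y \<in> carrier_vec a" for y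
    using assoc_mult_mat_vec[OF C C'(1) y] C' y by (intro bexI[of _ "C' *\<^sub>v y"]) auto
  thus "(\<forall>x\<in>carrier_vec a. B *\<^sub>v x = 0\<^sub>v m \<longrightarrow> x = 0\<^sub>v a) \<and>
    (\<forall>y\<in>carrier_vec a. \<exists>u\<in>carrier_vec m. C *\<^sub>v u = y)"
    using left_inverse_imp_inj[OF B B'] by blast
next
  assume r: "(\<forall>x\<in>carrier_vec a. B *\<^sub>v x = 0\<^sub>v m \<longrightarrow> x = 0\<^sub>v a) \<and>
    (\<forall>y\<in>carrier_vec a. \<exists>u\<in>carrier_vec m. C *\<^sub>v u = y)"
  have "\<exists>B' \<in> carrier_mat a m. B' * B = 1\<^sub>m a"
    using r by (intro left_inverse_if_kernel_trivial[OF B]) blast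
  moreover have "\<exists>C' \<in> carrier_mat m a. C * C' = 1\<^sub>m a"
  proof -
    have "\<forall>j. \<exists>u. u \<in> carrier_vec m \<and> C *\<^sub>v u = unit_vec a j"
      using r unit_vec_carrier by blast
    then obtain f where f: "\<And>j. f j \<in> carrier_vec m" "\<And>j. C *\<^sub>v f j = unit_vec a j" by metis
    define C' where "C' = mat m a (\<lambda>(i, j). f j $ i)"
    have C': "C' \<in> carrier_mat m a" by (simp add: C'_def)
    have "C * C' = 1\<^sub>m a"
    proof (rule mat_col_eqI)
      fix j assume "j < dim_col (1\<^sub>m a :: 'a mat)"
      hence j: "j < a" by simp
      have "col C' j = f j" using f(1)[of j] j by (intro eq_vecI) (auto simp: C'_def)
      thus "col (C * C') j = col (1\<^sub>m a) j" using col_mult2[OF C C' j] f(2)[of j] j by simp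
    qed (use C C' in auto)
    thus ?thesis using C' by blast
  qed
  ultimately show "full_rank_pair m a B C" using B C by (simp add: full_rank_pair_def)
qed

text \<open>A copy of \<open>GL a\<close>, each element listed together with its inverse.\<close>

definition inverse_pairs :: "nat \<Rightarrow> ('a::field mat \<times> 'a mat) set" where
  "inverse_pairs a = {(U, V). U \<in> carrier_mat a a \<and> V \<in> carrier_mat a a \<and> U * V = 1\<^sub>m a \<and> V * U = 1\<^sub>m a}"

text \<open>The full rank factorisations of one product form a torsor under \<open>GL a\<close>:
  they are \<open>(B U, V C)\<close> with \<open>V\<close> inverse to \<open>U\<close>, and
  \<open>U\<close> is recovered as \<open>B' B1\<close>.\<close>

lemma card_full_rank_pair_fibre:
  fixes B :: "'a::field mat"
  assumes r: "full_rank_pair m a B C"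
  shows "card {(B1, C1). full_rank_pair m a B1 C1 \<and> B1 * C1 = B * C} =
    card (inverse_pairs a :: ('a mat \<times> 'a mat) set)"
proof -
  from r obtain B' C' where B: "B \<in> carrier_mat m a" and C: "C \<in> carrier_mat a m"
    and B': "B' \<in> carrier_mat a m" and BB: "B' * B = 1\<^sub>m a"
    and C': "C' \<in> carrier_mat m a" and CC: "C * C' = 1\<^sub>m a" by (auto simp: full_rank_pair_def)
  let ?G = "inverse_pairs a :: ('a mat \<times> 'a mat) set"
  let ?F = "{(B1, C1). full_rank_pair m a B1 C1 \<and> B1 * C1 = B * C}"
  have "bij_betw (\<lambda>(U, V). (B * U, V * C)) ?G ?F"
  proof (rule bij_betwI[where g = "\<lambda>(B1, C1). (B' * B1, C1 * C')"])
    show "(\<lambda>(U, V). (B * U, V * C)) \<in> ?G \<rightarrow> ?F"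
      unfolding inverse_pairs_def
    proof clarify
      fix U V :: "'a mat"
      assume U: "U \<in> carrier_mat a a" and V: "V \<in> carrier_mat a a" and UV: "U * V = 1\<^sub>m a" and VU: "V * U = 1\<^sub>m a"
      have BU: "B * U \<in> carrier_mat m a" and VC: "V * C \<in> carrier_mat a m" using B U V C by auto
      have VB: "V * B' \<in> carrier_mat a m" and CU: "C' * U \<in> carrier_mat m a" using B' U V C' by auto
      have "(V * B') * (B * U) = 1\<^sub>m a"
        using assoc_mult_mat[OF V B' BU] mult_cancel_one[OF B' B U BB] VU by simp
      moreover have "(V * C) * (C' * U) = 1\<^sub>m a"
        using assoc_mult_mat[OF V C CU] mult_cancel_one[OF C C' U CC] VU by simp
      moreover have "(B * U) * (V * C) = B * C"
        using assoc_mult_mat[OF B U VC] mult_cancel_one[OF U V C UV] by simp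
      ultimately show "full_rank_pair m a (B * U) (V * C) \<and> B * U * (V * C) = B * C"
        using BU VC VB CU by (auto simp: full_rank_pair_def)
    qed
    show "(\<lambda>(B1, C1). (B' * B1, C1 * C')) \<in> ?F \<rightarrow> ?G"
      unfolding inverse_pairs_def
    proof clarify
      fix B1 C1 assume r1: "full_rank_pair m a B1 C1" and eq: "B1 * C1 = B * C"
      have B1: "B1 \<in> carrier_mat m a" and C1: "C1 \<in> carrier_mat a m" using r1 by (auto simp: full_rank_pair_def)
      have U: "B' * B1 \<in> carrier_mat a a" and V: "C1 * C' \<in> carrier_mat a a" using B' B1 C1 C' by auto
      have "B' * B1 * (C1 * C') = B' * ((B1 * C1) * C')"
        using assoc_mult_mat[OF B' B1 V] assoc_mult_mat[OF B1 C1 C'] by simp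
      also have "(B1 * C1) * C' = B"
        unfolding eq using assoc_mult_mat[OF B C C'] CC right_mult_one_mat[OF B] by simp
      finally have "B' * B1 * (C1 * C') = 1\<^sub>m a" using BB by simp
      thus "B' * B1 \<in> carrier_mat a a \<and> C1 * C' \<in> carrier_mat a a \<and>
          B' * B1 * (C1 * C') = 1\<^sub>m a \<and> C1 * C' * (B' * B1) = 1\<^sub>m a"
        using mat_mult_left_right_inverse[OF U V] U V by blast
    qed
    show "(\<lambda>(B1, C1). (B' * B1, C1 * C')) ((\<lambda>(U, V). (B * U, V * C)) x) = x" if "x \<in> ?G" for x
      using that mult_cancel_one[OF B' B _ BB] assoc_mult_mat[OF _ C C'] CC
      by (auto simp: inverse_pairs_def)
    show "(\<lambda>(U, V). (B * U, V * C)) ((\<lambda>(B1, C1). (B' * B1, C1 * C')) y) = y" if y: "y \<in> ?F" for y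
    proof -
      obtain B1 C1 where y': "y = (B1, C1)" and r1: "full_rank_pair m a B1 C1" and eq: "B1 * C1 = B * C"
        using y by auto
      from r1 obtain B1' C1' where B1: "B1 \<in> carrier_mat m a" and C1: "C1 \<in> carrier_mat a m"
        and B1': "B1' \<in> carrier_mat a m" and BB1: "B1' * B1 = 1\<^sub>m a"
        and C1': "C1' \<in> carrier_mat m a" and CC1: "C1 * C1' = 1\<^sub>m a" by (auto simp: full_rank_pair_def)
      have X: "C * C1' \<in> carrier_mat a a" and Y: "B1' * B \<in> carrier_mat a a" using C C1' B1' B by auto
      have "B1 = B1 * C1 * C1'"
        using assoc_mult_mat[OF B1 C1 C1'] CC1 right_mult_one_mat[OF B1] by simp
      also have "\<dots> = B * (C * C1')" unfolding eq by (rule assoc_mult_mat[OF B C C1'])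
      finally have B1eq: "B1 = B * (C * C1')" .
      have "B * (B' * B1) = B1"
        unfolding B1eq using mult_cancel_one[OF B' B X BB] by simp
      moreover have "C1 = B1' * (B1 * C1)"
        by (rule mult_cancel_one[OF B1' B1 C1 BB1, symmetric])
      hence C1eq: "C1 = (B1' * B) * C" unfolding eq using assoc_mult_mat[OF B1' B C] by simp
      have "C1 * C' = B1' * B"
        unfolding C1eq using assoc_mult_mat[OF Y C C'] CC right_mult_one_mat[OF Y] by simp
      hence "C1 * C' * C = C1" using C1eq by simp
      ultimately show ?thesis by (simp add: y')
    qed
  qed
  from bij_betw_same_card[OF this] show ?thesis by simp
qed

lemma GL_factors:
  fixes h k :: "'a::field mat"
  assumes h: "h \<in> carrier_mat m m" and k: "k \<in> carrier_mat m m" and g: "h * k \<in> GL m"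
  shows "h \<in> GL m \<and> k \<in> GL m"
proof -
  obtain x where x: "x \<in> carrier_mat m m" "h * k * x = 1\<^sub>m m" "x * (h * k) = 1\<^sub>m m"
    using GL_D[OF g] by metis
  have kx: "k * x \<in> carrier_mat m m" and xh: "x * h \<in> carrier_mat m m" using k x h by auto
  have 1: "h * (k * x) = 1\<^sub>m m" using assoc_mult_mat[OF h k x(1)] x(2) by simp
  have 2: "x * h * k = 1\<^sub>m m" using assoc_mult_mat[OF x(1) h k] x(3) by simp
  show ?thesis
    using GL_I[OF h kx 1 mat_mult_left_right_inverse[OF h kx 1]]
      GL_I[OF k xh mat_mult_left_right_inverse[OF xh k 2] 2] by blast
qed

definition factor_pairs where
  "factor_pairs m \<mu> \<nu> g = {(h, k). h \<in> GL m \<and> k \<in> GL m \<and> mod_type_of h = \<mu> \<and> mod_type_of k = \<nu> \<and> h * k = g}"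

definition factor_quads where
  "factor_quads m a b \<mu> \<nu> g = {((B, C), (D, E)). full_rank_pair m a B C \<and> full_rank_pair m b D E \<and>
    mod_type_of (1\<^sub>m m + B * C) = \<mu> \<and> mod_type_of (1\<^sub>m m + D * E) = \<nu> \<and>
    (1\<^sub>m m + B * C) * (1\<^sub>m m + D * E) = g}"

text \<open>This holds for every \<open>a\<close> if no invertible matrix has modified type \<open>\<mu>\<close>.\<close>

definition has_rank :: "nat \<Rightarrow> ('a::field poly \<Rightarrow> nat multiset) \<Rightarrow> bool" where
  "has_rank a \<mu> \<longleftrightarrow> (\<forall>m (h :: 'a mat). h \<in> GL m \<and> mod_type_of h = \<mu> \<longrightarrow> (\<exists>B C. full_rank_pair m a B C \<and> h = 1\<^sub>m m + B * C))"

lemma has_rank_exists: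
  fixes \<mu> :: "'a::{field,finite} poly \<Rightarrow> nat multiset"
  shows "\<exists>a. has_rank a \<mu>"
proof (cases "\<exists>m (h :: 'a mat). h \<in> GL m \<and> mod_type_of h = \<mu>")
  case True
  then obtain m and h :: "'a mat" where h: "h \<in> GL m" "mod_type_of h = \<mu>" by blast
  hence "h \<in> carrier_mat m m" by (simp add: GL_def)
  from full_rank_pair_exists[OF this] obtain a B C where r: "full_rank_pair m a B C" "h = 1\<^sub>m m + B * C" by blast
  have "has_rank a \<mu>"
    unfolding has_rank_def
  proof (intro allI impI)
    fix m' and h' :: "'a mat" assume h': "h' \<in> GL m' \<and> mod_type_of h' = \<mu>"
    hence "h' \<in> carrier_mat m' m'" by (simp add: GL_def)
    from full_rank_pair_exists[OF this] obtain a' B' C' where r': "full_rank_pair m' a' B' C'" "h' = 1\<^sub>m m' + B' * C'" by blast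
    have "a = a'" using full_rank_pair_rank_unique[OF r(1) r'(1)] h h' r r' by simp
    thus "\<exists>B C. full_rank_pair m' a B C \<and> h' = 1\<^sub>m m' + B * C" using r' by blast
  qed
  thus ?thesis by blast
next
  case False
  thus ?thesis unfolding has_rank_def by blast
qed

lemma one_plus_inj:
  fixes X Y :: "'a::field mat"
  assumes "X \<in> carrier_mat m m" "Y \<in> carrier_mat m m" "1\<^sub>m m + X = 1\<^sub>m m + Y"
  shows "X = Y"
proof (rule eq_matI)
  fix i j assume "i < dim_row Y" "j < dim_col Y"
  thus "X $$ (i, j) = Y $$ (i, j)" using arg_cong[OF assms(3), of "\<lambda>M. M $$ (i, j)"] assms(1,2) by simp
qed (use assms in auto)

lemma full_rank_pair_mult_carrier: "full_rank_pair m a B C \<Longrightarrow> B * C \<in> carrier_mat m m"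
  by (auto simp: full_rank_pair_def)

text \<open>Each fibre of the map to \<open>(h, k)\<close> is a product of two torsors, whose size
  depends on \<open>a\<close> and \<open>b\<close> but not on \<open>m\<close> or
  \<open>g\<close>.\<close>

lemma card_factor_quads:
  fixes \<mu> \<nu> :: "'a::{field,finite} poly \<Rightarrow> nat multiset"
  assumes a: "has_rank a \<mu>" and b: "has_rank b \<nu>" and g: "g \<in> GL m"
  shows "card (factor_quads m a b \<mu> \<nu> g) = card (factor_pairs m \<mu> \<nu> g) *
    (card (inverse_pairs a :: ('a mat \<times> 'a mat) set) *
     card (inverse_pairs b :: ('a mat \<times> 'a mat) set))"
proof -
  let ?u = "\<lambda>a. card (inverse_pairs a :: ('a mat \<times> 'a mat) set)"
  let ?Q = "factor_quads m a b \<mu> \<nu> g" and ?P = "factor_pairs m \<mu> \<nu> g"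
  define f where "f = (\<lambda>((B :: 'a mat, C), (D :: 'a mat, E)). (1\<^sub>m m + B * C, 1\<^sub>m m + D * E))"
  have fQ: "finite ?Q"
    by (rule finite_subset[of _ "(carrier_mat m a \<times> carrier_mat a m) \<times> (carrier_mat m b \<times> carrier_mat b m)"])
       (auto simp: factor_quads_def full_rank_pair_def)
  have fP: "finite ?P"
    by (rule finite_subset[of _ "carrier_mat m m \<times> carrier_mat m m"])
       (auto simp: factor_pairs_def GL_def)
  have im: "f ` ?Q \<subseteq> ?P"
  proof (rule image_subsetI)
    fix x assume "x \<in> ?Q"
    then obtain B C D E where x: "x = ((B, C), (D, E))" and r: "full_rank_pair m a B C" "full_rank_pair m b D E"
      and t: "mod_type_of (1\<^sub>m m + B * C) = \<mu>" "mod_type_of (1\<^sub>m m + D * E) = \<nu>"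
      and p: "(1\<^sub>m m + B * C) * (1\<^sub>m m + D * E) = g"
      by (auto simp: factor_quads_def)
    have "1\<^sub>m m + B * C \<in> GL m \<and> 1\<^sub>m m + D * E \<in> GL m"
      using full_rank_pair_mult_carrier[OF r(1)] full_rank_pair_mult_carrier[OF r(2)] g p by (intro GL_factors) auto
    thus "f x \<in> ?P" using t p by (simp add: factor_pairs_def f_def x)
  qed
  have fib: "card {x \<in> ?Q. f x = y} = ?u a * ?u b" if y: "y \<in> ?P" for y
  proof -
    obtain h k where y': "y = (h, k)" and hk: "h \<in> GL m" "k \<in> GL m" "mod_type_of h = \<mu>" "mod_type_of k = \<nu>" "h * k = g"
      using y by (auto simp: factor_pairs_def)
    obtain B0 C0 where r0: "full_rank_pair m a B0 C0" "h = 1\<^sub>m m + B0 * C0" using a hk unfolding has_rank_def by blast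
    obtain D0 E0 where s0: "full_rank_pair m b D0 E0" "k = 1\<^sub>m m + D0 * E0" using b hk unfolding has_rank_def by blast
    have eqB: "1\<^sub>m m + B * C = h \<longleftrightarrow> B * C = B0 * C0" if "full_rank_pair m a B C" for B C
      using one_plus_inj[OF full_rank_pair_mult_carrier[OF that] full_rank_pair_mult_carrier[OF r0(1)]] r0(2) by auto
    have eqD: "1\<^sub>m m + D * E = k \<longleftrightarrow> D * E = D0 * E0" if "full_rank_pair m b D E" for D E
      using one_plus_inj[OF full_rank_pair_mult_carrier[OF that] full_rank_pair_mult_carrier[OF s0(1)]] s0(2) by auto
    have "{x \<in> ?Q. f x = y} = {(B, C). full_rank_pair m a B C \<and> B * C = B0 * C0} \<times> {(D, E). full_rank_pair m b D E \<and> D * E = D0 * E0}"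
      (is "?L = ?R")
    proof (intro equalityI subsetI)
      fix x assume "x \<in> ?L"
      thus "x \<in> ?R" using eqB eqD by (auto simp: factor_quads_def f_def y')
    next
      fix x assume "x \<in> ?R"
      then obtain B C D E where x: "x = ((B, C), (D, E))" and r: "full_rank_pair m a B C" "full_rank_pair m b D E"
        "B * C = B0 * C0" "D * E = D0 * E0" by auto
      have "1\<^sub>m m + B * C = h" "1\<^sub>m m + D * E = k" using r(3,4) r0(2) s0(2) by simp_all
      thus "x \<in> ?L" using r hk by (simp add: factor_quads_def f_def x y')
    qed
    thus ?thesis
      by (simp add: card_cartesian_product card_full_rank_pair_fibre[OF r0(1)] card_full_rank_pair_fibre[OF s0(1)])
  qed
  show ?thesis
    using card_sum_fibres[OF fQ fP im] fib by simp
qed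

section \<open>Block coordinates and the product of two factors\<close>

definition incl1 :: "nat \<Rightarrow> nat \<Rightarrow> 'a::field mat" where "incl1 a b = vcat (1\<^sub>m a) (0\<^sub>m b a)"
definition incl2 :: "nat \<Rightarrow> nat \<Rightarrow> 'a::field mat" where "incl2 a b = vcat (0\<^sub>m a b) (1\<^sub>m b)"
definition proj1 :: "nat \<Rightarrow> nat \<Rightarrow> 'a::field mat" where "proj1 a b = hcat (1\<^sub>m a) (0\<^sub>m a b)"
definition proj2 :: "nat \<Rightarrow> nat \<Rightarrow> 'a::field mat" where "proj2 a b = hcat (0\<^sub>m b a) (1\<^sub>m b)"

lemma incl_proj_carrier:
  "incl1 a b \<in> carrier_mat (a + b) a" "incl2 a b \<in> carrier_mat (a + b) b"
  "proj1 a b \<in> carrier_mat a (a + b)" "proj2 a b \<in> carrier_mat b (a + b)"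
  by (simp_all add: incl1_def incl2_def proj1_def proj2_def)

lemma hcat_incl:
  fixes B :: "'a::field mat"
  assumes B: "B \<in> carrier_mat m a" and D: "D \<in> carrier_mat m b"
  shows "hcat B D * incl1 a b = B" "hcat B D * incl2 a b = D"
proof -
  show "hcat B D * incl1 a b = B"
    unfolding incl1_def hcat_mult_vcat[OF B D one_carrier_mat zero_carrier_mat]
    using right_mult_one_mat[OF B] right_mult_zero_mat[OF D, of a] B by simp
  show "hcat B D * incl2 a b = D"
    unfolding incl2_def hcat_mult_vcat[OF B D zero_carrier_mat one_carrier_mat]
    using right_mult_one_mat[OF D] right_mult_zero_mat[OF B, of b] D by simp
qed

lemma proj_vcat:
  fixes C :: "'a::field mat"
  assumes C: "C \<in> carrier_mat a m" and E: "E \<in> carrier_mat b m"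
  shows "proj1 a b * vcat C E = C" "proj2 a b * vcat C E = E"
proof -
  show "proj1 a b * vcat C E = C"
    unfolding proj1_def hcat_mult_vcat[OF one_carrier_mat zero_carrier_mat C E]
    using left_mult_one_mat[OF C] left_mult_zero_mat[OF E, of a] C by simp
  show "proj2 a b * vcat C E = E"
    unfolding proj2_def hcat_mult_vcat[OF zero_carrier_mat one_carrier_mat C E]
    using left_mult_one_mat[OF E] left_mult_zero_mat[OF C, of b] E by simp
qed

text \<open>For \<open>Z = T S\<close> the upper right block of \<open>Z\<close> is
  \<open>C D\<close>, so this is the unitriangular matrix \<open>N\<close> with corner
  \<open>C D\<close>. It is the middle factor in \<open>B C + D E + B C D E = S N T\<close>.\<close>

definition twist :: "nat \<Rightarrow> nat \<Rightarrow> 'a::field mat \<Rightarrow> 'a mat" where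
  "twist a b Z = 1\<^sub>m (a + b) + incl1 a b * (proj1 a b * (Z * incl2 a b)) * proj2 a b"

lemma twist_carrier: "Z \<in> carrier_mat (a + b) (a + b) \<Longrightarrow> twist a b Z \<in> carrier_mat (a + b) (a + b)"
  unfolding twist_def
  by (intro add_carrier_mat mult_carrier_mat[OF mult_carrier_mat[OF incl_proj_carrier(1)] incl_proj_carrier(4)]
      mult_carrier_mat[OF incl_proj_carrier(3)] mult_carrier_mat[OF _ incl_proj_carrier(2)]) simp_all

text \<open>The conditions on \<open>S = [B D]\<close> and on \<open>T\<close>, which is \<open>C\<close> on top of \<open>E\<close>, expressed by \<open>Z = T S\<close>, \<open>K = ker S\<close>
  and \<open>L = im T\<close>. Here \<open>C B\<close> and \<open>E D\<close> are diagonal blocks of \<open>Z\<close>.\<close>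

definition st_cond where
  "st_cond a b \<mu> \<nu> Z K L \<longleftrightarrow> type_of (1\<^sub>m a + proj1 a b * (Z * incl1 a b)) = \<mu> \<and>
    type_of (1\<^sub>m b + proj2 a b * (Z * incl2 a b)) = \<nu> \<and>
    (\<forall>x\<in>carrier_vec a. incl1 a b *\<^sub>v x \<in> K \<longrightarrow> x = 0\<^sub>v a) \<and>
    (\<forall>x\<in>carrier_vec b. incl2 a b *\<^sub>v x \<in> K \<longrightarrow> x = 0\<^sub>v b) \<and>
    (\<forall>y\<in>carrier_vec a. \<exists>l\<in>L. proj1 a b *\<^sub>v l = y) \<and> (\<forall>y\<in>carrier_vec b. \<exists>l\<in>L. proj2 a b *\<^sub>v l = y)"

lemma mult_twist:
  fixes S :: "'a::field mat"
  assumes S: "S \<in> carrier_mat m (a + b)" and T: "T \<in> carrier_mat (a + b) m"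
    and B: "B = S * incl1 a b" and D: "D = S * incl2 a b" and C: "C = proj1 a b * T" and E: "E = proj2 a b * T"
    and ST: "S * T = B * C + D * E"
  shows "(1\<^sub>m m + B * C) * (1\<^sub>m m + D * E) = 1\<^sub>m m + S * twist a b (T * S) * T"
proof -
  note J = incl_proj_carrier(1,2)[of a b] and P = incl_proj_carrier(3,4)[of a b]
  have Bc: "B \<in> carrier_mat m a" and Dc: "D \<in> carrier_mat m b"
    and Cc: "C \<in> carrier_mat a m" and Ec: "E \<in> carrier_mat b m"
    unfolding B C D E using S T J P by (auto intro: mult_carrier_mat)
  have BC: "B * C \<in> carrier_mat m m" and DE: "D * E \<in> carrier_mat m m" and CD: "C * D \<in> carrier_mat a b"
    using Bc Cc Dc Ec by auto
  have Z: "T * S \<in> carrier_mat (a + b) (a + b)" using S T by simp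
  have ZJ: "T * S * incl2 a b \<in> carrier_mat (a + b) b" by (rule mult_carrier_mat[OF Z J(2)])
  have CDeq: "proj1 a b * (T * S * incl2 a b) = C * D"
    unfolding C D assoc_mult_mat[OF T S J(2)] using assoc_mult_mat[OF P(1) T mult_carrier_mat[OF S J(2)]] by simp
  define M where "M = incl1 a b * (C * D) * proj2 a b"
  have JM: "incl1 a b * (C * D) \<in> carrier_mat (a + b) b" by (rule mult_carrier_mat[OF J(1) CD])
  have M: "M \<in> carrier_mat (a + b) (a + b)" unfolding M_def by (rule mult_carrier_mat[OF JM P(2)])
  have "S * M * T = B * (C * D) * E"
  proof -
    \<comment> \<open>The corner of the twist accounts for the only term of degree two,
      \<open>B C D E\<close>.\<close>
    have "S * M = S * (incl1 a b * (C * D)) * proj2 a b"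
      unfolding M_def by (rule assoc_mult_mat[OF S JM P(2), symmetric])
    also have "S * (incl1 a b * (C * D)) = B * (C * D)"
      unfolding B by (rule assoc_mult_mat[OF S J(1) CD, symmetric])
    finally have SM: "S * M = B * (C * D) * proj2 a b" .
    show ?thesis
      unfolding SM E by (rule assoc_mult_mat[OF mult_carrier_mat[OF Bc CD] P(2) T])
  qed
  also have "\<dots> = (B * C) * (D * E)"
    using assoc_mult_mat[OF Bc CD Ec] assoc_mult_mat[OF Cc Dc Ec]
      assoc_mult_mat[OF Bc Cc DE] by simp
  finally have SMT: "S * M * T = (B * C) * (D * E)" .
  have "S * twist a b (T * S) = S * 1\<^sub>m (a + b) + S * M"
    unfolding twist_def CDeq M_def[symmetric] by (rule mult_add_distrib_mat[OF S one_carrier_mat M])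
  also have "S * 1\<^sub>m (a + b) = S" by (rule right_mult_one_mat[OF S])
  finally have "S * twist a b (T * S) * T = (S + S * M) * T" by simp
  also have "\<dots> = S * T + S * M * T"
    by (rule add_mult_distrib_mat[OF S mult_carrier_mat[OF S M] T])
  finally have rhs: "S * twist a b (T * S) * T = (B * C + D * E) + (B * C) * (D * E)"
    by (simp only: ST SMT)
  have oDE: "1\<^sub>m m + D * E \<in> carrier_mat m m" using DE by simp
  have "(1\<^sub>m m + B * C) * (1\<^sub>m m + D * E) = 1\<^sub>m m * (1\<^sub>m m + D * E) + B * C * (1\<^sub>m m + D * E)"
    by (rule add_mult_distrib_mat[OF one_carrier_mat BC oDE])
  also have "1\<^sub>m m * (1\<^sub>m m + D * E) = 1\<^sub>m m + D * E" by (rule left_mult_one_mat[OF oDE])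
  also have "B * C * (1\<^sub>m m + D * E) = B * C * 1\<^sub>m m + B * C * (D * E)"
    by (rule mult_add_distrib_mat[OF BC one_carrier_mat DE])
  also have "B * C * 1\<^sub>m m = B * C" by (rule right_mult_one_mat[OF BC])
  finally have lhs: "(1\<^sub>m m + B * C) * (1\<^sub>m m + D * E) = 1\<^sub>m m + D * E + (B * C + B * C * (D * E))" .
  have "1\<^sub>m m + Y + (X + W) = 1\<^sub>m m + ((X + Y) + W)"
    if "X \<in> carrier_mat m m" "Y \<in> carrier_mat m m" "W \<in> carrier_mat m m" for X Y W :: "'a mat"
    using that by (intro eq_matI) (auto simp: algebra_simps)
  from this[OF BC DE mult_carrier_mat[OF BC DE]] show ?thesis unfolding lhs rhs .
qed

text \<open>\<open>mod_type_of_one_plus\<close> is what removes the size \<open>m\<close> from the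
  type conditions: they become conditions on \<open>1 + C B\<close> and
  \<open>1 + E D\<close>.\<close>

lemma factor_quads_iff:
  fixes B :: "'a::{field,finite} mat"
  assumes B: "B \<in> carrier_mat m a" and C: "C \<in> carrier_mat a m"
    and D: "D \<in> carrier_mat m b" and E: "E \<in> carrier_mat b m" and g: "g \<in> carrier_mat m m"
  defines "S \<equiv> hcat B D" and "T \<equiv> vcat C E"
  shows "((B, C), (D, E)) \<in> factor_quads m a b \<mu> \<nu> g \<longleftrightarrow>
    st_cond a b \<mu> \<nu> (T * S) (ker_mat (a + b) S) (im_mat m T) \<and> S * twist a b (T * S) * T = g - 1\<^sub>m m"
proof -
  note J = incl_proj_carrier(1,2)[of a b] and P = incl_proj_carrier(3,4)[of a b]
  have S: "S \<in> carrier_mat m (a + b)" and T: "T \<in> carrier_mat (a + b) m"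
    using B C D E by (auto simp: S_def T_def)
  have SJ: "S * incl1 a b = B" "S * incl2 a b = D" using hcat_incl[OF B D] by (auto simp: S_def)
  have PT: "proj1 a b * T = C" "proj2 a b * T = E" using proj_vcat[OF C E] by (auto simp: T_def)
  have ST: "S * T = B * C + D * E" unfolding S_def T_def by (rule hcat_mult_vcat[OF B D C E])
  have k1: "incl1 a b *\<^sub>v x \<in> ker_mat (a + b) S \<longleftrightarrow> B *\<^sub>v x = 0\<^sub>v m" if "x \<in> carrier_vec a" for x
    using assoc_mult_mat_vec[OF S J(1) that] mult_mat_vec_carrier[OF J(1) that] S
    by (simp add: ker_mat_def SJ)
  have k2: "incl2 a b *\<^sub>v x \<in> ker_mat (a + b) S \<longleftrightarrow> D *\<^sub>v x = 0\<^sub>v m" if "x \<in> carrier_vec b" for x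
    using assoc_mult_mat_vec[OF S J(2) that] mult_mat_vec_carrier[OF J(2) that] S
    by (simp add: ker_mat_def SJ)
  have inj: "(\<forall>x\<in>carrier_vec a. B *\<^sub>v x = 0\<^sub>v m \<longrightarrow> x = 0\<^sub>v a) \<longleftrightarrow>
      (\<forall>x\<in>carrier_vec a. incl1 a b *\<^sub>v x \<in> ker_mat (a + b) S \<longrightarrow> x = 0\<^sub>v a)"
    "(\<forall>x\<in>carrier_vec b. D *\<^sub>v x = 0\<^sub>v m \<longrightarrow> x = 0\<^sub>v b) \<longleftrightarrow>
      (\<forall>x\<in>carrier_vec b. incl2 a b *\<^sub>v x \<in> ker_mat (a + b) S \<longrightarrow> x = 0\<^sub>v b)"
    using k1 k2 by blast+
  have surj: "(\<forall>y\<in>carrier_vec a. \<exists>u\<in>carrier_vec m. C *\<^sub>v u = y) \<longleftrightarrow>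
      (\<forall>y\<in>carrier_vec a. \<exists>l\<in>im_mat m T. proj1 a b *\<^sub>v l = y)"
    "(\<forall>y\<in>carrier_vec b. \<exists>u\<in>carrier_vec m. E *\<^sub>v u = y) \<longleftrightarrow>
      (\<forall>y\<in>carrier_vec b. \<exists>l\<in>im_mat m T. proj2 a b *\<^sub>v l = y)"
    using assoc_mult_mat_vec[OF P(1) T] assoc_mult_mat_vec[OF P(2) T]
    by (auto simp: im_mat_def PT)
  have CB: "proj1 a b * (T * S * incl1 a b) = C * B"
    using assoc_mult_mat[OF P(1) T B] assoc_mult_mat[OF T S J(1)] by (simp add: SJ PT)
  have ED: "proj2 a b * (T * S * incl2 a b) = E * D"
    using assoc_mult_mat[OF P(2) T D] assoc_mult_mat[OF T S J(2)] by (simp add: SJ PT)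
  have tw: "(1\<^sub>m m + B * C) * (1\<^sub>m m + D * E) = 1\<^sub>m m + S * twist a b (T * S) * T"
    by (rule mult_twist[OF S T SJ(1)[symmetric] SJ(2)[symmetric] PT(1)[symmetric] PT(2)[symmetric] ST])
  have X: "S * twist a b (T * S) * T \<in> carrier_mat m m"
    by (rule mult_carrier_mat[OF mult_carrier_mat[OF S twist_carrier[OF mult_carrier_mat[OF T S]]] T])
  have eq: "1\<^sub>m m + X = g \<longleftrightarrow> X = g - 1\<^sub>m m" if "X \<in> carrier_mat m m" for X
  proof
    have "1\<^sub>m m + X - 1\<^sub>m m = X" using that by (intro eq_matI) auto
    thus "X = g - 1\<^sub>m m" if "1\<^sub>m m + X = g" using that by simp
  next
    assume "X = g - 1\<^sub>m m"
    thus "1\<^sub>m m + X = g" using g by (auto intro!: eq_matI)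
  qed
  have "((B, C), (D, E)) \<in> factor_quads m a b \<mu> \<nu> g \<longleftrightarrow> full_rank_pair m a B C \<and> full_rank_pair m b D E \<and>
      type_of (1\<^sub>m a + C * B) = \<mu> \<and> type_of (1\<^sub>m b + E * D) = \<nu> \<and> S * twist a b (T * S) * T = g - 1\<^sub>m m"
    using mod_type_of_one_plus[of m a B C] mod_type_of_one_plus[of m b D E] eq[OF X]
    by (auto simp: factor_quads_def tw)
  also have "\<dots> \<longleftrightarrow> st_cond a b \<mu> \<nu> (T * S) (ker_mat (a + b) S) (im_mat m T) \<and>
      S * twist a b (T * S) * T = g - 1\<^sub>m m"
    unfolding full_rank_pair_iff[OF B C] full_rank_pair_iff[OF D E] inj surj st_cond_def CB ED by blast
  finally show ?thesis .
qed

lemma card_factor_quads_eq: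
  fixes g :: "'a::{field,finite} mat"
  assumes g: "g \<in> carrier_mat m m"
  shows "card (factor_quads m a b \<mu> \<nu> g) = card {(S, T). S \<in> carrier_mat m (a + b) \<and> T \<in> carrier_mat (a + b) m \<and>
    st_cond a b \<mu> \<nu> (T * S) (ker_mat (a + b) S) (im_mat m T) \<and> S * twist a b (T * S) * T = g - 1\<^sub>m m}"
    (is "card ?Q = card ?ST")
proof -
  have car: "B \<in> carrier_mat m a \<and> C \<in> carrier_mat a m \<and> D \<in> carrier_mat m b \<and> E \<in> carrier_mat b m"
    if "((B, C), (D, E)) \<in> ?Q" for B C D E
    using that by (auto simp: factor_quads_def full_rank_pair_def)
  have "bij_betw (\<lambda>((B, C), (D, E)). (hcat B D, vcat C E)) ?Q ?ST"
  proof (rule bij_betw_imageI)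
    show "inj_on (\<lambda>((B, C), (D, E)). (hcat B D, vcat C E)) ?Q"
    proof (rule inj_onI)
      fix x y assume x: "x \<in> ?Q" and y: "y \<in> ?Q"
        and eq: "(\<lambda>((B, C), (D, E)). (hcat B D, vcat C E)) x = (\<lambda>((B, C), (D, E)). (hcat B D, vcat C E)) y"
      obtain B C D E where x': "x = ((B, C), (D, E))" by (metis surj_pair)
      obtain B' C' D' E' where y': "y = ((B', C'), (D', E'))" by (metis surj_pair)
      have cx: "B \<in> carrier_mat m a" "C \<in> carrier_mat a m" "D \<in> carrier_mat m b" "E \<in> carrier_mat b m"
        using car[of B C D E] x x' by auto
      have cy: "B' \<in> carrier_mat m a" "C' \<in> carrier_mat a m" "D' \<in> carrier_mat m b" "E' \<in> carrier_mat b m"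
        using car[of B' C' D' E'] y y' by auto
      show "x = y"
        using hcat_inj[OF cx(1,3) cy(1,3)] vcat_inj[OF cx(2,4) cy(2,4)] eq by (simp add: x' y')
    qed
    show "(\<lambda>((B, C), (D, E)). (hcat B D, vcat C E)) ` ?Q = ?ST"
    proof (intro equalityI subsetI)
      fix z assume "z \<in> (\<lambda>((B, C), (D, E)). (hcat B D, vcat C E)) ` ?Q"
      then obtain B C D E where q: "((B, C), (D, E)) \<in> ?Q" and z: "z = (hcat B D, vcat C E)" by auto
      have c: "B \<in> carrier_mat m a" "C \<in> carrier_mat a m" "D \<in> carrier_mat m b" "E \<in> carrier_mat b m"
        using car[OF q] by auto
      show "z \<in> ?ST" using q factor_quads_iff[OF c g, of \<mu> \<nu>] c unfolding z by auto
    next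
      fix z assume z: "z \<in> ?ST"
      then obtain S T where z': "z = (S, T)" and S: "S \<in> carrier_mat m (a + b)" and T: "T \<in> carrier_mat (a + b) m" by auto
      obtain B D where S': "B \<in> carrier_mat m a" "D \<in> carrier_mat m b" "S = hcat B D" using hcat_split[OF S] by blast
      obtain C E where T': "C \<in> carrier_mat a m" "E \<in> carrier_mat b m" "T = vcat C E" using vcat_split[OF T] by blast
      have "((B, C), (D, E)) \<in> ?Q"
        using z factor_quads_iff[OF S'(1) T'(1) S'(2) T'(2) g, of \<mu> \<nu>] unfolding z' S' T' by auto
      thus "z \<in> (\<lambda>((B, C), (D, E)). (hcat B D, vcat C E)) ` ?Q"
        unfolding z' S'(3) T'(3) by (rule rev_image_eqI) simp
    qed
  qed
  thus ?thesis by (rule bij_betw_same_card)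
qed

lemma ker_mat_vcat:
  assumes "S0 \<in> carrier_mat m0 e" "S1 \<in> carrier_mat n e"
  shows "ker_mat e (vcat S0 S1) = ker_mat e S0 \<inter> ker_mat e S1"
proof -
  have "vcat S0 S1 *\<^sub>v x = 0\<^sub>v (m0 + n) \<longleftrightarrow> S0 *\<^sub>v x = 0\<^sub>v m0 \<and> S1 *\<^sub>v x = 0\<^sub>v n" for x
  proof
    assume z: "vcat S0 S1 *\<^sub>v x = 0\<^sub>v (m0 + n)"
    have "(S0 *\<^sub>v x) $ i = 0" if "i < m0" for i
      using arg_cong[OF z, of "\<lambda>v. v $ i"] that assms row_vcat[OF assms, of i] by simp
    moreover have "(S1 *\<^sub>v x) $ i = 0" if "i < n" for i
      using arg_cong[OF z, of "\<lambda>v. v $ (m0 + i)"] that assms row_vcat[OF assms, of "m0 + i"] by simp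
    ultimately show "S0 *\<^sub>v x = 0\<^sub>v m0 \<and> S1 *\<^sub>v x = 0\<^sub>v n" using assms by (auto simp: vec_eq_iff)
  next
    assume z: "S0 *\<^sub>v x = 0\<^sub>v m0 \<and> S1 *\<^sub>v x = 0\<^sub>v n"
    have "row S0 i \<bullet> x = 0" if "i < m0" for i
      using arg_cong[OF conjunct1[OF z], of "\<lambda>v. v $ i"] that assms by simp
    moreover have "row S1 i \<bullet> x = 0" if "i < n" for i
      using arg_cong[OF conjunct2[OF z], of "\<lambda>v. v $ i"] that assms by simp
    ultimately show "vcat S0 S1 *\<^sub>v x = 0\<^sub>v (m0 + n)"
      using assms by (intro eq_vecI) (auto simp: row_vcat[OF assms])
  qed
  thus ?thesis using assms by (auto simp: ker_mat_def)
qed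

lemma hcat_mult_append_vec:
  fixes T0 :: "'a::field mat"
  assumes T0: "T0 \<in> carrier_mat e m0" and T1: "T1 \<in> carrier_mat e n" and x: "x \<in> carrier_vec m0" and y: "y \<in> carrier_vec n"
  shows "hcat T0 T1 *\<^sub>v (x @\<^sub>v y) = T0 *\<^sub>v x + T1 *\<^sub>v y"
proof -
  have "hcat T0 T1 *\<^sub>v (x @\<^sub>v y) = (T0 *\<^sub>v x + T1 *\<^sub>v y) @\<^sub>v (0\<^sub>m 0 m0 *\<^sub>v x + 0\<^sub>m 0 n *\<^sub>v y)"
    unfolding hcat_def using T0 T1 x y by (simp add: four_block_mat_mult_vec[of _ e m0 _ n _ 0])
  also have "\<dots> = T0 *\<^sub>v x + T1 *\<^sub>v y" using T0 T1 x y by (intro eq_vecI) auto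
  finally show ?thesis .
qed

lemma im_mat_hcat:
  fixes T0 :: "'a::field mat"
  assumes T0: "T0 \<in> carrier_mat e m0" and T1: "T1 \<in> carrier_mat e n"
  shows "im_mat (m0 + n) (hcat T0 T1) = {u + v | u v. u \<in> im_mat m0 T0 \<and> v \<in> im_mat n T1}"
proof (intro equalityI subsetI)
  fix w assume "w \<in> im_mat (m0 + n) (hcat T0 T1)"
  then obtain z where z: "z \<in> carrier_vec (m0 + n)" "w = hcat T0 T1 *\<^sub>v z" by (auto simp: im_mat_def)
  have e: "vec_first z m0 @\<^sub>v vec_last z n = z" using z(1) by (rule vec_first_last_append)
  have "w = T0 *\<^sub>v vec_first z m0 + T1 *\<^sub>v vec_last z n"
    using hcat_mult_append_vec[OF T0 T1, of "vec_first z m0" "vec_last z n"] z(2) e by simp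
  thus "w \<in> {u + v | u v. u \<in> im_mat m0 T0 \<and> v \<in> im_mat n T1}"
    using vec_first_carrier vec_last_carrier unfolding im_mat_def by blast
next
  fix w assume "w \<in> {u + v | u v. u \<in> im_mat m0 T0 \<and> v \<in> im_mat n T1}"
  then obtain x y where xy: "x \<in> carrier_vec m0" "y \<in> carrier_vec n" "w = T0 *\<^sub>v x + T1 *\<^sub>v y"
    by (auto simp: im_mat_def)
  thus "w \<in> im_mat (m0 + n) (hcat T0 T1)"
    unfolding im_mat_def using hcat_mult_append_vec[OF T0 T1 xy(1,2)]
    by (intro image_eqI[where x = "x @\<^sub>v y"]) auto
qed

lemma mult_eq_0_iff_im_mat:
  fixes X :: "'a::field mat"
  assumes X: "X \<in> carrier_mat k e" and T: "T \<in> carrier_mat e n"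
  shows "X * T = 0\<^sub>m k n \<longleftrightarrow> (\<forall>l\<in>im_mat n T. X *\<^sub>v l = 0\<^sub>v k)"
proof
  assume z: "X * T = 0\<^sub>m k n"
  have "0\<^sub>m k n *\<^sub>v x = 0\<^sub>v k" if "x \<in> carrier_vec n" for x :: "'a vec"
    using that by (intro eq_vecI) auto
  thus "\<forall>l\<in>im_mat n T. X *\<^sub>v l = 0\<^sub>v k"
    using assoc_mult_mat_vec[OF X T] z by (auto simp: im_mat_def)
next
  assume "\<forall>l\<in>im_mat n T. X *\<^sub>v l = 0\<^sub>v k"
  thus "X * T = 0\<^sub>m k n"
    using assoc_mult_mat_vec[OF X T] by (intro mat_eq_0_if_kills[OF mult_carrier_mat[OF X T]]) (auto simp: im_mat_def)
qed

lemma four_block_mat_inj: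
  assumes "A \<in> carrier_mat a c" "B \<in> carrier_mat a d" "C \<in> carrier_mat b c" "D \<in> carrier_mat b d"
    "A' \<in> carrier_mat a c" "B' \<in> carrier_mat a d" "C' \<in> carrier_mat b c" "D' \<in> carrier_mat b d"
  shows "four_block_mat A B C D = four_block_mat A' B' C' D' \<longleftrightarrow> A = A' \<and> B = B' \<and> C = C' \<and> D = D'"
proof
  assume eq: "four_block_mat A B C D = four_block_mat A' B' C' D'"
  have e: "four_block_mat A B C D $$ (i, j) = four_block_mat A' B' C' D' $$ (i, j)" for i j
    using eq by simp
  show "A = A' \<and> B = B' \<and> C = C' \<and> D = D'"
  proof (intro conjI eq_matI)
    fix i j assume "i < dim_row A'" "j < dim_col A'"
    thus "A $$ (i, j) = A' $$ (i, j)" using e[of i j] assms by simp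
  next
    fix i j assume "i < dim_row B'" "j < dim_col B'"
    thus "B $$ (i, j) = B' $$ (i, j)" using e[of i "c + j"] assms by simp
  next
    fix i j assume "i < dim_row C'" "j < dim_col C'"
    thus "C $$ (i, j) = C' $$ (i, j)" using e[of "a + i" j] assms by simp
  next
    fix i j assume "i < dim_row D'" "j < dim_col D'"
    thus "D $$ (i, j) = D' $$ (i, j)" using e[of "a + i" "c + j"] assms by simp
  qed (use assms in auto)
qed simp

text \<open>Here \<open>K\<close>, \<open>L\<close> and \<open>W\<close> stand for the kernel of
  \<open>S1\<close>, the image of \<open>T1\<close> and \<open>T1 S1\<close>, and \<open>H\<close>
  for \<open>g0 - 1\<close>. The matrix to be matched is \<open>H\<close> bordered by zeros, so one
  block of \<open>S N T\<close> is prescribed and three must vanish; each vanishing is a condition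
  on \<open>K\<close> and \<open>L\<close>.\<close>

definition split_cond where
  "split_cond m0 a b \<mu> \<nu> H = (\<lambda>(S0, T0) K L W.
    let N = twist a b (T0 * S0 + W) in
      st_cond a b \<mu> \<nu> (T0 * S0 + W) (ker_mat (a + b) S0 \<inter> K) {u + v | u v. u \<in> im_mat m0 T0 \<and> v \<in> L} \<and>
      S0 * N * T0 = H \<and> (\<forall>l\<in>L. (S0 * N) *\<^sub>v l = 0\<^sub>v m0) \<and>
      (\<forall>l\<in>im_mat m0 T0. N *\<^sub>v l \<in> K) \<and> (\<forall>l\<in>L. N *\<^sub>v l \<in> K))"

lemma split_cond_iff:
  fixes S0 :: "'a::{field,finite} mat"
  assumes S0: "S0 \<in> carrier_mat m0 (a + b)" and T0: "T0 \<in> carrier_mat (a + b) m0"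
    and S1: "S1 \<in> carrier_mat n (a + b)" and T1: "T1 \<in> carrier_mat (a + b) n" and g0: "g0 \<in> carrier_mat m0 m0"
  defines "S \<equiv> vcat S0 S1" and "T \<equiv> hcat T0 T1"
    and "g \<equiv> four_block_mat g0 (0\<^sub>m m0 n) (0\<^sub>m n m0) (1\<^sub>m n)"
  shows "st_cond a b \<mu> \<nu> (T * S) (ker_mat (a + b) S) (im_mat (m0 + n) T) \<and>
      S * twist a b (T * S) * T = g - 1\<^sub>m (m0 + n) \<longleftrightarrow>
    split_cond m0 a b \<mu> \<nu> (g0 - 1\<^sub>m m0) (S0, T0) (ker_mat (a + b) S1) (im_mat n T1) (T1 * S1)"
proof -
  have TS: "T * S = T0 * S0 + T1 * S1" unfolding S_def T_def by (rule hcat_mult_vcat[OF T0 T1 S0 S1])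
  have Zc: "T0 * S0 + T1 * S1 \<in> carrier_mat (a + b) (a + b)" using S1 T1 by simp
  define N where "N = twist a b (T0 * S0 + T1 * S1)"
  have N: "N \<in> carrier_mat (a + b) (a + b)" unfolding N_def by (rule twist_carrier[OF Zc])
  have S0N: "S0 * N \<in> carrier_mat m0 (a + b)" and S1N: "S1 * N \<in> carrier_mat n (a + b)" using S0 S1 N by auto
  have H: "g0 - 1\<^sub>m m0 \<in> carrier_mat m0 m0" by (rule minus_carrier_mat[OF one_carrier_mat])
  have gm: "g - 1\<^sub>m (m0 + n) = four_block_mat (g0 - 1\<^sub>m m0) (0\<^sub>m m0 n) (0\<^sub>m n m0) (0\<^sub>m n n)"
    unfolding g_def using g0 by (intro eq_matI) auto
  have "S * N = vcat (S0 * N) (S1 * N)" unfolding S_def by (rule vcat_mult[OF S0 S1 N])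
  hence "S * N * T = four_block_mat (S0 * N * T0) (S0 * N * T1) (S1 * N * T0) (S1 * N * T1)"
    unfolding T_def using vcat_mult_hcat[OF S0N S1N T0 T1] by simp
  hence "S * N * T = g - 1\<^sub>m (m0 + n) \<longleftrightarrow>
      S0 * N * T0 = g0 - 1\<^sub>m m0 \<and> S0 * N * T1 = 0\<^sub>m m0 n \<and> S1 * N * T0 = 0\<^sub>m n m0 \<and> S1 * N * T1 = 0\<^sub>m n n"
    unfolding gm
    using four_block_mat_inj[OF mult_carrier_mat[OF S0N T0] mult_carrier_mat[OF S0N T1]
        mult_carrier_mat[OF S1N T0] mult_carrier_mat[OF S1N T1] H zero_carrier_mat zero_carrier_mat zero_carrier_mat]
    by simp
  moreover have "S0 * N * T1 = 0\<^sub>m m0 n \<longleftrightarrow> (\<forall>l\<in>im_mat n T1. (S0 * N) *\<^sub>v l = 0\<^sub>v m0)"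
    by (rule mult_eq_0_iff_im_mat[OF S0N T1])
  \<comment> \<open>The vanishing says that \<open>N\<close> maps the image of \<open>T'\<close>
    into the kernel of \<open>S1\<close>; it is applied to both \<open>T0\<close> and
    \<open>T1\<close>.\<close>
  moreover have "S1 * N * T' = 0\<^sub>m n k \<longleftrightarrow> (\<forall>l\<in>im_mat k T'. N *\<^sub>v l \<in> ker_mat (a + b) S1)"
    if T': "T' \<in> carrier_mat (a + b) k" for T' k
  proof -
    have "im_mat k T' \<subseteq> carrier_vec (a + b)" using T' by (auto simp: im_mat_def)
    thus ?thesis
      unfolding mult_eq_0_iff_im_mat[OF S1N T']
      using assoc_mult_mat_vec[OF S1 N] N S1 by (auto simp: ker_mat_def subset_iff)
  qed
  ultimately have "S * N * T = g - 1\<^sub>m (m0 + n) \<longleftrightarrow>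
      S0 * N * T0 = g0 - 1\<^sub>m m0 \<and> (\<forall>l\<in>im_mat n T1. (S0 * N) *\<^sub>v l = 0\<^sub>v m0) \<and>
      (\<forall>l\<in>im_mat m0 T0. N *\<^sub>v l \<in> ker_mat (a + b) S1) \<and> (\<forall>l\<in>im_mat n T1. N *\<^sub>v l \<in> ker_mat (a + b) S1)"
    using T0 T1 by blast
  moreover have "ker_mat (a + b) S = ker_mat (a + b) S0 \<inter> ker_mat (a + b) S1"
    unfolding S_def by (rule ker_mat_vcat[OF S0 S1])
  moreover have "im_mat (m0 + n) T = {u + v | u v. u \<in> im_mat m0 T0 \<and> v \<in> im_mat n T1}"
    unfolding T_def by (rule im_mat_hcat[OF T0 T1])
  ultimately show ?thesis
    unfolding split_cond_def Let_def TS N_def by simp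
qed

text \<open>The parts \<open>(S0, T0)\<close> range over a finite set independent of
  \<open>n\<close> and take the role of \<open>x\<close> in
  \<open>poly_expr_card_pairs\<close>.\<close>

lemma poly_expr_card_factor_quads:
  fixes g0 :: "'a::{field,finite} mat"
  assumes g0: "g0 \<in> carrier_mat m0 m0"
  shows "poly_expr UNIV (\<lambda>n. of_nat (card (UNIV :: 'a set)) ^ n)
    (\<lambda>n. of_nat (card (factor_quads (m0 + n) a b \<mu> \<nu> (four_block_mat g0 (0\<^sub>m m0 n) (0\<^sub>m n m0) (1\<^sub>m n)))))"
proof -
  let ?X = "carrier_mat m0 (a + b) \<times> (carrier_mat (a + b) m0 :: 'a mat set)"
  let ?Q = "split_cond m0 a b \<mu> \<nu> (g0 - 1\<^sub>m m0)"
  have "card (factor_quads (m0 + n) a b \<mu> \<nu> (four_block_mat g0 (0\<^sub>m m0 n) (0\<^sub>m n m0) (1\<^sub>m n))) =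
      card {(x, S, T). x \<in> ?X \<and> S \<in> carrier_mat n (a + b) \<and> T \<in> carrier_mat (a + b) n \<and>
        ?Q x (ker_mat (a + b) S) (im_mat n T) (T * S)}" for n
  proof -
    let ?g = "four_block_mat g0 (0\<^sub>m m0 n) (0\<^sub>m n m0) (1\<^sub>m n)"
    let ?D = "{(x, S, T). x \<in> ?X \<and> S \<in> carrier_mat n (a + b) \<and> T \<in> carrier_mat (a + b) n \<and>
        ?Q x (ker_mat (a + b) S) (im_mat n T) (T * S)}"
    let ?ST = "{(S, T). S \<in> carrier_mat (m0 + n) (a + b) \<and> T \<in> carrier_mat (a + b) (m0 + n) \<and>
      st_cond a b \<mu> \<nu> (T * S) (ker_mat (a + b) S) (im_mat (m0 + n) T) \<and> S * twist a b (T * S) * T = ?g - 1\<^sub>m (m0 + n)}"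
    let ?f = "\<lambda>((S0, T0), S1, T1). (vcat S0 S1, hcat T0 T1 :: 'a mat)"
    have "?g \<in> carrier_mat (m0 + n) (m0 + n)" using g0 by simp
    note card_factor_quads_eq[OF this, of a b \<mu> \<nu>]
    also have "card ?ST = card ?D"
    proof -
      have "bij_betw ?f ?D ?ST"
      proof (rule bij_betw_imageI)
        show "inj_on ?f ?D"
        proof (rule inj_onI)
          fix x y assume x: "x \<in> ?D" and y: "y \<in> ?D" and eq: "?f x = ?f y"
          obtain S0 T0 S1 T1 where x': "x = ((S0, T0), S1, T1)" by (metis surj_pair)
          obtain S0' T0' S1' T1' where y': "y = ((S0', T0'), S1', T1')" by (metis surj_pair)
          have cx: "S0 \<in> carrier_mat m0 (a + b)" "T0 \<in> carrier_mat (a + b) m0"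
            "S1 \<in> carrier_mat n (a + b)" "T1 \<in> carrier_mat (a + b) n" using x by (auto simp: x')
          have cy: "S0' \<in> carrier_mat m0 (a + b)" "T0' \<in> carrier_mat (a + b) m0"
            "S1' \<in> carrier_mat n (a + b)" "T1' \<in> carrier_mat (a + b) n" using y by (auto simp: y')
          show "x = y"
            using vcat_inj[OF cx(1,3) cy(1,3)] hcat_inj[OF cx(2,4) cy(2,4)] eq by (simp add: x' y')
        qed
        show "?f ` ?D = ?ST"
        proof (intro equalityI subsetI)
          fix z assume "z \<in> ?f ` ?D"
          then obtain S0 T0 S1 T1 where z: "z = (vcat S0 S1, hcat T0 T1)" and
            c: "S0 \<in> carrier_mat m0 (a + b)" "T0 \<in> carrier_mat (a + b) m0"
              "S1 \<in> carrier_mat n (a + b)" "T1 \<in> carrier_mat (a + b) n" and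
            Q: "?Q (S0, T0) (ker_mat (a + b) S1) (im_mat n T1) (T1 * S1)" by auto
          show "z \<in> ?ST"
            using split_cond_iff[OF c g0, of \<mu> \<nu>] Q vcat_carrier[OF c(1,3)] hcat_carrier[OF c(2,4)]
            unfolding z by blast
        next
          fix z assume z: "z \<in> ?ST"
          then obtain S T where z': "z = (S, T)" and S: "S \<in> carrier_mat (m0 + n) (a + b)"
            and T: "T \<in> carrier_mat (a + b) (m0 + n)" by auto
          obtain S0 S1 where S': "S0 \<in> carrier_mat m0 (a + b)" "S1 \<in> carrier_mat n (a + b)" "S = vcat S0 S1"
            using vcat_split[OF S] by blast
          obtain T0 T1 where T': "T0 \<in> carrier_mat (a + b) m0" "T1 \<in> carrier_mat (a + b) n" "T = hcat T0 T1"
            using hcat_split[OF T] by blast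
          have "?Q (S0, T0) (ker_mat (a + b) S1) (im_mat n T1) (T1 * S1)"
            using z split_cond_iff[OF S'(1) T'(1) S'(2) T'(2) g0, of \<mu> \<nu>] unfolding z' S'(3) T'(3) by blast
          hence "((S0, T0), S1, T1) \<in> ?D" using S' T' by blast
          thus "z \<in> ?f ` ?D" unfolding z' S'(3) T'(3) by (rule rev_image_eqI) simp
        qed
      qed
      thus ?thesis by (simp add: bij_betw_same_card)
    qed
    finally show ?thesis .
  qed
  thus ?thesis
    using poly_expr_card_pairs[of ?X "a + b" ?Q] by (simp only:) simp
qed

text \<open>Quadruples overcount factorisations by a constant independent of \<open>n\<close>;
  dividing by it keeps polynomiality but not control over the denominators.\<close>

theorem card_factor_pairs_poly:
  fixes g0 :: "'a::{field,finite} mat"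
  assumes g0: "g0 \<in> GL m0"
  shows "\<exists>p. \<forall>n. of_nat (card (factor_pairs (m0 + n) \<mu> \<nu> (four_block_mat g0 (0\<^sub>m m0 n) (0\<^sub>m n m0) (1\<^sub>m n)))) =
    poly p (of_nat (card (UNIV :: 'a set)) ^ n :: rat)"
proof -
  obtain a b where ab: "has_rank a \<mu>" "has_rank b \<nu>" using has_rank_exists by metis
  let ?u = "\<lambda>a. card (inverse_pairs a :: ('a mat \<times> 'a mat) set)"
  let ?g = "\<lambda>n. four_block_mat g0 (0\<^sub>m m0 n) (0\<^sub>m n m0) (1\<^sub>m n)"
  have u: "?u a > 0" for a
  proof -
    have "finite (inverse_pairs a :: ('a mat \<times> 'a mat) set)"
      unfolding inverse_pairs_def by (rule finite_subset[of _ "carrier_mat a a \<times> carrier_mat a a"]) auto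
    moreover have "(1\<^sub>m a, 1\<^sub>m a) \<in> (inverse_pairs a :: ('a mat \<times> 'a mat) set)"
      by (simp add: inverse_pairs_def)
    ultimately show ?thesis by (auto simp only: card_gt_0_iff)
  qed
  obtain h where g0c: "g0 \<in> carrier_mat m0 m0" and h: "h \<in> carrier_mat m0 m0" "g0 * h = 1\<^sub>m m0" "h * g0 = 1\<^sub>m m0"
    using GL_D[OF g0] by metis
  have gGL: "?g n \<in> GL (m0 + n)" for n
  proof (rule GL_I)
    let ?h = "four_block_mat h (0\<^sub>m m0 n) (0\<^sub>m n m0) (1\<^sub>m n)"
    show "?g n \<in> carrier_mat (m0 + n) (m0 + n)" "?h \<in> carrier_mat (m0 + n) (m0 + n)" using g0c h by auto
    show "?g n * ?h = 1\<^sub>m (m0 + n)" "?h * ?g n = 1\<^sub>m (m0 + n)"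
      using four_block_mult_0[OF g0c one_carrier_mat h(1) one_carrier_mat, of n]
        four_block_mult_0[OF h(1) one_carrier_mat g0c one_carrier_mat, of n] h(2,3) by simp_all
  qed
  obtain p where p: "\<And>n. of_nat (card (factor_quads (m0 + n) a b \<mu> \<nu> (?g n))) =
      poly p (of_nat (card (UNIV :: 'a set)) ^ n :: rat)"
    using poly_expr_card_factor_quads[OF g0c, of a b \<mu> \<nu>] unfolding poly_expr_def by blast
  define c :: rat where "c = of_nat (?u a * ?u b)"
  have c: "c > 0" using u[of a] u[of b] unfolding c_def by simp
  have "of_nat (card (factor_pairs (m0 + n) \<mu> \<nu> (?g n))) =
      poly (smult (1 / c) p) (of_nat (card (UNIV :: 'a set)) ^ n)" for n
  proof -
    have "of_nat (card (factor_quads (m0 + n) a b \<mu> \<nu> (?g n))) = of_nat (card (factor_pairs (m0 + n) \<mu> \<nu> (?g n))) * c"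
      unfolding card_factor_quads[OF ab gGL] c_def by (rule of_nat_mult)
    thus ?thesis using p[of n] c by (simp add: field_simps)
  qed
  thus ?thesis by blast
qed

section \<open>Structure constants\<close>

text \<open>Conjugating both factors at once preserves invertibility and modified types.\<close>

lemma card_factor_pairs_similar:
  fixes g g' :: "'a::{field,finite} mat"
  assumes g: "g \<in> carrier_mat m m" and sim: "similar_mat g g'"
  shows "card (factor_pairs m \<mu> \<nu> g) = card (factor_pairs m \<mu> \<nu> g')"
proof -
  from similar_matD[OF sim] obtain n P Q where c: "{g, g', P, Q} \<subseteq> carrier_mat n n"
    and PQ: "P * Q = 1\<^sub>m n" and QP: "Q * P = 1\<^sub>m n" and gg: "g = P * g' * Q" by blast
  have "n = m" using c g by auto
  hence g': "g' \<in> carrier_mat m m" and P: "P \<in> carrier_mat m m" and Q: "Q \<in> carrier_mat m m"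
    and PQ: "P * Q = 1\<^sub>m m" and QP: "Q * P = 1\<^sub>m m" using c PQ QP by auto
  have conj: "R * (h * k) * S = (R * h * S) * (R * k * S)"
    if "R \<in> carrier_mat m m" "S \<in> carrier_mat m m" "S * R = 1\<^sub>m m" "h \<in> carrier_mat m m" "k \<in> carrier_mat m m"
    for R S h k :: "'a mat"
  proof -
    have hS: "h * S \<in> carrier_mat m m" and kS: "k * S \<in> carrier_mat m m" using that by auto
    have RkS: "R * (k * S) \<in> carrier_mat m m" using that kS by auto
    have "(R * h * S) * (R * k * S) = R * (h * (S * (R * (k * S))))"
      using assoc_mult_mat[OF that(1,4,2)] assoc_mult_mat[OF that(1,5,2)] assoc_mult_mat[OF that(1) hS RkS]
        assoc_mult_mat[OF that(4,2) RkS] by simp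
    also have "S * (R * (k * S)) = k * S" by (rule mult_cancel_one[OF that(2,1) kS that(3)])
    also have "R * (h * (k * S)) = R * (h * k) * S"
      using assoc_mult_mat[OF that(4,5,2)] assoc_mult_mat[OF that(1) mult_carrier_mat[OF that(4,5)] that(2)] by simp
    finally show ?thesis by simp
  qed
  have inv: "R * (S * h * R) * S = h"
    if "R \<in> carrier_mat m m" "S \<in> carrier_mat m m" "R * S = 1\<^sub>m m" "h \<in> carrier_mat m m"
    for R S h :: "'a mat"
  proof -
    have hR: "h * R \<in> carrier_mat m m" using that by auto
    have "R * (S * h * R) = h * R"
      using assoc_mult_mat[OF that(2,4,1)] mult_cancel_one[OF that(1,2) hR that(3)] by simp
    thus ?thesis using assoc_mult_mat[OF that(4,1,2)] that by simp
  qed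
  have maps: "(R * h * S, R * k * S) \<in> factor_pairs m \<mu> \<nu> (R * x * S)"
    if hk: "(h, k) \<in> factor_pairs m \<mu> \<nu> x" and R: "R \<in> carrier_mat m m" and S: "S \<in> carrier_mat m m"
      and RS: "R * S = 1\<^sub>m m" and SR: "S * R = 1\<^sub>m m" for R S h k x :: "'a mat"
  proof -
    have h: "h \<in> carrier_mat m m" "h \<in> GL m" "mod_type_of h = \<mu>" and k: "k \<in> carrier_mat m m" "k \<in> GL m" "mod_type_of k = \<nu>"
      and x: "h * k = x" using hk by (auto simp: factor_pairs_def GL_def)
    have sim: "similar_mat h (R * h * S)" if "h \<in> carrier_mat m m" for h
      using that R S inv[OF S R SR that] RS SR
      by (intro similar_matI[of _ _ S R m]) auto
    have gl: "R * h * S \<in> GL m" if hG: "h \<in> GL m" for h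
    proof -
      obtain h' where h: "h \<in> carrier_mat m m" "h' \<in> carrier_mat m m" "h * h' = 1\<^sub>m m" "h' * h = 1\<^sub>m m"
        using GL_D[OF hG] by metis
      have "R * 1\<^sub>m m * S = 1\<^sub>m m" using R RS by simp
      hence "(R * h * S) * (R * h' * S) = 1\<^sub>m m" "(R * h' * S) * (R * h * S) = 1\<^sub>m m"
        using conj[OF R S SR h(1,2)] conj[OF R S SR h(2,1)] h by simp_all
      thus ?thesis using R S h by (intro GL_I[of _ _ "R * h' * S"]) auto
    qed
    show ?thesis
      using gl h k conj[OF R S SR h(1) k(1)] x mod_type_of_similar[OF h(1) sim[OF h(1)]]
        mod_type_of_similar[OF k(1) sim[OF k(1)]]
      by (simp add: factor_pairs_def)
  qed
  have fp: "h \<in> carrier_mat m m \<and> k \<in> carrier_mat m m" if "(h, k) \<in> factor_pairs m \<mu> \<nu> x" for h k x :: "'a mat"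
    using that by (auto simp: factor_pairs_def GL_def)
  have g'eq: "Q * g * P = g'" unfolding gg by (rule inv[OF Q P QP g'])
  have "bij_betw (\<lambda>(h, k). (Q * h * P, Q * k * P)) (factor_pairs m \<mu> \<nu> g) (factor_pairs m \<mu> \<nu> g')"
  proof (rule bij_betwI[where g = "\<lambda>(h, k). (P * h * Q, P * k * Q)"])
    show "(\<lambda>(h, k). (Q * h * P, Q * k * P)) \<in> factor_pairs m \<mu> \<nu> g \<rightarrow> factor_pairs m \<mu> \<nu> g'"
      using maps[OF _ Q P QP PQ, of _ _ g] unfolding g'eq by auto
    show "(\<lambda>(h, k). (P * h * Q, P * k * Q)) \<in> factor_pairs m \<mu> \<nu> g' \<rightarrow> factor_pairs m \<mu> \<nu> g"
      using maps[OF _ P Q PQ QP, of _ _ g'] unfolding gg[symmetric] by auto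
    show "(\<lambda>(h, k). (P * h * Q, P * k * Q)) ((\<lambda>(h, k). (Q * h * P, Q * k * P)) x) = x"
      if "x \<in> factor_pairs m \<mu> \<nu> g" for x
      using that fp[of "fst x" "snd x" g] inv[OF P Q PQ] by (auto simp: case_prod_beta)
    show "(\<lambda>(h, k). (Q * h * P, Q * k * P)) ((\<lambda>(h, k). (P * h * Q, P * k * Q)) x) = x"
      if "x \<in> factor_pairs m \<mu> \<nu> g'" for x
      using that fp[of "fst x" "snd x" g'] inv[OF Q P QP] by (auto simp: case_prod_beta)
  qed
  thus ?thesis by (rule bij_betw_same_card)
qed

lemma ga_mult_X_class:
  fixes g :: "'a::{field,finite} mat"
  shows "ga_mult m (X_class m \<mu>) (X_class m \<nu>) g = (if g \<in> GL m then of_nat (card (factor_pairs m \<mu> \<nu> g)) else 0)"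
proof (cases "g \<in> GL m")
  case True
  have fin: "finite (GL m :: 'a mat set)"
    by (rule finite_subset[OF _ finite_carrier_mat[of m m]]) (auto simp: GL_def)
  have "(\<Sum>h\<in>GL m. \<Sum>k\<in>GL m. if h * k = g then X_class m \<mu> h * X_class m \<nu> k else 0) =
      (\<Sum>x\<in>GL m \<times> GL m. if x \<in> factor_pairs m \<mu> \<nu> g then 1 else (0 :: rat))"
    unfolding sum.cartesian_product
    by (intro sum.cong) (auto simp: X_class_def factor_pairs_def split: if_splits)
  also have "\<dots> = of_nat (card ((GL m \<times> GL m) \<inter> {x. x \<in> factor_pairs m \<mu> \<nu> g}))"
    using fin by (subst sum.If_cases) auto
  also have "(GL m \<times> GL m) \<inter> {x. x \<in> factor_pairs m \<mu> \<nu> g} = factor_pairs m \<mu> \<nu> g"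
    by (auto simp: factor_pairs_def)
  finally show ?thesis using True by (simp add: ga_mult_def)
qed (simp add: ga_mult_def)

lemma right_invertible_wide:
  fixes X :: "'a::{field,finite} mat"
  assumes X: "X \<in> carrier_mat c e" and Y: "Y \<in> carrier_mat e c" and XY: "X * Y = 1\<^sub>m c"
  shows "c \<le> e"
proof -
  have "inj_on (\<lambda>v. Y *\<^sub>v v) (carrier_vec c)"
    using assoc_mult_mat_vec[OF X Y] XY by (intro inj_on_inverseI[where g = "\<lambda>v. X *\<^sub>v v"]) simp
  hence "card (UNIV :: 'a set) ^ c \<le> card (UNIV :: 'a set) ^ e"
    unfolding card_carrier_vec_finite[symmetric] using Y by (intro card_inj_on_le) auto
  thus ?thesis using two_le_card_field[where 'a = 'a] by (simp add: power_le_imp_le_exp)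
qed

text \<open>\<open>g - 1 = S N T\<close> factors through dimension \<open>a + b\<close>. Hence the
  modified type of \<open>g\<close> is the type of a matrix of size at most \<open>a + b\<close>,
  and a finite field admits only finitely many of these.\<close>

lemma finite_product_types:
  fixes \<mu> \<nu> :: "'a::{field,finite} poly \<Rightarrow> nat multiset"
  shows "finite {mod_type_of g | g m. g \<in> GL m \<and> factor_pairs m \<mu> \<nu> g \<noteq> {}}"
proof -
  obtain a b where a: "has_rank a \<mu>" and b: "has_rank b \<nu>" using has_rank_exists by metis
  have "{mod_type_of g | g m. g \<in> GL m \<and> factor_pairs m \<mu> \<nu> g \<noteq> {}} \<subseteq>
      (\<Union>c\<le>a + b. (\<lambda>Z :: 'a mat. type_of (1\<^sub>m c + Z)) ` carrier_mat c c)"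
  proof
    fix la assume "la \<in> {mod_type_of (g :: 'a mat) | g m. g \<in> GL m \<and> factor_pairs m \<mu> \<nu> g \<noteq> {}}"
    then obtain g :: "'a mat" and m h k where la: "la = mod_type_of g" and g: "g \<in> GL m"
      and "(h, k) \<in> factor_pairs m \<mu> \<nu> g" by auto
    hence hk: "h \<in> GL m" "k \<in> GL m" "mod_type_of h = \<mu>" "mod_type_of k = \<nu>" "h * k = g"
      by (auto simp: factor_pairs_def)
    obtain B C where r: "full_rank_pair m a B C" "h = 1\<^sub>m m + B * C" using a hk unfolding has_rank_def by blast
    obtain D E where s: "full_rank_pair m b D E" "k = 1\<^sub>m m + D * E" using b hk unfolding has_rank_def by blast
    have car: "B \<in> carrier_mat m a" "C \<in> carrier_mat a m" "D \<in> carrier_mat m b" "E \<in> carrier_mat b m"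
      using r s by (auto simp: full_rank_pair_def)
    define S T where "S = hcat B D" and "T = vcat C E"
    have S: "S \<in> carrier_mat m (a + b)" and T: "T \<in> carrier_mat (a + b) m"
      using car by (auto simp: S_def T_def)
    define N where "N = twist a b (T * S)"
    have N: "N \<in> carrier_mat (a + b) (a + b)" unfolding N_def using S T by (intro twist_carrier) simp
    have gST: "g = 1\<^sub>m m + S * N * T"
      unfolding N_def hk(5)[symmetric] r(2) s(2)
      by (rule mult_twist[OF S T])
         (simp_all add: S_def T_def hcat_incl[OF car(1,3)] proj_vcat[OF car(2,4)] hcat_mult_vcat[OF car(1,3,2,4)])
    have "g \<in> carrier_mat m m" using g by (simp add: GL_def)
    from full_rank_pair_exists[OF this] obtain c B3 C3 where t: "full_rank_pair m c B3 C3" "g = 1\<^sub>m m + B3 * C3" by blast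
    then obtain B' C' where B3: "B3 \<in> carrier_mat m c" and C3: "C3 \<in> carrier_mat c m"
      and B': "B' \<in> carrier_mat c m" "B' * B3 = 1\<^sub>m c" and C': "C' \<in> carrier_mat m c" "C3 * C' = 1\<^sub>m c"
      by (auto simp: full_rank_pair_def)
    have SN: "S * N \<in> carrier_mat m (a + b)" using S N by simp
    have eq: "B3 * C3 = S * N * T"
      using one_plus_inj[OF full_rank_pair_mult_carrier[OF t(1)] mult_carrier_mat[OF SN T]] t(2) gST by simp
    have TC: "T * C' \<in> carrier_mat (a + b) c" and BSN: "B' * (S * N) \<in> carrier_mat c (a + b)"
      using T C' B' SN by auto
    \<comment> \<open>The identity of size \<open>c\<close> factors through dimension
      \<open>a + b\<close>, which bounds the rank \<open>c\<close> of \<open>g - 1\<close>.\<close>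
    have "(B' * (S * N)) * (T * C') = B' * ((S * N * T) * C')"
      using assoc_mult_mat[OF B'(1) SN TC] assoc_mult_mat[OF SN T C'(1)] by simp
    also have "S * N * T * C' = B3 * (C3 * C')"
      unfolding eq[symmetric] by (rule assoc_mult_mat[OF B3 C3 C'(1)])
    also have "\<dots> = B3" unfolding C'(2) by (rule right_mult_one_mat[OF B3])
    finally have "(B' * (S * N)) * (T * C') = 1\<^sub>m c" using B'(2) by simp
    hence "c \<le> a + b" by (rule right_invertible_wide[OF BSN TC])
    moreover have "mod_type_of g = type_of (1\<^sub>m c + C3 * B3)"
      unfolding t(2) by (rule mod_type_of_one_plus[OF t(1)])
    moreover have "C3 * B3 \<in> carrier_mat c c" using C3 B3 by simp
    ultimately show "la \<in> (\<Union>c\<le>a + b. (\<lambda>Z :: 'a mat. type_of (1\<^sub>m c + Z)) ` carrier_mat c c)"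
      unfolding la by blast
  qed
  thus ?thesis by (rule finite_subset) simp
qed

lemma structure_polynomial_exists:
  fixes \<mu> \<nu> la :: "'a::{field,finite} poly \<Rightarrow> nat multiset"
  shows "\<exists>p \<in> Rq (card (UNIV :: 'a set)). \<forall>m (g :: 'a mat). g \<in> GL m \<and> mod_type_of g = la \<longrightarrow>
    of_nat (card (factor_pairs m \<mu> \<nu> g)) = poly p (qint (card (UNIV :: 'a set)) m)"
proof (cases "\<exists>m (g :: 'a mat). g \<in> GL m \<and> mod_type_of g = la")
  case False
  \<comment> \<open>If no invertible matrix has this modified type there is nothing to match, and
    the zero polynomial serves.\<close>
  have "(0 :: rat poly) \<in> Rq (card (UNIV :: 'a set))"
    unfolding Rq_def by (intro CollectI exI[of _ 0]) simp
  thus ?thesis using False by (intro bexI[of _ 0]) auto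
next
  case True
  define q where "q = card (UNIV :: 'a set)"
  have q2: "q \<ge> 2" using two_le_card_field[where 'a = 'a] by (simp add: q_def)
  \<comment> \<open>By minimality every matrix of this modified type is at least as large as
    \<open>g0\<close>, hence similar to \<open>g0\<close> extended by an identity block.\<close>
  define m0 where "m0 = (LEAST m. \<exists>g :: 'a mat. g \<in> GL m \<and> mod_type_of g = la)"
  have "\<exists>g :: 'a mat. g \<in> GL m0 \<and> mod_type_of g = la"
    unfolding m0_def using True by (rule LeastI_ex)
  then obtain g0 :: "'a mat" where g0: "g0 \<in> GL m0" "mod_type_of g0 = la" by blast
  have g0c: "g0 \<in> carrier_mat m0 m0" using g0 by (simp add: GL_def)
  let ?g = "\<lambda>n. four_block_mat g0 (0\<^sub>m m0 n) (0\<^sub>m n m0) (1\<^sub>m n)"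
  obtain p where p: "\<And>n. of_nat (card (factor_pairs (m0 + n) \<mu> \<nu> (?g n))) = poly p (of_nat q ^ n :: rat)"
    using card_factor_pairs_poly[OF g0(1), of \<mu> \<nu>] by (auto simp: q_def)
  \<comment> \<open>The substitution recovers the power of \<open>q\<close> from the quantum
    integer: \<open>(1 + (q - 1) [m]) / q ^ m0 = q ^ (m - m0)\<close>.\<close>
  define r where "r = pcompose p [:1 / of_nat q ^ m0, (of_nat q - 1) / of_nat q ^ m0:]"
  have r: "poly r (qint q (m0 + n)) = of_nat (card (factor_pairs (m0 + n) \<mu> \<nu> (?g n)))" for n
  proof -
    have "(of_nat q :: rat) - 1 \<noteq> 0" "(of_nat q :: rat) \<noteq> 0" using q2 by auto
    hence "1 / of_nat q ^ m0 + qint q (m0 + n) * ((of_nat q - 1) / of_nat q ^ m0) = (of_nat q ^ n :: rat)"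
      by (simp add: qint_def power_add field_simps)
    thus ?thesis by (simp add: r_def poly_pcompose p)
  qed
  \<comment> \<open>At \<open>m \<ge> m0\<close> the values are cardinalities; below
    \<open>m0\<close> there is no matrix of this type to count, so only eventual integrality is
    available.\<close>
  have "r \<in> Rq q"
  proof (rule Rq_if_eventually_laurent_values[OF q2])
    fix m assume "m0 \<le> m"
    then obtain n where "m = m0 + n" using le_Suc_ex by blast
    thus "poly r (qint q m) \<in> laurent_ints q"
      using laurent_ints_of_int[of "int (card (factor_pairs (m0 + n) \<mu> \<nu> (?g n)))" q] by (simp add: r)
  qed
  moreover have "of_nat (card (factor_pairs m \<mu> \<nu> g)) = poly r (qint q m)"
    if g: "g \<in> GL m" "mod_type_of g = la" for m and g :: "'a mat"
  proof -
    have le: "m0 \<le> m" unfolding m0_def by (rule Least_le) (use g in blast)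
    have gc: "g \<in> carrier_mat m m" using g by (simp add: GL_def)
    have "similar_mat g (?g (m - m0))"
      by (rule similar_extend_by_identity[OF gc g0c _ le]) (simp add: g g0)
    hence "card (factor_pairs m \<mu> \<nu> g) = card (factor_pairs m \<mu> \<nu> (?g (m - m0)))"
      by (rule card_factor_pairs_similar[OF gc])
    thus ?thesis using r[of "m - m0"] le by simp
  qed
  ultimately show ?thesis unfolding q_def by blast
qed

theorem theorem6p5:
  fixes \<mu> \<nu> :: "'a::{field,finite} poly \<Rightarrow> nat multiset"
  assumes "is_mod_type \<mu>" and "is_mod_type \<nu>"
  shows "\<exists>R :: ('a poly \<Rightarrow> nat multiset) \<Rightarrow> rat poly.
           (\<forall>la. R la \<in> Rq (card (UNIV :: 'a set))) \<and>
           finite {la. is_mod_type la \<and> R la \<noteq> 0} \<and>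
           (\<forall>m::nat. ga_mult m (X_class m \<mu>) (X_class m \<nu>) =
              (\<lambda>g. \<Sum>la\<in>{la. is_mod_type la \<and> R la \<noteq> 0}.
                     poly (R la) (qint (card (UNIV :: 'a set)) m) * X_class m la g))"
proof -
  define q where "q = card (UNIV :: 'a set)"
  define \<Lambda> where "\<Lambda> = {mod_type_of g | (g :: 'a mat) m. g \<in> GL m \<and> factor_pairs m \<mu> \<nu> g \<noteq> {}}"
  have fin: "finite \<Lambda>" unfolding \<Lambda>_def by (rule finite_product_types)
  have "\<forall>la. \<exists>p. p \<in> Rq q \<and> (\<forall>m (g :: 'a mat). g \<in> GL m \<and> mod_type_of g = la \<longrightarrow>
      of_nat (card (factor_pairs m \<mu> \<nu> g)) = poly p (qint q m))"
    using structure_polynomial_exists[of _ \<mu> \<nu>] unfolding q_def by blast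
  then obtain P where P: "\<And>la. P la \<in> Rq q"
    "\<And>la m g. g \<in> GL m \<Longrightarrow> mod_type_of (g :: 'a mat) = la \<Longrightarrow>
      of_nat (card (factor_pairs m \<mu> \<nu> g)) = poly (P la) (qint q m)"
    by metis
  \<comment> \<open>When no matrix has modified type \<open>la\<close>, nothing constrains
    \<open>P la\<close>; the cutoff at \<open>\<Lambda>\<close> is what makes the support
    finite.\<close>
  define R where "R la = (if la \<in> \<Lambda> then P la else 0)" for la
  define F where "F = {la. is_mod_type la \<and> R la \<noteq> 0}"
  have "0 \<in> Rq q" unfolding Rq_def by (intro CollectI exI[of _ 0]) simp
  hence Rq: "R la \<in> Rq q" for la using P(1) by (simp add: R_def)
  have finF: "finite F"
    by (rule finite_subset[OF _ fin]) (auto simp: F_def R_def split: if_splits)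
  have "ga_mult m (X_class m \<mu>) (X_class m \<nu>) g = (\<Sum>la\<in>F. poly (R la) (qint q m) * X_class m la g)"
    for m and g :: "'a mat"
  proof (cases "g \<in> GL m")
    case False
    thus ?thesis by (simp add: ga_mult_X_class X_class_def)
  next
    case True
    let ?la = "mod_type_of g"
    have "(\<Sum>la\<in>F. poly (R la) (qint q m) * X_class m la g) =
        (\<Sum>la\<in>F. if la = ?la then poly (R ?la) (qint q m) else 0)"
      using True by (intro sum.cong) (auto simp: X_class_def)
    also have "\<dots> = (if ?la \<in> F then poly (R ?la) (qint q m) else 0)"
      using finF by simp
    \<comment> \<open>\<open>?la\<close> is a modified type, so it can be missing from
      \<open>F\<close> only if \<open>R ?la = 0\<close>.\<close>
    also have "\<dots> = poly (R ?la) (qint q m)"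
      using is_mod_type_mod_type_of[OF True] by (auto simp: F_def)
    also have "\<dots> = of_nat (card (factor_pairs m \<mu> \<nu> g))"
    proof (cases "?la \<in> \<Lambda>")
      case True
      thus ?thesis using P(2)[OF \<open>g \<in> GL m\<close> refl] by (simp add: R_def)
    next
      case False
      hence "factor_pairs m \<mu> \<nu> g = {}" using True by (auto simp: \<Lambda>_def)
      thus ?thesis using False by (simp add: R_def)
    qed
    finally show ?thesis using True by (simp add: ga_mult_X_class)
  qed
  hence "\<forall>m. ga_mult m (X_class m \<mu>) (X_class m \<nu>) = (\<lambda>g. \<Sum>la\<in>F. poly (R la) (qint q m) * X_class m la g)"
    by blast
  thus ?thesis using Rq finF unfolding F_def q_def by blast
qed

end
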